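(* Let $\mathcal E=(\mathcal E_t)_{t>0}$ and $\mathcal F=(\mathcal F_t)_{t>0}$ be product systems, let $\mathcal M$ be a product subsystem of $\mathcal E$ and let $\mathcal N$ be a product subsystem of $\mathcal F$. Let $\check{\mathcal M}$ denote the cluster of $\mathcal M$ (in $\mathcal E$) and $\check{\mathcal N}$ the cluster of $\mathcal N$ (in $\mathcal F$). Then, inside $\mathcal E\otimes\mathcal F$, $$(\mathcal E\otimes\mathcal N)\bigvee(\mathcal M\otimes\mathcal F)=(\mathcal E\otimes\check{\mathcal N})\bigvee(\check{\mathcal M}\otimes\mathcal F).$$
   Context: A product system is a measurable family $\mathcal E=(\mathcal E_t)_{t>0}$ of nonzero separable complex Hilbert spaces with a measurable family of unitaries $V_{s,t}:\mathcal E_s\otimes\mathcal E_t\to\mathcal E_{s+t}$ ($s,t>0$) such that $V_{r,s+t}(1_{\mathcal E_r}\otimes V_{s,t})=V_{r+s,t}(V_{r,s}\otimes 1_{\mathcal E_t})$ for all $r,s,t>0$. Measurability means: there is a sequence of sections $f^n=(f^n_t)_{t>0}$, $f^n_t\in\mathcal E_t$, such that $\{f^n_t\}_n$ is total in $\mathcal E_t$ for each $t$, all functions $t\mapsto\langle f^m_t,f^n_t\rangle$ are measurable, and all functions $(s,t)\mapsto\langle V_{s,t}(f^k_s\otimes f^l_t),f^m_{s+t}\rangle$ are measurable. A section $(a_t)$ is measurable if all $t\mapsto\langle a_t,f^n_t\rangle$ are measurable. Write $a\circ b=V_{s,t}(a\otimes b)$ for $a\in\mathcal E_s$, $b\in\mathcal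 E_t$. A product subsystem $\mathcal G$ of $\mathcal E$ is a family of nonzero closed subspaces $\mathcal G_t\subset\mathcal E_t$, measurable in the sense that all $t\mapsto\langle P_{\mathcal G_t}f^m_t,f^n_t\rangle$ are measurable ($P_{\mathcal G_t}$ being the orthogonal projection onto $\mathcal G_t$), such that $V_{s,t}$ restricts to a unitary $\mathcal G_s\otimes\mathcal G_t\to\mathcal G_{s+t}$ for all $s,t>0$. For product subsystems $\mathcal G,\mathcal G'$ of a product system, $\mathcal G\bigvee\mathcal G'$ is the product subsystem generated by them: its fiber at $t$ is the closed linear span of all $x_1\circ\cdots\circ x_n$ with $n\ge1$, $t_i>0$, $\sum_i t_i=t$, and $x_i\in\mathcal G_{t_i}\cup\mathcal G'_{t_i}$. The tensor product $\mathcal E\otimes\mathcal F$ has fibers $\mathcal E_t\otimes\mathcal F_t$ and multiplication $(a\otimes b)\circ(a'\otimes b')=(a\circ a')\otimes(b\circ b')$; $\mathcal E\otimes\mathcal N$ denotes the subsystem $(\mathcal E_t\otimes\mathcal N_t)_{t>0}$, and similarly for the others. Cluster: for a product subsystem $\mathcal G$ of $\mathcal E$, put $$\tilde{\mathcal G}_t=\overline{\mathrm{span}}\{x\circ y: x\in\mathcal E_r\ominus\mathcal G_r,\ y\in\mathcal E_{t-r}\ominus\mathcal G_{t-r}\text{ for some }0<r<t\},\qquad \mathcal G'_t=\mathcal E_t\ominus\tilde{\mathcal G}_t,$$ where $\ominus$ denotes orthogonal complement within. One has $\mathcal G'_{s+t}\subset\mathcal G'_s\circ\mathcal G'_t$ (closed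 span of products). The cluster $\check{\mathcal G}$ of $\mathcal G$ is the product subsystem of $\mathcal E$ generated by $(\mathcal G'_t)_{t>0}$, i.e. $\check{\mathcal G}_t$ is the closed linear span of all $x_1\circ\cdots\circ x_n$ with $x_i\in\mathcal G'_{t_i}$, $t_i>0$, $\sum_i t_i=t$. *)

theory Defs
  imports "HOL-Analysis.Analysis"
begin

section \<open>Complex Hilbert spaces\<close>

text \<open>
  The inner product is conjugate-linear in the first and linear in the second argument. Norm,
  metric and topology are those of the underlying real inner product \<open>Re (cinner x y)\<close>.
\<close>

class complex_inner = real_inner +
  fixes scaleC :: "complex \<Rightarrow> 'a \<Rightarrow> 'a"  (infixr "*\<^sub>C" 75)
    and cinner :: "'a \<Rightarrow> 'a \<Rightarrow> complex"
  assumes scaleC_add_right: "a *\<^sub>C (x + y) = a *\<^sub>C x + a *\<^sub>C y"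
    and scaleC_add_left: "(a + b) *\<^sub>C x = a *\<^sub>C x + b *\<^sub>C x"
    and scaleC_scaleC: "a *\<^sub>C (b *\<^sub>C x) = (a * b) *\<^sub>C x"
    and scaleC_of_real: "complex_of_real r *\<^sub>C x = r *\<^sub>R x"
    and cinner_commute: "cinner x y = cnj (cinner y x)"
    and cinner_add_right: "cinner x (y + z) = cinner x y + cinner x z"
    and cinner_scaleC_right: "cinner x (a *\<^sub>C y) = a * cinner x y"
    and inner_eq_Re_cinner: "inner x y = Re (cinner x y)"

class chilbert_space = complex_inner + complete_space

interpretation cvec: vector_space "scaleC :: complex \<Rightarrow> 'a \<Rightarrow> 'a::complex_inner"
proof
  fix x :: 'a
  show "1 *\<^sub>C x = x" using scaleC_of_real[of 1 x] by simp
qed (simp_all add: scaleC_add_right scaleC_add_left scaleC_scaleC)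

lemma cinner_add_left: "cinner (x + y) z = cinner x z + cinner y (z::'a::complex_inner)"
  by (metis cinner_commute cinner_add_right complex_cnj_add)

lemma cinner_scaleC_left: "cinner (a *\<^sub>C x) y = cnj a * cinner x (y::'a::complex_inner)"
  by (metis cinner_commute cinner_scaleC_right complex_cnj_mult)

lemma cinner_zero [simp]: "cinner x 0 = 0" "cinner 0 x = 0" for x :: "'a::complex_inner"
  using cinner_add_right[of x 0 0] cinner_add_left[of 0 0 x] by simp_all

lemma cinner_minus_right: "cinner x (- y) = - cinner x (y::'a::complex_inner)"
  using cinner_add_right[of x y "- y"] by (simp add: add_eq_0_iff)

lemma cinner_minus_left: "cinner (- x) y = - cinner x (y::'a::complex_inner)"
  using cinner_add_left[of x "- x" y] by (simp add: add_eq_0_iff)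

lemma cinner_diff_right: "cinner x (y - z) = cinner x y - cinner x (z::'a::complex_inner)"
  using cinner_add_right[of x y "- z"] by (simp add: cinner_minus_right)

lemma cinner_diff_left: "cinner (x - y) z = cinner x z - cinner y (z::'a::complex_inner)"
  using cinner_add_left[of x "- y" z] by (simp add: cinner_minus_left)

lemma cinner_self: "cinner x x = complex_of_real ((norm x)\<^sup>2)" for x :: "'a::complex_inner"
proof (rule complex_eqI)
  show "Re (cinner x x) = Re (complex_of_real ((norm x)\<^sup>2))"
    by (simp add: power2_norm_eq_inner inner_eq_Re_cinner)
  show "Im (cinner x x) = Im (complex_of_real ((norm x)\<^sup>2))"
    using arg_cong[OF cinner_commute[of x x], of Im] by simp
qed

lemma norm_scaleC: "norm (a *\<^sub>C x) = cmod a * norm (x::'a::complex_inner)"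
proof -
  have "complex_of_real ((norm (a *\<^sub>C x))\<^sup>2) = complex_of_real ((cmod a * norm x)\<^sup>2)"
    unfolding cinner_self[symmetric] cinner_scaleC_left cinner_scaleC_right
    by (simp add: cinner_self power_mult_distrib flip: complex_norm_square)
  then have "(norm (a *\<^sub>C x))\<^sup>2 = (cmod a * norm x)\<^sup>2" using of_real_eq_iff by blast
  then show ?thesis by (simp add: power2_eq_iff_nonneg)
qed

lemma norm_cinner_le: "cmod (cinner x y) \<le> norm x * norm (y::'a::complex_inner)"
proof (cases "cinner x y = 0")
  case False
  define a where "a = cnj (sgn (cinner x y))"
  have "a * cinner x y = complex_of_real ((cmod (cinner x y))\<^sup>2) / cmod (cinner x y)"
    unfolding a_def sgn_eq complex_norm_square by simp
  then have "a * cinner x y = cmod (cinner x y)"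
    by (simp add: power2_eq_square)
  then have "cmod (cinner x y) = Re (cinner x (a *\<^sub>C y))"
    by (simp add: cinner_scaleC_right)
  also have "\<dots> \<le> norm x * norm (a *\<^sub>C y)"
    unfolding inner_eq_Re_cinner[symmetric] by (rule norm_cauchy_schwarz)
  also have "\<dots> = norm x * norm y"
    using False by (simp add: norm_scaleC a_def norm_sgn)
  finally show ?thesis .
qed (simp)

lemma bounded_bilinear_cinner: "bounded_bilinear (cinner :: 'a::complex_inner \<Rightarrow> _)"
proof
  fix r :: real and a b :: 'a
  show "cinner (r *\<^sub>R a) b = r *\<^sub>R cinner a b"
    by (simp add: cinner_scaleC_left scaleR_conv_of_real flip: scaleC_of_real)
  show "cinner a (r *\<^sub>R b) = r *\<^sub>R cinner a b"
    by (simp add: cinner_scaleC_right scaleR_conv_of_real flip: scaleC_of_real)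
  show "\<exists>K. \<forall>a b::'a. norm (cinner a b) \<le> norm a * norm b * K"
    by (rule exI[of _ 1]) (simp add: norm_cinner_le)
qed (simp_all add: cinner_add_left cinner_add_right)

lemmas tendsto_cinner = bounded_bilinear.tendsto[OF bounded_bilinear_cinner]

lemma bounded_linear_scaleC: "bounded_linear (\<lambda>x::'a::complex_inner. a *\<^sub>C x)"
proof (rule bounded_linear_intro[where K = "cmod a"])
  show "a *\<^sub>C (r *\<^sub>R x) = r *\<^sub>R (a *\<^sub>C x)" for r and x :: 'a
    by (simp add: scaleC_scaleC mult.commute flip: scaleC_of_real)
qed (simp_all add: scaleC_add_right norm_scaleC mult.commute)

lemmas tendsto_scaleC = bounded_linear.tendsto[OF bounded_linear_scaleC]

section \<open>Completion\<close>

text \<open>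
  The Hilbert space completion of an inner product space, as Cauchy sequences modulo null
  sequences.
\<close>

definition null_equiv :: "(nat \<Rightarrow> 'a::real_normed_vector) \<Rightarrow> (nat \<Rightarrow> 'a) \<Rightarrow> bool"
  where "null_equiv X Y \<longleftrightarrow> Cauchy X \<and> Cauchy Y \<and> (\<lambda>n. X n - Y n) \<longlonglongrightarrow> 0"

lemma part_equivp_null_equiv: "part_equivp null_equiv"
proof (rule part_equivpI)
  show "\<exists>X::nat \<Rightarrow> 'a. null_equiv X X"
    by (rule exI[of _ "\<lambda>_. 0"]) (simp add: null_equiv_def convergent_Cauchy convergent_const)
  show "symp (null_equiv :: (nat \<Rightarrow> 'a) \<Rightarrow> _)"
  proof (rule sympI)
    fix X Y :: "nat \<Rightarrow> 'a" assume "null_equiv X Y"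
    then show "null_equiv Y X"
      using tendsto_minus[of "\<lambda>n. X n - Y n" 0 sequentially] by (simp add: null_equiv_def)
  qed
  show "transp (null_equiv :: (nat \<Rightarrow> 'a) \<Rightarrow> _)"
  proof (rule transpI)
    fix X Y Z :: "nat \<Rightarrow> 'a" assume "null_equiv X Y" "null_equiv Y Z"
    then show "null_equiv X Z"
      using tendsto_add[of "\<lambda>n. X n - Y n" 0 sequentially "\<lambda>n. Y n - Z n" 0]
      by (simp add: null_equiv_def)
  qed
qed

quotient_type (overloaded) 'a completion = "nat \<Rightarrow> 'a::real_normed_vector" / partial: null_equiv
  by (rule part_equivp_null_equiv)

lemma Cauchy_add: "Cauchy X \<Longrightarrow> Cauchy Y \<Longrightarrow> Cauchy (\<lambda>n. X n + Y n)"
  for X Y :: "nat \<Rightarrow> 'a::real_normed_vector"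
proof (rule metric_CauchyI)
  fix e :: real assume X: "Cauchy X" and Y: "Cauchy Y" and "e > 0"
  then have e: "e / 2 > 0" by simp
  obtain M N where MN: "\<And>m n. m \<ge> M \<Longrightarrow> n \<ge> M \<Longrightarrow> dist (X m) (X n) < e / 2"
      "\<And>m n. m \<ge> N \<Longrightarrow> n \<ge> N \<Longrightarrow> dist (Y m) (Y n) < e / 2"
    using metric_CauchyD[OF X e] metric_CauchyD[OF Y e] by metis
  have "dist (X m + Y m) (X n + Y n) < e" if "m \<ge> max M N" "n \<ge> max M N" for m n
    using MN(1)[of m n] MN(2)[of m n] that dist_triangle_add[of "X m" "Y m" "X n" "Y n"] by simp
  then show "\<exists>K. \<forall>m\<ge>K. \<forall>n\<ge>K. dist (X m + Y m) (X n + Y n) < e" by blast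
qed

lemma Cauchy_minus: "Cauchy X \<Longrightarrow> Cauchy (\<lambda>n. - X n)"
  for X :: "nat \<Rightarrow> 'a::real_normed_vector"
  using bounded_linear.Cauchy[OF bounded_linear_minus[OF bounded_linear_ident]] by blast

lemma Cauchy_diff: "Cauchy X \<Longrightarrow> Cauchy Y \<Longrightarrow> Cauchy (\<lambda>n. X n - Y n)"
  for X Y :: "nat \<Rightarrow> 'a::real_normed_vector"
  using Cauchy_add[OF _ Cauchy_minus, of X Y] by simp

lemma Cauchy_cinner:
  fixes X Y :: "nat \<Rightarrow> 'a::complex_inner"
  assumes X: "Cauchy X" and Y: "Cauchy Y"
  shows "convergent (\<lambda>n. cinner (X n) (Y n))"
proof -
  obtain B C where B: "\<And>n. norm (X n) \<le> B" and C: "\<And>n. norm (Y n) \<le> C" and pos: "B > 0" "C > 0"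
    using cauchy_imp_bounded[OF X] cauchy_imp_bounded[OF Y] by (auto simp: bounded_pos)
  have "Cauchy (\<lambda>n. cinner (X n) (Y n))"
  proof (rule metric_CauchyI)
    fix e :: real assume "e > 0"
    define d where "d = e / (B + C)"
    have d: "d > 0" using pos \<open>e > 0\<close> by (simp add: d_def)
    obtain M N where MN: "\<And>m n. m \<ge> M \<Longrightarrow> n \<ge> M \<Longrightarrow> dist (X m) (X n) < d"
        "\<And>m n. m \<ge> N \<Longrightarrow> n \<ge> N \<Longrightarrow> dist (Y m) (Y n) < d"
      using metric_CauchyD[OF X d] metric_CauchyD[OF Y d] by metis
    have "dist (cinner (X m) (Y m)) (cinner (X n) (Y n)) < e" if "m \<ge> max M N" "n \<ge> max M N" for m n
    proof -
      have "cinner (X m) (Y m) - cinner (X n) (Y n) = cinner (X m - X n) (Y m) + cinner (X n) (Y m - Y n)"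
        by (simp add: cinner_diff_left cinner_diff_right)
      then have "dist (cinner (X m) (Y m)) (cinner (X n) (Y n))
          \<le> norm (X m - X n) * norm (Y m) + norm (X n) * norm (Y m - Y n)"
        unfolding dist_norm by (metis norm_triangle_mono norm_cinner_le)
      also have "\<dots> \<le> norm (X m - X n) * C + B * norm (Y m - Y n)"
        using B C by (intro add_mono mult_left_mono mult_right_mono) auto
      also have "\<dots> < d * C + B * d"
        using MN(1)[of m n] MN(2)[of m n] that pos
        by (intro add_strict_mono) (simp_all add: dist_norm)
      also have "\<dots> = d * (B + C)" by (simp add: algebra_simps)
      also have "\<dots> = e" using pos by (simp add: d_def)
      finally show ?thesis .
    qed
    then show "\<exists>K. \<forall>m\<ge>K. \<forall>n\<ge>K. dist (cinner (X m) (Y m)) (cinner (X n) (Y n)) < e" by blast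
  qed
  then show ?thesis by (simp add: Cauchy_convergent_iff)
qed

lemma tendsto_cinner_lim:
  fixes X Y :: "nat \<Rightarrow> 'a::complex_inner"
  assumes "Cauchy X" "Cauchy Y"
  shows "(\<lambda>n. cinner (X n) (Y n)) \<longlonglongrightarrow> lim (\<lambda>n. cinner (X n) (Y n))"
  using Cauchy_cinner[OF assms] by (simp add: convergent_LIMSEQ_iff)

lemma lim_cinner_cong:
  fixes X Y :: "nat \<Rightarrow> 'a::complex_inner"
  assumes "null_equiv X X'" "null_equiv Y Y'"
  shows "lim (\<lambda>n. cinner (X n) (Y n)) = lim (\<lambda>n. cinner (X' n) (Y' n))"
proof -
  have c: "Cauchy X" "Cauchy X'" "Cauchy Y" "Cauchy Y'"
    and z: "(\<lambda>n. X n - X' n) \<longlonglongrightarrow> 0" "(\<lambda>n. Y n - Y' n) \<longlonglongrightarrow> 0"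
    using assms by (auto simp: null_equiv_def)
  have b: "Bfun X' sequentially" "Bfun Y sequentially"
    using c cauchy_imp_bounded by (auto simp: Bseq_eq_bounded)
  have "(\<lambda>n. cinner (X n - X' n) (Y n) + cinner (X' n) (Y n - Y' n)) \<longlonglongrightarrow> 0"
    using bounded_bilinear.Zfun_prod_Bfun[OF bounded_bilinear_cinner, of "\<lambda>n. X n - X' n" sequentially Y]
      bounded_bilinear.Bfun_prod_Zfun[OF bounded_bilinear_cinner, of X' sequentially "\<lambda>n. Y n - Y' n"]
      z b by (intro tendsto_add_zero) (auto simp: tendsto_Zfun_iff)
  then have "(\<lambda>n. cinner (X n) (Y n) - cinner (X' n) (Y' n)) \<longlonglongrightarrow> 0"
    by (simp add: cinner_diff_left cinner_diff_right)
  from tendsto_diff[OF tendsto_cinner_lim[OF c(1,3)] this]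
  have "(\<lambda>n. cinner (X' n) (Y' n)) \<longlonglongrightarrow> lim (\<lambda>n. cinner (X n) (Y n))" by simp
  then show ?thesis by (metis limI)
qed

instantiation completion :: (complex_inner) complex_inner
begin

lift_definition zero_completion :: "'a completion" is "\<lambda>_. 0"
  by (simp add: null_equiv_def convergent_Cauchy convergent_const)

lift_definition plus_completion :: "'a completion \<Rightarrow> 'a completion \<Rightarrow> 'a completion"
  is "\<lambda>X Y n. X n + Y n"
  subgoal for X X' Y Y'
    using tendsto_add[of "\<lambda>n. X n - X' n" 0 sequentially "\<lambda>n. Y n - Y' n" 0]
    by (simp add: null_equiv_def Cauchy_add algebra_simps)
  done

lift_definition uminus_completion :: "'a completion \<Rightarrow> 'a completion" is "\<lambda>X n. - X n"
  subgoal for X X'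
    using tendsto_minus[of "\<lambda>n. X n - X' n" 0 sequentially]
    by (simp add: null_equiv_def Cauchy_minus algebra_simps)
  done

definition minus_completion :: "'a completion \<Rightarrow> 'a completion \<Rightarrow> 'a completion"
  where "minus_completion x y = x + - y"

lift_definition scaleC_completion :: "complex \<Rightarrow> 'a completion \<Rightarrow> 'a completion"
  is "\<lambda>a X n. a *\<^sub>C X n"
  subgoal for a X X'
    using tendsto_scaleC[of "\<lambda>n. X n - X' n" 0 sequentially a]
    by (simp add: null_equiv_def bounded_linear.Cauchy[OF bounded_linear_scaleC] cvec.scale_right_diff_distrib)
  done

definition scaleR_completion :: "real \<Rightarrow> 'a completion \<Rightarrow> 'a completion"
  where "scaleR_completion r x = complex_of_real r *\<^sub>C x"

lift_definition cinner_completion :: "'a completion \<Rightarrow> 'a completion \<Rightarrow> complex"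
  is "\<lambda>X Y. lim (\<lambda>n. cinner (X n) (Y n))"
  by (rule lim_cinner_cong)

definition inner_completion :: "'a completion \<Rightarrow> 'a completion \<Rightarrow> real"
  where "inner_completion x y = Re (cinner x y)"
definition norm_completion :: "'a completion \<Rightarrow> real"
  where "norm_completion x = sqrt (inner x x)"
definition sgn_completion :: "'a completion \<Rightarrow> 'a completion"
  where "sgn_completion x = scaleR (inverse (norm x)) x"
definition dist_completion :: "'a completion \<Rightarrow> 'a completion \<Rightarrow> real"
  where "dist_completion x y = norm (x - y)"
definition uniformity_completion :: "('a completion \<times> 'a completion) filter"
  where "uniformity_completion = (INF e\<in>{0 <..}. principal {(x, y). dist x y < e})"
definition open_completion :: "'a completion set \<Rightarrow> bool"
  where "open_completion U \<longleftrightarrow> (\<forall>x\<in>U. eventually (\<lambda>(x', y). x' = x \<longrightarrow> y \<in> U) uniformity)"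

instance
proof
  fix x y z :: "'a completion" and a b :: complex and r s :: real
  show add: "x + y + z = x + (y + z)" "x + y = y + x" "0 + x = x" "- x + x = 0"
    by (transfer; simp add: null_equiv_def Cauchy_add convergent_Cauchy convergent_const
        algebra_simps)+
  show "x - y = x + - y" by (simp add: minus_completion_def)
  show sar: "a *\<^sub>C (x + y) = a *\<^sub>C x + a *\<^sub>C y" for a and x y :: "'a completion"
    by transfer (simp add: null_equiv_def Cauchy_add bounded_linear.Cauchy[OF bounded_linear_scaleC]
        scaleC_add_right)
  show sal: "(a + b) *\<^sub>C x = a *\<^sub>C x + b *\<^sub>C x" for a b and x :: "'a completion"
    by transfer (simp add: null_equiv_def Cauchy_add bounded_linear.Cauchy[OF bounded_linear_scaleC]
        scaleC_add_left)
  show ss: "a *\<^sub>C b *\<^sub>C x = (a * b) *\<^sub>C x" for a b and x :: "'a completion"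
    by transfer (simp add: null_equiv_def bounded_linear.Cauchy[OF bounded_linear_scaleC])
  have s1: "1 *\<^sub>C x = x" for x :: "'a completion"
    by transfer (simp add: null_equiv_def bounded_linear.Cauchy[OF bounded_linear_scaleC])
  show "complex_of_real r *\<^sub>C x = r *\<^sub>R x" by (simp add: scaleR_completion_def)
  show "r *\<^sub>R (x + y) = r *\<^sub>R x + r *\<^sub>R y" "(r + s) *\<^sub>R x = r *\<^sub>R x + s *\<^sub>R x"
    "r *\<^sub>R s *\<^sub>R x = (r * s) *\<^sub>R x" "1 *\<^sub>R x = x"
    by (simp_all add: scaleR_completion_def sar sal ss s1)
  show comm: "cinner x y = cnj (cinner y x)" for x y :: "'a completion"
  proof transfer
    fix X Y :: "nat \<Rightarrow> 'a" assume "null_equiv X X" "null_equiv Y Y"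
    then have "Cauchy X" "Cauchy Y" by (auto simp: null_equiv_def)
    from tendsto_cnj[OF tendsto_cinner_lim[OF this(2,1)]]
    show "lim (\<lambda>n. cinner (X n) (Y n)) = cnj (lim (\<lambda>n. cinner (Y n) (X n)))"
      by (intro limI) (simp flip: cinner_commute)
  qed
  show car: "cinner x (y + z) = cinner x y + cinner x z" for x y z :: "'a completion"
  proof transfer
    fix X Y Z :: "nat \<Rightarrow> 'a" assume "null_equiv X X" "null_equiv Y Y" "null_equiv Z Z"
    then have c: "Cauchy X" "Cauchy Y" "Cauchy Z" by (auto simp: null_equiv_def)
    from tendsto_add[OF tendsto_cinner_lim[OF c(1,2)] tendsto_cinner_lim[OF c(1,3)]]
    show "lim (\<lambda>n. cinner (X n) (Y n + Z n))
        = lim (\<lambda>n. cinner (X n) (Y n)) + lim (\<lambda>n. cinner (X n) (Z n))"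
      by (intro limI) (simp add: cinner_add_right)
  qed
  show csr: "cinner x (a *\<^sub>C y) = a * cinner x y" for a and x y :: "'a completion"
  proof transfer
    fix a and X Y :: "nat \<Rightarrow> 'a" assume "null_equiv X X" "null_equiv Y Y"
    then have c: "Cauchy X" "Cauchy Y" by (auto simp: null_equiv_def)
    from tendsto_mult_left[OF tendsto_cinner_lim[OF c]]
    show "lim (\<lambda>n. cinner (X n) (a *\<^sub>C Y n)) = a * lim (\<lambda>n. cinner (X n) (Y n))"
      by (intro limI) (simp add: cinner_scaleC_right)
  qed
  have csl: "cinner (a *\<^sub>C x) y = cnj a * cinner x y" for a and x y :: "'a completion"
    by (metis comm csr complex_cnj_mult)
  have cal: "cinner (x + y) z = cinner x z + cinner y z" for x y z :: "'a completion"
    by (metis comm car complex_cnj_add)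
  show "inner x y = Re (cinner x y)" by (simp add: inner_completion_def)
  show "inner x y = inner y x" using comm[of x y] by (simp add: inner_completion_def)
  show "inner (x + y) z = inner x z + inner y z" by (simp add: inner_completion_def cal)
  show "inner (r *\<^sub>R x) y = r * inner x y"
    by (simp add: inner_completion_def scaleR_completion_def csl)
  have "0 \<le> Re (cinner x x) \<and> (Re (cinner x x) = 0 \<longrightarrow> x = 0)"
  proof transfer
    fix X :: "nat \<Rightarrow> 'a" assume "null_equiv X X"
    then have X: "Cauchy X" by (simp add: null_equiv_def)
    have lim: "(\<lambda>n. (norm (X n))\<^sup>2) \<longlonglongrightarrow> Re (lim (\<lambda>n. cinner (X n) (X n)))"
      using tendsto_Re[OF tendsto_cinner_lim[OF X X]] by (simp add: cinner_self)
    then have "0 \<le> Re (lim (\<lambda>n. cinner (X n) (X n)))"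
      by (rule LIMSEQ_le_const) auto
    moreover have "null_equiv X (\<lambda>_. 0)" if "Re (lim (\<lambda>n. cinner (X n) (X n))) = 0"
    proof -
      have "(\<lambda>n. sqrt ((norm (X n))\<^sup>2)) \<longlonglongrightarrow> sqrt 0" using lim that by (intro tendsto_intros) simp
      then show ?thesis
        using X by (simp add: null_equiv_def convergent_Cauchy convergent_const tendsto_norm_zero_iff)
    qed
    ultimately show "0 \<le> Re (lim (\<lambda>n. cinner (X n) (X n))) \<and>
        (Re (lim (\<lambda>n. cinner (X n) (X n))) = 0 \<longrightarrow> null_equiv X (\<lambda>_. 0))" by blast
  qed
  moreover have "cinner 0 (0 :: 'a completion) = 0"
    by transfer simp
  ultimately show "0 \<le> inner x x" "inner x x = 0 \<longleftrightarrow> x = 0"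
    by (auto simp: inner_completion_def)
qed (simp_all add: norm_completion_def sgn_completion_def dist_completion_def
      uniformity_completion_def open_completion_def)

end

lift_definition to_completion :: "'a::real_normed_vector \<Rightarrow> 'a completion" is "\<lambda>x _. x"
  by (simp add: null_equiv_def convergent_Cauchy convergent_const)

lemma to_completion_add: "to_completion (x + y) = to_completion x + to_completion (y::'a::complex_inner)"
  by transfer (simp add: null_equiv_def convergent_Cauchy convergent_const)

lemma to_completion_scaleC: "to_completion (a *\<^sub>C x) = a *\<^sub>C to_completion (x::'a::complex_inner)"
  by transfer (simp add: null_equiv_def convergent_Cauchy convergent_const)

lemma cinner_to_completion [simp]:
  "cinner (to_completion x) (to_completion y) = cinner x (y::'a::complex_inner)"
  by transfer simp

lemma to_completion_diff: "to_completion (x - y) = to_completion x - to_completion (y::'a::complex_inner)"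
  using to_completion_add[of "x - y" y] by simp

lemma norm_to_completion [simp]: "norm (to_completion x) = norm (x::'a::complex_inner)"
  by (simp add: norm_eq_sqrt_inner inner_eq_Re_cinner)

lemma tendsto_abs_completion:
  fixes X :: "nat \<Rightarrow> 'a::complex_inner"
  assumes X: "Cauchy X"
  shows "(\<lambda>n. to_completion (X n)) \<longlonglongrightarrow> abs_completion X"
proof -
  define x where x: "x = abs_completion X"
  have "(\<lambda>n. to_completion (X n)) \<longlonglongrightarrow> x"
  proof (rule metric_LIMSEQ_I)
    fix e :: real assume "e > 0"
    then obtain M where M: "\<And>m n. m \<ge> M \<Longrightarrow> n \<ge> M \<Longrightarrow> dist (X m) (X n) < e / 2"
      using metric_CauchyD[OF X, of "e / 2"] by auto
    have "dist (to_completion (X n)) x < e" if "n \<ge> M" for n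
    proof -
      have rx: "null_equiv (\<lambda>m. X n - X m) (\<lambda>m. X n - X m)" "null_equiv X X" "null_equiv (\<lambda>_. X n) (\<lambda>_. X n)"
        using X by (simp_all add: null_equiv_def Cauchy_diff convergent_Cauchy convergent_const)
      have "to_completion (X n) - x = abs_completion (\<lambda>m. X n - X m)"
        unfolding minus_completion_def x to_completion.abs_eq
        using rx X by (simp add: uminus_completion.abs_eq plus_completion.abs_eq null_equiv_def Cauchy_minus)
      then have "inner (to_completion (X n) - x) (to_completion (X n) - x)
          = Re (lim (\<lambda>m. cinner (X n - X m) (X n - X m)))"
        using rx by (simp add: inner_eq_Re_cinner cinner_completion.abs_eq)
      moreover have "(\<lambda>m. Re (cinner (X n - X m) (X n - X m)))
          \<longlonglongrightarrow> Re (lim (\<lambda>m. cinner (X n - X m) (X n - X m)))"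
        using rx by (intro tendsto_Re tendsto_cinner_lim) (auto simp: null_equiv_def)
      moreover have "Re (cinner (X n - X m) (X n - X m)) \<le> (e / 2)\<^sup>2" if "m \<ge> M" for m
        using M[of n m] \<open>n \<ge> M\<close> that by (simp add: cinner_self dist_norm power_mono)
      ultimately have "inner (to_completion (X n) - x) (to_completion (X n) - x) \<le> (e / 2)\<^sup>2"
        using LIMSEQ_le_const2[of _ _ "(e / 2)\<^sup>2"] by auto
      then have "dist (to_completion (X n)) x \<le> e / 2"
        unfolding dist_norm power2_norm_eq_inner[symmetric]
        by (rule power2_le_imp_le) (use \<open>e > 0\<close> in simp)
      then show ?thesis using \<open>e > 0\<close> by simp
    qed
    then show "\<exists>N. \<forall>n\<ge>N. dist (to_completion (X n)) x < e" by blast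
  qed
  then show ?thesis by (simp add: x)
qed

lemma completion_approx:
  fixes x :: "'a::complex_inner completion"
  obtains X where "(\<lambda>n. to_completion (X n)) \<longlonglongrightarrow> x"
proof -
  have "\<exists>X. Cauchy X \<and> x = abs_completion X"
  proof (induction x rule: completion.abs_induct)
    fix X :: "nat \<Rightarrow> 'a" assume "null_equiv X X"
    then have "Cauchy X" unfolding null_equiv_def by (rule conjunct1)
    then show "\<exists>Y. Cauchy Y \<and> abs_completion X = abs_completion Y" by (intro exI[of _ X] conjI refl)
  qed
  then show ?thesis using that tendsto_abs_completion by blast
qed

instance completion :: (complex_inner) chilbert_space
proof
  fix S :: "nat \<Rightarrow> 'a completion" assume S: "Cauchy S"
  have "\<exists>v. dist (to_completion v) (S n) < inverse (real (Suc n))" for n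
  proof -
    obtain X where "(\<lambda>n. to_completion (X n)) \<longlonglongrightarrow> S n" by (rule completion_approx)
    then show ?thesis by (metis LIMSEQ_def inverse_positive_iff_positive of_nat_0_less_iff order_refl zero_less_Suc)
  qed
  then obtain V where V: "\<And>n. dist (to_completion (V n)) (S n) < inverse (real (Suc n))" by metis
  have "(\<lambda>n. dist (to_completion (V n)) (S n)) \<longlonglongrightarrow> 0"
    by (rule tendsto_sandwich[OF _ _ tendsto_const LIMSEQ_inverse_real_of_nat])
       (auto intro!: always_eventually less_imp_le V simp del: of_nat_Suc)
  then have d0: "(\<lambda>n. to_completion (V n) - S n) \<longlonglongrightarrow> 0"
    by (simp add: dist_norm tendsto_norm_zero_iff)
  then have "Cauchy (\<lambda>n. S n + (to_completion (V n) - S n))"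
    by (intro Cauchy_add S LIMSEQ_imp_Cauchy)
  then have cV: "Cauchy V"
    by (simp add: Cauchy_def dist_norm flip: to_completion_diff)
  from tendsto_diff[OF tendsto_abs_completion[OF cV] d0] have "S \<longlonglongrightarrow> abs_completion V" by simp
  then show "convergent S" by (rule convergentI)
qed

section \<open>Tensor products of Hilbert spaces\<close>

text \<open>
  A list of pairs \<open>(x\<^sub>i, y\<^sub>i)\<close> represents the finite sum of the elementary tensors
  \<open>x\<^sub>i \<otimes> y\<^sub>i\<close>. Since the functionals \<open>u \<otimes> v \<mapsto> \<langle>u, x\<rangle>\<langle>v, y\<rangle>\<close> separate the points of the
  algebraic tensor product, two lists represent the same element of it iff \<open>pair_eval\<close> agrees
  on them.
\<close>

definition pair_eval :: "('a::complex_inner \<times> 'b::complex_inner) list \<Rightarrow> 'a \<Rightarrow> 'b \<Rightarrow> complex"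
  where "pair_eval xs u v = (\<Sum>(x, y)\<leftarrow>xs. cinner u x * cinner v y)"

definition pair_cinner ::
  "('a::complex_inner \<times> 'b::complex_inner) list \<Rightarrow> ('a \<times> 'b) list \<Rightarrow> complex"
  where "pair_cinner xs ys = (\<Sum>(x, y)\<leftarrow>xs. pair_eval ys x y)"

lemma pair_eval_simps [simp]:
  "pair_eval [] u v = 0"
  "pair_eval ((x, y) # xs) u v = cinner u x * cinner v y + pair_eval xs u v"
  "pair_eval (xs @ ys) u v = pair_eval xs u v + pair_eval ys u v"
  by (simp_all add: pair_eval_def)

lemma pair_cinner_simps [simp]:
  "pair_cinner [] ys = 0"
  "pair_cinner ((x, y) # xs) ys = pair_eval ys x y + pair_cinner xs ys"
  "pair_cinner (xs @ zs) ys = pair_cinner xs ys + pair_cinner zs ys"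
  by (simp_all add: pair_cinner_def)

lemma pair_eval_scale: "pair_eval (map (\<lambda>(x, y). (a *\<^sub>C x, y)) xs) u v = a * pair_eval xs u v"
  by (induction xs) (auto simp: cinner_scaleC_right algebra_simps)

lemma pair_cinner_commute: "pair_cinner xs ys = cnj (pair_cinner ys xs)"
proof -
  have 1: "pair_cinner ys [] = 0" for ys :: "('a \<times> 'b) list"
    by (induction ys) auto
  have 2: "pair_cinner ys ((x, y) # xs) = cnj (pair_eval ys x y) + pair_cinner ys xs"
    for x y and xs ys :: "('a \<times> 'b) list"
    by (induction ys) (auto simp flip: cinner_commute)
  show ?thesis by (induction xs) (auto simp: 1 2)
qed

lemma pair_cinner_cong:
  assumes "\<And>u v. pair_eval xs u v = pair_eval xs' u v" "\<And>u v. pair_eval ys u v = pair_eval ys' u v"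
  shows "pair_cinner xs ys = pair_cinner xs' ys'"
proof -
  have 1: "pair_cinner zs xs = pair_cinner zs xs'"
    if "\<And>u v. pair_eval xs u v = pair_eval xs' u v" for zs xs xs' :: "('a \<times> 'b) list"
    using that by (simp add: pair_cinner_def)
  show ?thesis using 1[OF assms(1)] 1[OF assms(2)] pair_cinner_commute by metis
qed

lemma pair_cinner_nonneg: "0 \<le> Re (pair_cinner xs xs)"
proof (induction "length xs" arbitrary: xs)
  case (Suc n)
  then obtain a b ys where xs: "xs = (a, b) # ys" and n: "n = length ys"
    by (cases xs) auto
  show ?case
  proof (cases "a = 0")
    case True
    then have "pair_cinner xs xs = pair_cinner ys ys"
      by (intro pair_cinner_cong) (auto simp: xs)
    then show ?thesis using Suc n by simp
  next
    case False
    define c where "c x = cinner a x / cinner a a" for x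
    define f where "f = (\<lambda>(x, y::'b). (x - c x *\<^sub>C a, y))"
    have aa: "cinner a a \<noteq> 0" using False by (simp add: cinner_self)
    have "\<exists>B. \<forall>u v. pair_eval zs u v = pair_eval (map f zs) u v + cinner u a * cinner v B" for zs
    proof (induction zs)
      case Nil
      show ?case by (rule exI[of _ 0]) simp
    next
      case (Cons z zs)
      then obtain B where B: "\<And>u v. pair_eval zs u v = pair_eval (map f zs) u v + cinner u a * cinner v B"
        by blast
      show ?case
        by (rule exI[of _ "B + c (fst z) *\<^sub>C snd z"], cases z)
           (simp add: f_def B cinner_diff_right cinner_add_right cinner_scaleC_right algebra_simps)
    qed
    then obtain B where B: "\<And>u v. pair_eval ys u v = pair_eval (map f ys) u v + cinner u a * cinner v B"
      by blast
    have orth: "pair_eval (map f zs) a v = 0" for zs v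
      by (induction zs)
         (auto simp: f_def cinner_diff_right cinner_scaleC_right c_def aa)
    have orth': "pair_cinner (map f ys) [(a, b + B)] = 0"
      by (subst pair_cinner_commute) (simp add: orth)
    have split: "pair_cinner zs ((a, b + B) # ws) = pair_cinner zs [(a, b + B)] + pair_cinner zs ws" for zs ws
      by (induction zs) auto
    have "pair_cinner xs xs = pair_cinner ((a, b + B) # map f ys) ((a, b + B) # map f ys)"
      by (intro pair_cinner_cong) (simp_all add: xs B cinner_add_right algebra_simps)
    also have "\<dots> = cinner a a * cinner (b + B) (b + B) + pair_cinner (map f ys) (map f ys)"
      using split[of "map f ys" "map f ys"] by (simp add: orth orth')
    finally have "Re (pair_cinner xs xs)
        = (norm a)\<^sup>2 * (norm (b + B))\<^sup>2 + Re (pair_cinner (map f ys) (map f ys))"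
      by (simp only: cinner_self of_real_mult[symmetric] plus_complex.simps Re_complex_of_real)
    moreover have "0 \<le> Re (pair_cinner (map f ys) (map f ys))" using Suc n by simp
    ultimately show ?thesis by simp
  qed
qed simp

definition pair_equiv ::
  "('a::complex_inner \<times> 'b::complex_inner) list \<Rightarrow> ('a \<times> 'b) list \<Rightarrow> bool"
  where "pair_equiv xs ys \<longleftrightarrow> (\<forall>u v. pair_eval xs u v = pair_eval ys u v)"

quotient_type (overloaded) ('a, 'b) alg_tensor = "('a::complex_inner \<times> 'b::complex_inner) list" / pair_equiv
  by (rule equivpI) (auto simp: reflp_def symp_def transp_def pair_equiv_def)

instantiation alg_tensor :: (complex_inner, complex_inner) complex_inner
begin

lift_definition zero_alg_tensor :: "('a, 'b) alg_tensor" is "[]" .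

lift_definition plus_alg_tensor :: "('a, 'b) alg_tensor \<Rightarrow> ('a, 'b) alg_tensor \<Rightarrow> ('a, 'b) alg_tensor"
  is "(@)" by (simp add: pair_equiv_def)

lift_definition scaleC_alg_tensor :: "complex \<Rightarrow> ('a, 'b) alg_tensor \<Rightarrow> ('a, 'b) alg_tensor"
  is "\<lambda>a. map (\<lambda>(x, y). (a *\<^sub>C x, y))" by (simp add: pair_equiv_def pair_eval_scale)

lift_definition cinner_alg_tensor :: "('a, 'b) alg_tensor \<Rightarrow> ('a, 'b) alg_tensor \<Rightarrow> complex"
  is pair_cinner by (rule pair_cinner_cong) (auto simp: pair_equiv_def)

definition uminus_alg_tensor :: "('a, 'b) alg_tensor \<Rightarrow> ('a, 'b) alg_tensor"
  where "uminus_alg_tensor x = (- 1) *\<^sub>C x"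
definition minus_alg_tensor :: "('a, 'b) alg_tensor \<Rightarrow> ('a, 'b) alg_tensor \<Rightarrow> ('a, 'b) alg_tensor"
  where "minus_alg_tensor x y = x + - y"
definition scaleR_alg_tensor :: "real \<Rightarrow> ('a, 'b) alg_tensor \<Rightarrow> ('a, 'b) alg_tensor"
  where "scaleR_alg_tensor r x = complex_of_real r *\<^sub>C x"
definition inner_alg_tensor :: "('a, 'b) alg_tensor \<Rightarrow> ('a, 'b) alg_tensor \<Rightarrow> real"
  where "inner_alg_tensor x y = Re (cinner x y)"
definition norm_alg_tensor :: "('a, 'b) alg_tensor \<Rightarrow> real"
  where "norm_alg_tensor x = sqrt (inner x x)"
definition sgn_alg_tensor :: "('a, 'b) alg_tensor \<Rightarrow> ('a, 'b) alg_tensor"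
  where "sgn_alg_tensor x = scaleR (inverse (norm x)) x"
definition dist_alg_tensor :: "('a, 'b) alg_tensor \<Rightarrow> ('a, 'b) alg_tensor \<Rightarrow> real"
  where "dist_alg_tensor x y = norm (x - y)"
definition uniformity_alg_tensor :: "(('a, 'b) alg_tensor \<times> ('a, 'b) alg_tensor) filter"
  where "uniformity_alg_tensor = (INF e\<in>{0 <..}. principal {(x, y). dist x y < e})"
definition open_alg_tensor :: "('a, 'b) alg_tensor set \<Rightarrow> bool"
  where "open_alg_tensor U \<longleftrightarrow> (\<forall>x\<in>U. eventually (\<lambda>(x', y). x' = x \<longrightarrow> y \<in> U) uniformity)"

instance
proof
  fix x y z :: "('a, 'b) alg_tensor" and a b :: complex and r s :: real
  show "x + y + z = x + (y + z)" "x + y = y + x" "0 + x = x"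
    by (transfer; simp add: pair_equiv_def)+
  show "- x + x = 0"
    unfolding uminus_alg_tensor_def
    by transfer (unfold pair_equiv_def pair_eval_simps pair_eval_scale, simp)
  show "x - y = x + - y" by (simp add: minus_alg_tensor_def)
  show sar: "a *\<^sub>C (x + y) = a *\<^sub>C x + a *\<^sub>C y" for a and x y :: "('a, 'b) alg_tensor"
    by transfer (simp add: pair_equiv_def)
  show sal: "(a + b) *\<^sub>C x = a *\<^sub>C x + b *\<^sub>C x" for a b and x :: "('a, 'b) alg_tensor"
    by transfer (unfold pair_equiv_def pair_eval_simps pair_eval_scale, simp add: algebra_simps)
  show ss: "a *\<^sub>C b *\<^sub>C x = (a * b) *\<^sub>C x" for a b and x :: "('a, 'b) alg_tensor"
    by transfer (unfold pair_equiv_def pair_eval_simps pair_eval_scale, simp)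
  have s1: "1 *\<^sub>C x = x" for x :: "('a, 'b) alg_tensor"
    by transfer (simp add: pair_equiv_def pair_eval_scale)
  show "complex_of_real r *\<^sub>C x = r *\<^sub>R x" by (simp add: scaleR_alg_tensor_def)
  show "r *\<^sub>R (x + y) = r *\<^sub>R x + r *\<^sub>R y" "(r + s) *\<^sub>R x = r *\<^sub>R x + s *\<^sub>R x"
    "r *\<^sub>R s *\<^sub>R x = (r * s) *\<^sub>R x" "1 *\<^sub>R x = x"
    by (simp_all add: scaleR_alg_tensor_def sar sal ss s1)
  show comm: "cinner x y = cnj (cinner y x)" for x y :: "('a, 'b) alg_tensor"
    by transfer (rule pair_cinner_commute)
  have cal: "cinner (x + y) z = cinner x z + cinner y z" for x y z :: "('a, 'b) alg_tensor"
    by transfer simp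
  show car: "cinner x (y + z) = cinner x y + cinner x z" for x y z :: "('a, 'b) alg_tensor"
    by (metis comm cal complex_cnj_add)
  show csr: "cinner x (a *\<^sub>C y) = a * cinner x y" for a and x y :: "('a, 'b) alg_tensor"
  proof transfer
    fix a and X Y :: "('a \<times> 'b) list"
    show "pair_cinner X (map (\<lambda>(x, y). (a *\<^sub>C x, y)) Y) = a * pair_cinner X Y"
      by (induction X) (auto simp: pair_eval_scale algebra_simps)
  qed
  have csl: "cinner (a *\<^sub>C x) y = cnj a * cinner x y" for a and x y :: "('a, 'b) alg_tensor"
    by (metis comm csr complex_cnj_mult)
  show "inner x y = Re (cinner x y)" by (simp add: inner_alg_tensor_def)
  show "inner x y = inner y x" using comm[of x y] by (simp add: inner_alg_tensor_def)
  show "inner (x + y) z = inner x z + inner y z" by (simp add: inner_alg_tensor_def cal)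
  show "inner (r *\<^sub>R x) y = r * inner x y"
    by (simp add: inner_alg_tensor_def scaleR_alg_tensor_def csl)
  have pos: "0 \<le> Re (cinner x x)" for x :: "('a, 'b) alg_tensor"
    by transfer (rule pair_cinner_nonneg)
  then show "0 \<le> inner x x" by (simp add: inner_alg_tensor_def)
  have zero: "x = 0" if *: "\<And>y. cinner y x = 0" for x :: "('a, 'b) alg_tensor"
    using * 
  proof transfer
    fix X :: "('a \<times> 'b) list" assume "\<And>Y. pair_cinner Y X = 0"
    from this[of "[(_, _)]"] show "pair_equiv X []" by (simp add: pair_equiv_def)
  qed
  have "x = 0" if x: "Re (cinner x x) = 0"
  proof (rule zero, rule ccontr)
    fix y :: "('a, 'b) alg_tensor" assume y: "cinner y x \<noteq> 0"
    have x0: "cinner x x = 0"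
      using x arg_cong[OF comm[of x x], of Im] by (auto intro!: complex_eqI)
    define p where "p = (cmod (cinner y x))\<^sup>2"
    have p: "p > 0" "cinner y x * cnj (cinner y x) = complex_of_real p"
      using y unfolding p_def complex_norm_square by simp_all
    define t where "t = - complex_of_real ((Re (cinner y y) + 1) / p)"
    have "cinner (y + (t * cnj (cinner y x)) *\<^sub>C x) (y + (t * cnj (cinner y x)) *\<^sub>C x)
        = cinner y y + t * cnj (cinner y x) * cinner y x + cnj t * cinner y x * cinner x y"
      by (simp add: cal car csl csr x0 algebra_simps)
    also have "\<dots> = cinner y y + t * (cinner y x * cnj (cinner y x)) + cnj t * (cinner y x * cnj (cinner y x))"
      by (subst (3) comm) (simp add: mult_ac)
    also have "\<dots> = cinner y y - 2 * complex_of_real (Re (cinner y y) + 1)"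
      unfolding p(2) using p(1) by (simp add: t_def flip: of_real_add of_real_mult of_real_divide)
    finally have "0 \<le> Re (cinner y y - 2 * complex_of_real (Re (cinner y y) + 1))"
      using pos by metis
    then show False using pos[of y] by simp
  qed
  moreover have "cinner 0 (0 :: ('a, 'b) alg_tensor) = 0" by transfer simp
  ultimately show "inner x x = 0 \<longleftrightarrow> x = 0" by (auto simp: inner_alg_tensor_def)
qed (simp_all add: norm_alg_tensor_def sgn_alg_tensor_def dist_alg_tensor_def
      uniformity_alg_tensor_def open_alg_tensor_def)

end

lift_definition alg_pair :: "'a::complex_inner \<Rightarrow> 'b::complex_inner \<Rightarrow> ('a, 'b) alg_tensor"
  is "\<lambda>x y. [(x, y)]" .

text \<open>
  The Hilbert space tensor product is the completion of the algebraic tensor product with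
  respect to \<open>\<langle>x \<otimes> y, x' \<otimes> y'\<rangle> = \<langle>x, x'\<rangle>\<langle>y, y'\<rangle>\<close>.
\<close>

type_synonym ('a, 'b) tensor = "('a, 'b) alg_tensor completion"

definition tensor :: "'a::complex_inner \<Rightarrow> 'b::complex_inner \<Rightarrow> ('a, 'b) tensor"  (infixr "\<otimes>" 76)
  where "x \<otimes> y = to_completion (alg_pair x y)"

lemma cinner_tensor: "cinner (x \<otimes> y) (x' \<otimes> y') = cinner x x' * cinner y y'"
proof -
  have "cinner (alg_pair x y) (alg_pair x' y') = cinner x x' * cinner y y'" by transfer simp
  then show ?thesis by (simp add: tensor_def)
qed

lemma tensor_add_left: "(x + x') \<otimes> y = x \<otimes> y + x' \<otimes> y"
proof -
  have "alg_pair (x + x') y = alg_pair x y + alg_pair x' y"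
    by transfer (simp add: pair_equiv_def cinner_add_right algebra_simps)
  then show ?thesis by (simp add: tensor_def to_completion_add)
qed

lemma tensor_add_right: "x \<otimes> (y + y') = x \<otimes> y + x \<otimes> y'"
proof -
  have "alg_pair x (y + y') = alg_pair x y + alg_pair x y'"
    by transfer (simp add: pair_equiv_def cinner_add_right algebra_simps)
  then show ?thesis by (simp add: tensor_def to_completion_add)
qed

lemma tensor_scaleC_left: "(a *\<^sub>C x) \<otimes> y = a *\<^sub>C (x \<otimes> y)"
proof -
  have "alg_pair (a *\<^sub>C x) y = a *\<^sub>C alg_pair x y" by transfer (simp add: pair_equiv_def)
  then show ?thesis by (simp add: tensor_def to_completion_scaleC)
qed

lemma tensor_scaleC_right: "x \<otimes> (a *\<^sub>C y) = a *\<^sub>C (x \<otimes> y)"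
proof -
  have "alg_pair x (a *\<^sub>C y) = a *\<^sub>C alg_pair x y"
    by transfer (simp add: pair_equiv_def cinner_scaleC_right)
  then show ?thesis by (simp add: tensor_def to_completion_scaleC)
qed

lemma norm_tensor: "norm (x \<otimes> y) = norm x * norm y"
proof -
  have "complex_of_real ((norm (x \<otimes> y))\<^sup>2) = complex_of_real ((norm x * norm y)\<^sup>2)"
    using cinner_tensor[of x y x y] by (simp add: cinner_self power_mult_distrib)
  then have "(norm (x \<otimes> y))\<^sup>2 = (norm x * norm y)\<^sup>2" using of_real_eq_iff by blast
  then show ?thesis by (simp add: power2_eq_iff_nonneg)
qed

lemma bounded_bilinear_tensor: "bounded_bilinear ((\<otimes>) :: 'a::complex_inner \<Rightarrow> 'b::complex_inner \<Rightarrow> _)"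
proof
  fix r :: real and a :: 'a and b :: 'b
  show "(r *\<^sub>R a) \<otimes> b = r *\<^sub>R (a \<otimes> b)" "a \<otimes> (r *\<^sub>R b) = r *\<^sub>R (a \<otimes> b)"
    unfolding scaleC_of_real[symmetric] by (rule tensor_scaleC_left tensor_scaleC_right)+
  show "\<exists>K. \<forall>(a::'a) (b::'b). norm (a \<otimes> b) \<le> norm a * norm b * K"
    by (rule exI[of _ 1]) (simp add: norm_tensor)
qed (rule tensor_add_left tensor_add_right)+

lemma tensor_total: "closure (cvec.span (range (\<lambda>(x, y). x \<otimes> y))) = (UNIV :: ('a::complex_inner, 'b::complex_inner) tensor set)"
proof -
  have 1: "to_completion X \<in> cvec.span (range (\<lambda>(x, y). x \<otimes> y))" for X :: "('a, 'b) alg_tensor"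
  proof (induction X rule: alg_tensor.abs_induct)
    fix xs :: "('a \<times> 'b) list"
    show "to_completion (abs_alg_tensor xs) \<in> cvec.span (range (\<lambda>(x, y). x \<otimes> y))"
    proof (induction xs)
      case Nil
      have "abs_alg_tensor [] = (0 :: ('a, 'b) alg_tensor)" by (simp add: zero_alg_tensor_def)
      moreover have "to_completion (0 :: ('a, 'b) alg_tensor) = 0"
        using to_completion_diff[of 0 "0 :: ('a, 'b) alg_tensor"] by simp
      ultimately show ?case by (simp add: cvec.span_zero)
    next
      case (Cons z zs)
      obtain x y where z: "z = (x, y)" by (cases z)
      have "abs_alg_tensor (z # zs) = alg_pair x y + abs_alg_tensor zs"
        by (simp add: z plus_alg_tensor.abs_eq alg_pair.abs_eq)
      then have "to_completion (abs_alg_tensor (z # zs)) = x \<otimes> y + to_completion (abs_alg_tensor zs)"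
        by (simp add: to_completion_add tensor_def)
      moreover have "x \<otimes> y \<in> cvec.span (range (\<lambda>(x, y). x \<otimes> y))"
        by (rule cvec.span_base) (auto intro: range_eqI[of _ _ "(x, y)"])
      ultimately show ?case using Cons by (simp add: cvec.span_add)
    qed
  qed
  have "x \<in> closure (cvec.span (range (\<lambda>(x, y). x \<otimes> y)))" for x :: "('a, 'b) tensor"
  proof -
    obtain X where "(\<lambda>n. to_completion (X n)) \<longlonglongrightarrow> x" by (rule completion_approx)
    then show ?thesis
      unfolding closure_sequential
      by (intro exI[of _ "\<lambda>n. to_completion (X n)"] conjI allI 1)
  qed
  then show ?thesis by blast
qed

section \<open>Closed subspaces and unitary operators\<close>

abbreviation closed_span :: "'a::complex_inner set \<Rightarrow> 'a set"
  where "closed_span X \<equiv> closure (cvec.span X)"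

lemma subspace_closure:
  assumes "cvec.subspace S" shows "cvec.subspace (closure S)"
proof (rule cvec.subspaceI)
  show "0 \<in> closure S" using cvec.subspace_0[OF assms] closure_subset by blast
  show "x + y \<in> closure S" if xy: "x \<in> closure S" "y \<in> closure S" for x y
  proof -
    obtain X Y where X: "\<And>n. X n \<in> S" "X \<longlonglongrightarrow> x" and Y: "\<And>n. Y n \<in> S" "Y \<longlonglongrightarrow> y"
      using xy unfolding closure_sequential by metis
    have "(\<lambda>n. X n + Y n) \<longlonglongrightarrow> x + y" by (intro tendsto_add X Y)
    then show ?thesis
      unfolding closure_sequential
      using cvec.subspace_add[OF assms X(1) Y(1)] by (intro exI[of _ "\<lambda>n. X n + Y n"]) simp
  qed
  show "c *\<^sub>C x \<in> closure S" if x: "x \<in> closure S" for c x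
  proof -
    obtain X where X: "\<And>n. X n \<in> S" "X \<longlonglongrightarrow> x" using x unfolding closure_sequential by metis
    have "(\<lambda>n. c *\<^sub>C X n) \<longlonglongrightarrow> c *\<^sub>C x" by (intro tendsto_scaleC X)
    then show ?thesis
      unfolding closure_sequential
      using cvec.subspace_scale[OF assms X(1)] by (intro exI[of _ "\<lambda>n. c *\<^sub>C X n"]) simp
  qed
qed

lemma subspace_closed_span: "cvec.subspace (closed_span X)"
  by (intro subspace_closure cvec.subspace_span)

lemma closed_span_superset: "x \<in> X \<Longrightarrow> x \<in> closed_span X"
  using closure_subset cvec.span_base by blast

lemma closed_span_minimal:
  "X \<subseteq> S \<Longrightarrow> closed S \<Longrightarrow> cvec.subspace S \<Longrightarrow> closed_span X \<subseteq> S"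
  by (intro closure_minimal cvec.span_minimal)

lemma closed_span_eq: "closed S \<Longrightarrow> cvec.subspace S \<Longrightarrow> closed_span S = S"
  by (intro antisym closed_span_minimal) (auto intro: closed_span_superset)

text \<open>
  The Hilbert space tensor product of two closed subspaces, realised inside the tensor product
  of the ambient spaces.
\<close>

definition tensor_space :: "'a::complex_inner set \<Rightarrow> 'b::complex_inner set \<Rightarrow> ('a, 'b) tensor set"
    (infixr "\<otimes>\<^sub>H" 76)
  where "H \<otimes>\<^sub>H K = closed_span {x \<otimes> y | x y. x \<in> H \<and> y \<in> K}"

text \<open>
  \<open>V\<close> restricts to a unitary operator from \<open>H\<close> onto \<open>K\<close>; its values outside \<open>H\<close> are irrelevant.
\<close>

definition unitary_between :: "('a::complex_inner \<Rightarrow> 'b::complex_inner) \<Rightarrow> 'a set \<Rightarrow> 'b set \<Rightarrow> bool"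
  where "unitary_between V H K \<longleftrightarrow>
    (\<forall>x\<in>H. \<forall>y\<in>H. V (x + y) = V x + V y) \<and> (\<forall>c. \<forall>x\<in>H. V (c *\<^sub>C x) = c *\<^sub>C V x) \<and>
    (\<forall>x\<in>H. \<forall>y\<in>H. cinner (V x) (V y) = cinner x y) \<and> V ` H = K"

lemma tensor_space_I: "x \<in> H \<Longrightarrow> y \<in> K \<Longrightarrow> x \<otimes> y \<in> H \<otimes>\<^sub>H K"
  unfolding tensor_space_def by (rule closed_span_superset) auto

lemma closed_vimage_tensor: "closed S \<Longrightarrow> closed {x. x \<otimes> y \<in> S}" "closed S \<Longrightarrow> closed {y. x \<otimes> y \<in> S}"
  using continuous_closed_vimage[of S "\<lambda>x. x \<otimes> y"] continuous_closed_vimage[of S "\<lambda>y. x \<otimes> y"]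
    linear_continuous_at[OF bounded_bilinear.bounded_linear_left[OF bounded_bilinear_tensor]]
    linear_continuous_at[OF bounded_bilinear.bounded_linear_right[OF bounded_bilinear_tensor]]
  by (auto simp: vimage_def)

lemma tensor_zero [simp]: "0 \<otimes> y = 0" "x \<otimes> 0 = 0"
  using norm_tensor[of 0 y] norm_tensor[of x 0] by simp_all

lemma tensor_space_closed_span:
  "closed_span A \<otimes>\<^sub>H closed_span B = closed_span {x \<otimes> y | x y. x \<in> A \<and> y \<in> B}"
proof -
  define T where "T = closed_span {x \<otimes> y | x y. x \<in> A \<and> y \<in> B}"
  have T: "closed T" "cvec.subspace T" unfolding T_def by (simp_all add: subspace_closed_span)
  have 1: "closed_span A \<subseteq> {x. x \<otimes> y \<in> T}" if "y \<in> B" for y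
  proof (rule closed_span_minimal)
    show "A \<subseteq> {x. x \<otimes> y \<in> T}" unfolding T_def using that by (auto intro!: closed_span_superset)
    show "cvec.subspace {x. x \<otimes> y \<in> T}"
      by (rule cvec.subspaceI)
        (auto simp: tensor_add_left tensor_scaleC_left cvec.subspace_0 cvec.subspace_add cvec.subspace_scale T)
  qed (simp add: closed_vimage_tensor T)
  have 2: "closed_span B \<subseteq> {y. x \<otimes> y \<in> T}" if "x \<in> closed_span A" for x
  proof (rule closed_span_minimal)
    show "B \<subseteq> {y. x \<otimes> y \<in> T}" using 1 that by auto
    show "cvec.subspace {y. x \<otimes> y \<in> T}"
      by (rule cvec.subspaceI)
        (auto simp: tensor_add_right tensor_scaleC_right cvec.subspace_0 cvec.subspace_add cvec.subspace_scale T)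
  qed (simp add: closed_vimage_tensor T)
  have "closed_span A \<otimes>\<^sub>H closed_span B \<subseteq> T"
    unfolding tensor_space_def using 2 by (intro closed_span_minimal T) auto
  moreover have "T \<subseteq> closed_span A \<otimes>\<^sub>H closed_span B"
    unfolding T_def tensor_space_def
    by (intro closure_mono cvec.span_mono) (auto intro: closed_span_superset)
  ultimately show ?thesis by (simp add: T_def)
qed

lemma unitary_betweenD:
  assumes "unitary_between V H K"
  shows "x \<in> H \<Longrightarrow> y \<in> H \<Longrightarrow> V (x + y) = V x + V y"
    and "x \<in> H \<Longrightarrow> V (c *\<^sub>C x) = c *\<^sub>C V x"
    and "x \<in> H \<Longrightarrow> y \<in> H \<Longrightarrow> cinner (V x) (V y) = cinner x y"
    and "V ` H = K" and "x \<in> H \<Longrightarrow> V x \<in> K"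
  using assms unfolding unitary_between_def by blast+

lemma unitary_between_norm:
  assumes "unitary_between V H K" "cvec.subspace H" "x \<in> H" "y \<in> H"
  shows "norm (V x - V y) = norm (x - y)"
proof -
  have xy: "x - y \<in> H" using assms by (simp add: cvec.subspace_diff)
  have "V x = V ((x - y) + y)" by simp
  also have "\<dots> = V (x - y) + V y" by (rule unitary_betweenD(1)[OF assms(1) xy assms(4)])
  finally have "V x - V y = V (x - y)" by simp
  then show ?thesis
    using unitary_betweenD(3)[OF assms(1) xy xy] by (simp add: norm_eq_sqrt_inner inner_eq_Re_cinner)
qed

lemma unitary_between_continuous:
  assumes "unitary_between V H K" "cvec.subspace H"
  shows "continuous_on H V"
  unfolding continuous_on_iff dist_norm by (metis assms unitary_between_norm)

lemma unitary_image_closed_span: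
  assumes V: "unitary_between V (closed_span X) K"
  shows "closed_span (V ` X) = closure K"
proof
  have sub: "cvec.subspace (closed_span X)" by (rule subspace_closed_span)
  have "0 = V 0"
    using unitary_betweenD(2)[OF V cvec.subspace_0[OF sub], of 0] by simp
  then have "cvec.subspace K"
    unfolding unitary_betweenD(4)[OF V, symmetric]
    using unitary_betweenD(1,2)[OF V, symmetric] sub
    by (intro cvec.subspaceI) (auto simp: cvec.subspace_0 cvec.subspace_add cvec.subspace_scale)
  moreover have "V ` X \<subseteq> K"
    using unitary_betweenD(5)[OF V] closed_span_superset by blast
  ultimately show "closed_span (V ` X) \<subseteq> closure K"
    by (intro closure_mono cvec.span_minimal)
  have "x \<in> X \<Longrightarrow> x \<in> closed_span X" for x by (rule closed_span_superset)
  have span: "V ` cvec.span X \<subseteq> closed_span (V ` X)"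
  proof safe
    fix x assume "x \<in> cvec.span X"
    then have "x \<in> cvec.span X \<and> V x \<in> closed_span (V ` X)"
    proof (induction rule: cvec.span_induct_alt)
      case base
      then show ?case using \<open>0 = V 0\<close> cvec.subspace_0[OF subspace_closed_span] by (simp add: cvec.span_zero)
    next
      case (step c x y)
      then have xy: "x \<in> cvec.span X" "c *\<^sub>C x \<in> cvec.span X" "y \<in> cvec.span X"
        by (simp_all add: cvec.span_base cvec.span_scale)
      then have xy': "x \<in> closed_span X" "c *\<^sub>C x \<in> closed_span X" "y \<in> closed_span X"
        using closure_subset by blast+
      have "V (c *\<^sub>C x + y) = c *\<^sub>C V x + V y"
        using unitary_betweenD(1,2)[OF V] xy' by simp
      moreover have "V x \<in> closed_span (V ` X)" using step by (intro closed_span_superset) auto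
      ultimately show ?case
        using step xy by (simp add: cvec.span_add cvec.subspace_add cvec.subspace_scale subspace_closed_span)
    qed
    then show "V x \<in> closed_span (V ` X)" ..
  qed
  have "V ` closed_span X \<subseteq> closed_span (V ` X)"
    using unitary_between_continuous[OF V sub] span by (intro image_closure_subset) auto
  then show "closure K \<subseteq> closed_span (V ` X)"
    unfolding unitary_betweenD(4)[OF V] by (rule closure_minimal) simp
qed

lemma unitary_betweenI:
  "\<lbrakk>\<And>x y. x \<in> H \<Longrightarrow> y \<in> H \<Longrightarrow> V (x + y) = V x + V y; \<And>c x. x \<in> H \<Longrightarrow> V (c *\<^sub>C x) = c *\<^sub>C V x;
    \<And>x y. x \<in> H \<Longrightarrow> y \<in> H \<Longrightarrow> cinner (V x) (V y) = cinner x y; V ` H = K\<rbrakk> \<Longrightarrow> unitary_between V H K"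
  unfolding unitary_between_def by blast

text \<open>
  Isometric extension: a family \<open>y\<close> with the same Gram matrix as \<open>x\<close> is its image under a
  unitary operator between the closed linear spans.
\<close>

inductive lin_rel :: "'i set \<Rightarrow> ('i \<Rightarrow> 'a) \<Rightarrow> ('i \<Rightarrow> 'b) \<Rightarrow> 'a::complex_inner \<Rightarrow> 'b::complex_inner \<Rightarrow> bool"
  for I x y
  where zero: "lin_rel I x y 0 0"
  | step: "lin_rel I x y u v \<Longrightarrow> i \<in> I \<Longrightarrow> lin_rel I x y (c *\<^sub>C x i + u) (c *\<^sub>C y i + v)"

lemma lin_rel_add: "lin_rel I x y u v \<Longrightarrow> lin_rel I x y u' v' \<Longrightarrow> lin_rel I x y (u + u') (v + v')"
  by (induction rule: lin_rel.induct) (simp_all add: add.assoc lin_rel.step)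

lemma lin_rel_scale: "lin_rel I x y u v \<Longrightarrow> lin_rel I x y (c *\<^sub>C u) (c *\<^sub>C v)"
  by (induction rule: lin_rel.induct) (simp_all add: scaleC_add_right scaleC_scaleC lin_rel.intros)

lemma lin_rel_swap: "lin_rel I x y u v \<Longrightarrow> lin_rel I y x v u"
  by (induction rule: lin_rel.induct) (simp_all add: lin_rel.intros)

lemma lin_rel_span: "lin_rel I x y u v \<Longrightarrow> u \<in> cvec.span (x ` I)"
  by (induction rule: lin_rel.induct)
     (simp_all add: cvec.span_zero cvec.span_add cvec.span_scale cvec.span_base)

lemma lin_rel_total: "u \<in> cvec.span (x ` I) \<Longrightarrow> \<exists>v. lin_rel I x y u v"
proof (induction rule: cvec.span_induct_alt)
  case base
  show ?case by (rule exI, rule lin_rel.zero)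
next
  case (step c a u)
  then obtain i v where "i \<in> I" "a = x i" "lin_rel I x y u v" by auto
  then show ?case using lin_rel.step[of I x y u v i c] by (intro exI) simp
qed

lemma lin_rel_cinner:
  assumes xy: "\<And>i j. i \<in> I \<Longrightarrow> j \<in> I \<Longrightarrow> cinner (x i) (x j) = cinner (y i) (y j)"
    and "lin_rel I x y u v" "lin_rel I x y u' v'"
  shows "cinner u u' = cinner v v'"
proof -
  have 1: "cinner (x i) u' = cinner (y i) v'" if "i \<in> I" for i
    using assms(3) that
    by (induction rule: lin_rel.induct) (simp_all add: cinner_add_right cinner_scaleC_right xy)
  show ?thesis
    using assms(2)
    by (induction rule: lin_rel.induct) (simp_all add: cinner_add_left cinner_scaleC_left 1)
qed

definition lim_rel :: "'i set \<Rightarrow> ('i \<Rightarrow> 'a) \<Rightarrow> ('i \<Rightarrow> 'b) \<Rightarrow> 'a::complex_inner \<Rightarrow> 'b::complex_inner \<Rightarrow> bool"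
  where "lim_rel I x y u v \<longleftrightarrow>
    (\<exists>U V. (\<forall>n. lin_rel I x y (U n) (V n)) \<and> U \<longlonglongrightarrow> u \<and> V \<longlonglongrightarrow> v)"

lemma lim_rel_swap: "lim_rel I x y u v \<Longrightarrow> lim_rel I y x v u"
  unfolding lim_rel_def by (elim exE conjE, intro exI conjI) (auto intro: lin_rel_swap)

lemma lim_rel_total:
  fixes x :: "'i \<Rightarrow> 'a::chilbert_space" and y :: "'i \<Rightarrow> 'b::chilbert_space"
  assumes xy: "\<And>i j. i \<in> I \<Longrightarrow> j \<in> I \<Longrightarrow> cinner (x i) (x j) = cinner (y i) (y j)"
    and u: "u \<in> closed_span (x ` I)"
  shows "\<exists>v. lim_rel I x y u v"
proof -
  obtain U where U: "\<And>n. U n \<in> cvec.span (x ` I)" "U \<longlonglongrightarrow> u"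
    using u unfolding closure_sequential by metis
  obtain V where V: "\<And>n. lin_rel I x y (U n) (V n)" using lin_rel_total[OF U(1), of y] by metis
  have "norm (V m - V n) = norm (U m - U n)" for m n
  proof -
    have "lin_rel I x y (U m + (- 1) *\<^sub>C U n) (V m + (- 1) *\<^sub>C V n)"
      by (intro lin_rel_add lin_rel_scale V)
    from lin_rel_cinner[OF xy this this] show ?thesis
      by (simp add: norm_eq_sqrt_inner inner_eq_Re_cinner)
  qed
  then have "Cauchy V"
    using LIMSEQ_imp_Cauchy[OF U(2)] by (simp add: Cauchy_def dist_norm)
  then obtain v where "V \<longlonglongrightarrow> v" using Cauchy_convergent convergent_def by blast
  then show ?thesis unfolding lim_rel_def using U V by (intro exI conjI allI)
qed

lemma lim_rel_closed_span: "lim_rel I x y u v \<Longrightarrow> u \<in> closed_span (x ` I)"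
  unfolding lim_rel_def closure_sequential
  by (elim exE conjE, intro exI conjI) (auto intro: lin_rel_span)

lemma lim_rel_cinner:
  assumes xy: "\<And>i j. i \<in> I \<Longrightarrow> j \<in> I \<Longrightarrow> cinner (x i) (x j) = cinner (y i) (y j)"
    and "lim_rel I x y u v" "lim_rel I x y u' v'"
  shows "cinner u u' = cinner v v'"
proof -
  obtain U V where 1: "\<And>n. lin_rel I x y (U n) (V n)" "U \<longlonglongrightarrow> u" "V \<longlonglongrightarrow> v"
    using assms(2) unfolding lim_rel_def by metis
  obtain U' V' where 2: "\<And>n. lin_rel I x y (U' n) (V' n)" "U' \<longlonglongrightarrow> u'" "V' \<longlonglongrightarrow> v'"
    using assms(3) unfolding lim_rel_def by metis
  have "cinner (U n) (U' n) = cinner (V n) (V' n)" for n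
    by (rule lin_rel_cinner[OF xy 1(1) 2(1)])
  then show ?thesis
    using tendsto_cinner[OF 1(2) 2(2)] tendsto_cinner[OF 1(3) 2(3)] LIMSEQ_unique by simp
qed

lemma lim_rel_add:
  assumes "lim_rel I x y u v" "lim_rel I x y u' v'"
  shows "lim_rel I x y (u + u') (v + v')"
proof -
  obtain U V U' V' where "\<And>n. lin_rel I x y (U n) (V n)" "U \<longlonglongrightarrow> u" "V \<longlonglongrightarrow> v"
    and "\<And>n. lin_rel I x y (U' n) (V' n)" "U' \<longlonglongrightarrow> u'" "V' \<longlonglongrightarrow> v'"
    using assms unfolding lim_rel_def by blast
  then show ?thesis
    unfolding lim_rel_def
    by (intro exI[of _ "\<lambda>n. U n + U' n"] exI[of _ "\<lambda>n. V n + V' n"])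
       (simp add: lin_rel_add tendsto_add)
qed

lemma lim_rel_scale:
  assumes "lim_rel I x y u v" shows "lim_rel I x y (c *\<^sub>C u) (c *\<^sub>C v)"
proof -
  obtain U V where "\<And>n. lin_rel I x y (U n) (V n)" "U \<longlonglongrightarrow> u" "V \<longlonglongrightarrow> v"
    using assms unfolding lim_rel_def by blast
  then show ?thesis
    unfolding lim_rel_def
    by (intro exI[of _ "\<lambda>n. c *\<^sub>C U n"] exI[of _ "\<lambda>n. c *\<^sub>C V n"])
       (simp add: lin_rel_scale tendsto_scaleC)
qed

lemma unitary_extension:
  fixes x :: "'i \<Rightarrow> 'a::chilbert_space" and y :: "'i \<Rightarrow> 'b::chilbert_space"
  assumes xy: "\<And>i j. i \<in> I \<Longrightarrow> j \<in> I \<Longrightarrow> cinner (x i) (x j) = cinner (y i) (y j)"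
  shows "\<exists>V. unitary_between V (closed_span (x ` I)) (closed_span (y ` I)) \<and> (\<forall>i\<in>I. V (x i) = y i)"
proof -
  define V where "V u = (SOME v. lim_rel I x y u v)" for u
  have V: "lim_rel I x y u (V u)" if "u \<in> closed_span (x ` I)" for u
    unfolding V_def using lim_rel_total[where y = y, OF xy that] by (rule someI_ex)
  have uniq: "v = v'" if "lim_rel I x y u v" "lim_rel I x y u v'" for u v v'
  proof -
    have "lim_rel I x y (u + (- 1) *\<^sub>C u) (v + (- 1) *\<^sub>C v')"
      by (intro lim_rel_add lim_rel_scale that)
    from lim_rel_cinner[OF xy this this] show ?thesis by (simp add: cinner_self)
  qed
  have eq: "V u = v" if "lim_rel I x y u v" for u v
    by (rule uniq[OF V[OF lim_rel_closed_span[OF that]] that])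
  have "unitary_between V (closed_span (x ` I)) (closed_span (y ` I))"
  proof (rule unitary_betweenI)
    fix u u' assume u: "u \<in> closed_span (x ` I)" "u' \<in> closed_span (x ` I)"
    show "V (u + u') = V u + V u'" by (intro eq lim_rel_add V u)
    show "cinner (V u) (V u') = cinner u u'"
      by (rule sym, rule lim_rel_cinner[OF xy V[OF u(1)] V[OF u(2)]])
  next
    fix c u assume u: "u \<in> closed_span (x ` I)"
    show "V (c *\<^sub>C u) = c *\<^sub>C V u" by (intro eq lim_rel_scale V u)
  next
    show "V ` closed_span (x ` I) = closed_span (y ` I)"
    proof (intro antisym subsetI)
      fix v assume "v \<in> V ` closed_span (x ` I)"
      then show "v \<in> closed_span (y ` I)"
        using lim_rel_closed_span[OF lim_rel_swap[OF V]] by blast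
    next
      fix v assume "v \<in> closed_span (y ` I)"
      from lim_rel_total[where y = x, OF xy[symmetric] this]
      obtain u where "lim_rel I y x v u" by blast
      then have "lim_rel I x y u v" by (rule lim_rel_swap)
      then show "v \<in> V ` closed_span (x ` I)"
        using eq[of u v] lim_rel_closed_span[of I x y u v] by blast
    qed
  qed
  moreover have "V (x i) = y i" if "i \<in> I" for i
  proof (rule eq)
    have "lin_rel I x y (1 *\<^sub>C x i + 0) (1 *\<^sub>C y i + 0)"
      by (intro lin_rel.intros that)
    then have "lin_rel I x y (x i) (y i)" by simp
    then show "lim_rel I x y (x i) (y i)"
      unfolding lim_rel_def by (intro exI[of _ "\<lambda>_. x i"] exI[of _ "\<lambda>_. y i"]) simp
  qed
  ultimately show ?thesis by blast
qed

section \<open>Product systems\<close>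

text \<open>
  The fibres \<open>E\<^sub>t\<close>, \<open>t > 0\<close>, are closed subspaces of one ambient Hilbert space, which need not be
  separable. This is no restriction: a family of Hilbert spaces embeds into its Hilbert space
  direct sum, and no relation between different fibres is imposed. The measurable structure is
  given by the sequence \<open>sec\<close> of sections. All components are meant for positive arguments only.
\<close>

record (overloaded) 'a psys =
  fibre :: "real \<Rightarrow> 'a set"
  mul :: "real \<Rightarrow> real \<Rightarrow> ('a, 'a) tensor \<Rightarrow> 'a"
  sec :: "nat \<Rightarrow> real \<Rightarrow> 'a"

text \<open>
  Totality of the countable family of sections makes the fibres separable and forces
  \<open>sec E n t \<in> fibre E t\<close>. The associativity law is stated on elementary tensors, which are total.
  Measurability is Borel measurability.
\<close>

definition product_system :: "'a::chilbert_space psys \<Rightarrow> bool"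
  where "product_system E \<longleftrightarrow>
    (\<forall>t>0. cvec.subspace (fibre E t) \<and> closed (fibre E t) \<and> fibre E t \<noteq> {0}) \<and>
    (\<forall>s>0. \<forall>t>0. unitary_between (mul E s t) (fibre E s \<otimes>\<^sub>H fibre E t) (fibre E (s + t))) \<and>
    (\<forall>r>0. \<forall>s>0. \<forall>t>0. \<forall>a\<in>fibre E r. \<forall>b\<in>fibre E s. \<forall>c\<in>fibre E t.
      mul E r (s + t) (a \<otimes> mul E s t (b \<otimes> c)) = mul E (r + s) t (mul E r s (a \<otimes> b) \<otimes> c)) \<and>
    (\<forall>t>0. closed_span (range (\<lambda>n. sec E n t)) = fibre E t) \<and>
    (\<forall>m n. (\<lambda>t. cinner (sec E m t) (sec E n t)) \<in> borel_measurable (restrict_space borel {0<..})) \<and>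
    (\<forall>k l m. (\<lambda>(s, t). cinner (mul E s t (sec E k s \<otimes> sec E l t)) (sec E m (s + t)))
      \<in> borel_measurable (restrict_space borel ({0<..} \<times> {0<..})))"

definition orth_proj :: "'a::complex_inner set \<Rightarrow> 'a \<Rightarrow> 'a"
  where "orth_proj S x = (THE y. y \<in> S \<and> (\<forall>z\<in>S. cinner z (x - y) = 0))"

definition product_subsystem :: "'a::chilbert_space psys \<Rightarrow> (real \<Rightarrow> 'a set) \<Rightarrow> bool"
  where "product_subsystem E G \<longleftrightarrow>
    (\<forall>t>0. cvec.subspace (G t) \<and> closed (G t) \<and> G t \<noteq> {0} \<and> G t \<subseteq> fibre E t) \<and>
    (\<forall>m n. (\<lambda>t. cinner (orth_proj (G t) (sec E m t)) (sec E n t))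
      \<in> borel_measurable (restrict_space borel {0<..})) \<and>
    (\<forall>s>0. \<forall>t>0. unitary_between (mul E s t) (G s \<otimes>\<^sub>H G t) (G (s + t)))"

text \<open>
  \<open>x\<^sub>1 \<circ> \<dots> \<circ> x\<^sub>n\<close> for a list of pairs \<open>(t\<^sub>i, x\<^sub>i)\<close>, bracketed to the right. The value on the empty
  list is a dummy.
\<close>

fun iter_prod :: "'a::chilbert_space psys \<Rightarrow> (real \<times> 'a) list \<Rightarrow> 'a"
  where
    "iter_prod E [] = 0"
  | "iter_prod E [(t, x)] = x"
  | "iter_prod E ((t, x) # p # ps) =
      mul E t (sum_list (map fst (p # ps))) (x \<otimes> iter_prod E (p # ps))"

definition generated :: "'a::chilbert_space psys \<Rightarrow> (real \<Rightarrow> 'a set) \<Rightarrow> real \<Rightarrow> 'a set"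
  where "generated E A t = closed_span {iter_prod E ps | ps.
    ps \<noteq> [] \<and> (\<forall>(s, x)\<in>set ps. 0 < s \<and> x \<in> A s) \<and> sum_list (map fst ps) = t}"

definition join :: "'a::chilbert_space psys \<Rightarrow> (real \<Rightarrow> 'a set) \<Rightarrow> (real \<Rightarrow> 'a set) \<Rightarrow> real \<Rightarrow> 'a set"
  where "join E G G' = generated E (\<lambda>t. G t \<union> G' t)"

definition orth_in :: "'a::complex_inner set \<Rightarrow> 'a set \<Rightarrow> 'a set"  (infixl "\<ominus>" 65)
  where "H \<ominus> S = {x \<in> H. \<forall>y\<in>S. cinner x y = 0}"

definition cluster_tilde :: "'a::chilbert_space psys \<Rightarrow> (real \<Rightarrow> 'a set) \<Rightarrow> real \<Rightarrow> 'a set"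
  where "cluster_tilde E G t = closed_span {mul E r (t - r) (x \<otimes> y) | r x y.
    0 < r \<and> r < t \<and> x \<in> fibre E r \<ominus> G r \<and> y \<in> fibre E (t - r) \<ominus> G (t - r)}"

definition cluster_prime :: "'a::chilbert_space psys \<Rightarrow> (real \<Rightarrow> 'a set) \<Rightarrow> real \<Rightarrow> 'a set"
  where "cluster_prime E G t = fibre E t \<ominus> cluster_tilde E G t"

definition cluster :: "'a::chilbert_space psys \<Rightarrow> (real \<Rightarrow> 'a set) \<Rightarrow> real \<Rightarrow> 'a set"
  where "cluster E G = generated E (cluster_prime E G)"

text \<open>
  For families of subspaces \<open>G\<^sub>t \<subseteq> E\<^sub>t\<close> and \<open>H\<^sub>t \<subseteq> F\<^sub>t\<close>, the family \<open>G\<^sub>t \<otimes> H\<^sub>t\<close> inside \<open>E\<^sub>t \<otimes> F\<^sub>t\<close>.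
\<close>

definition tensor_family ::
  "(real \<Rightarrow> 'a::complex_inner set) \<Rightarrow> (real \<Rightarrow> 'b::complex_inner set) \<Rightarrow> real \<Rightarrow> ('a, 'b) tensor set"
  where "tensor_family G H t = G t \<otimes>\<^sub>H H t"

text \<open>
  The unitary determined by \<open>(a \<otimes> b) \<circ> (a' \<otimes> b') = (a \<circ> a') \<otimes> (b \<circ> b')\<close>; it exists by
  \<open>tensor_mul_exists\<close> below.
\<close>

definition tensor_mul :: "'a::chilbert_space psys \<Rightarrow> 'b::chilbert_space psys \<Rightarrow> real \<Rightarrow> real
    \<Rightarrow> (('a, 'b) tensor, ('a, 'b) tensor) tensor \<Rightarrow> ('a, 'b) tensor"
  where "tensor_mul E F s t = (SOME V.
    unitary_between V
      ((fibre E s \<otimes>\<^sub>H fibre F s) \<otimes>\<^sub>H (fibre E t \<otimes>\<^sub>H fibre F t)) (fibre E (s + t) \<otimes>\<^sub>H fibre F (s + t)) \<and>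
    (\<forall>a\<in>fibre E s. \<forall>b\<in>fibre F s. \<forall>a'\<in>fibre E t. \<forall>b'\<in>fibre F t.
      V ((a \<otimes> b) \<otimes> (a' \<otimes> b')) = mul E s t (a \<otimes> a') \<otimes> mul F s t (b \<otimes> b')))"

definition tensor_psys :: "'a::chilbert_space psys \<Rightarrow> 'b::chilbert_space psys \<Rightarrow> ('a, 'b) tensor psys"
  where "tensor_psys E F = \<lparr>
    fibre = tensor_family (fibre E) (fibre F),
    mul = tensor_mul E F,
    sec = (\<lambda>n t. sec E (fst (prod_decode n)) t \<otimes> sec F (snd (prod_decode n)) t)\<rparr>"

lemma product_systemD:
  assumes "product_system E"
  shows "0 < t \<Longrightarrow> cvec.subspace (fibre E t)" "0 < t \<Longrightarrow> closed (fibre E t)" "0 < t \<Longrightarrow> fibre E t \<noteq> {0}"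
    and "0 < s \<Longrightarrow> 0 < t \<Longrightarrow> unitary_between (mul E s t) (fibre E s \<otimes>\<^sub>H fibre E t) (fibre E (s + t))"
    and "0 < r \<Longrightarrow> 0 < s \<Longrightarrow> 0 < t \<Longrightarrow> a \<in> fibre E r \<Longrightarrow> b \<in> fibre E s \<Longrightarrow> c \<in> fibre E t \<Longrightarrow>
      mul E r (s + t) (a \<otimes> mul E s t (b \<otimes> c)) = mul E (r + s) t (mul E r s (a \<otimes> b) \<otimes> c)"
    and "0 < t \<Longrightarrow> closed_span (range (\<lambda>n. sec E n t)) = fibre E t"
    and "(\<lambda>t. cinner (sec E m t) (sec E n t)) \<in> borel_measurable (restrict_space borel {0<..})"
    and "(\<lambda>(s, t). cinner (mul E s t (sec E k s \<otimes> sec E l t)) (sec E m (s + t)))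
      \<in> borel_measurable (restrict_space borel ({0<..} \<times> {0<..}))"
  using assms unfolding product_system_def by simp_all

lemma mul_in_fibre:
  assumes "product_system E" "0 < s" "0 < t" "a \<in> fibre E s" "b \<in> fibre E t"
  shows "mul E s t (a \<otimes> b) \<in> fibre E (s + t)"
  by (intro unitary_betweenD(5)[OF product_systemD(4)] tensor_space_I assms)

lemma sec_in_fibre: "product_system E \<Longrightarrow> 0 < t \<Longrightarrow> sec E n t \<in> fibre E t"
  by (subst product_systemD(6)[symmetric]) (auto intro: closed_span_superset)

lemma tensor_mul_exists:
  assumes E: "product_system E" and F: "product_system F" and st: "0 < s" "0 < t"
  shows "\<exists>V. unitary_between V
      ((fibre E s \<otimes>\<^sub>H fibre F s) \<otimes>\<^sub>H (fibre E t \<otimes>\<^sub>H fibre F t)) (fibre E (s + t) \<otimes>\<^sub>H fibre F (s + t)) \<and>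
    (\<forall>a\<in>fibre E s. \<forall>b\<in>fibre F s. \<forall>a'\<in>fibre E t. \<forall>b'\<in>fibre F t.
      V ((a \<otimes> b) \<otimes> (a' \<otimes> b')) = mul E s t (a \<otimes> a') \<otimes> mul F s t (b \<otimes> b'))"
proof -
  define I where "I = {((a, b), (a', b')) | a b a' b'.
    a \<in> fibre E s \<and> b \<in> fibre F s \<and> a' \<in> fibre E t \<and> b' \<in> fibre F t}"
  define x where "x = (\<lambda>((a :: 'a, b :: 'b), (a' :: 'a, b' :: 'b)). (a \<otimes> b) \<otimes> (a' \<otimes> b'))"
  define y where "y = (\<lambda>((a, b), (a', b')). mul E s t (a \<otimes> a') \<otimes> mul F s t (b \<otimes> b'))"
  have xy: "cinner (x i) (x j) = cinner (y i) (y j)" if iI: "i \<in> I" and jI: "j \<in> I" for i j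
  proof -
    obtain a b a' b' where i: "i = ((a, b), (a', b'))"
      and i': "a \<in> fibre E s" "b \<in> fibre F s" "a' \<in> fibre E t" "b' \<in> fibre F t"
      using iI unfolding I_def by blast
    obtain c d c' d' where j: "j = ((c, d), (c', d'))"
      and j': "c \<in> fibre E s" "d \<in> fibre F s" "c' \<in> fibre E t" "d' \<in> fibre F t"
      using jI unfolding I_def by blast
    have "cinner (mul E s t (a \<otimes> a')) (mul E s t (c \<otimes> c')) = cinner (a \<otimes> a') (c \<otimes> c')"
      by (intro unitary_betweenD(3)[OF product_systemD(4)[OF E st]] tensor_space_I i' j')
    moreover have "cinner (mul F s t (b \<otimes> b')) (mul F s t (d \<otimes> d')) = cinner (b \<otimes> b') (d \<otimes> d')"
      by (intro unitary_betweenD(3)[OF product_systemD(4)[OF F st]] tensor_space_I i' j')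
    ultimately show ?thesis by (simp add: i j x_def y_def cinner_tensor)
  qed
  have "(fibre E s \<otimes>\<^sub>H fibre F s) \<otimes>\<^sub>H (fibre E t \<otimes>\<^sub>H fibre F t) = closed_span (x ` I)"
  proof -
    have "{p \<otimes> q | p q. p \<in> {a \<otimes> b | a b. a \<in> fibre E s \<and> b \<in> fibre F s} \<and>
        q \<in> {a \<otimes> b | a b. a \<in> fibre E t \<and> b \<in> fibre F t}} = x ` I" (is "?L = _")
    proof
      show "?L \<subseteq> x ` I"
      proof safe
        fix a b a' b' assume "a \<in> fibre E s" "b \<in> fibre F s" "a' \<in> fibre E t" "b' \<in> fibre F t"
        then show "(a \<otimes> b) \<otimes> (a' \<otimes> b') \<in> x ` I"
          by (intro image_eqI[of _ x "((a, b), (a', b'))"]) (auto simp: x_def I_def)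
      qed
      show "x ` I \<subseteq> ?L" by (auto simp: x_def I_def)
    qed
    then show ?thesis
      unfolding tensor_space_def[of "fibre E s" "fibre F s"] tensor_space_def[of "fibre E t" "fibre F t"]
      by (simp add: tensor_space_closed_span)
  qed
  moreover have "fibre E (s + t) \<otimes>\<^sub>H fibre F (s + t) = closed_span (y ` I)"
  proof -
    have gen: "fibre G (s + t) = closed_span (mul G s t ` {a \<otimes> a' | a a'. a \<in> fibre G s \<and> a' \<in> fibre G t})"
      if "product_system G" for G :: "'c::chilbert_space psys"
      using unitary_image_closed_span[OF product_systemD(4)[OF that st, unfolded tensor_space_def]]
        product_systemD(2)[OF that, of "s + t"] st by (simp add: closure_closed)
    have "{p \<otimes> q | p q. p \<in> mul E s t ` {a \<otimes> a' | a a'. a \<in> fibre E s \<and> a' \<in> fibre E t} \<and>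
        q \<in> mul F s t ` {a \<otimes> a' | a a'. a \<in> fibre F s \<and> a' \<in> fibre F t}} = y ` I" (is "?L = _")
    proof
      show "?L \<subseteq> y ` I"
      proof safe
        fix a b a' b' assume "a \<in> fibre E s" "b \<in> fibre F s" "a' \<in> fibre E t" "b' \<in> fibre F t"
        then show "mul E s t (a \<otimes> a') \<otimes> mul F s t (b \<otimes> b') \<in> y ` I"
          by (intro image_eqI[of _ y "((a, b), (a', b'))"]) (auto simp: y_def I_def)
      qed
      show "y ` I \<subseteq> ?L"
      proof
        fix z assume "z \<in> y ` I"
        then obtain a b a' b' where z: "z = mul E s t (a \<otimes> a') \<otimes> mul F s t (b \<otimes> b')"
          and m: "a \<in> fibre E s" "b \<in> fibre F s" "a' \<in> fibre E t" "b' \<in> fibre F t"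
          by (auto simp: y_def I_def)
        have "mul E s t (a \<otimes> a') \<in> mul E s t ` {a \<otimes> a' | a a'. a \<in> fibre E s \<and> a' \<in> fibre E t}"
          "mul F s t (b \<otimes> b') \<in> mul F s t ` {a \<otimes> a' | a a'. a \<in> fibre F s \<and> a' \<in> fibre F t}"
          by (rule imageI, rule CollectI, intro exI conjI, rule refl, rule m, rule m)+
        with z show "z \<in> ?L" by (intro CollectI exI conjI)
      qed
    qed
    then show ?thesis
      unfolding gen[OF E] gen[OF F] by (simp add: tensor_space_closed_span)
  qed
  moreover obtain V where "unitary_between V (closed_span (x ` I)) (closed_span (y ` I))"
    and V: "\<And>i. i \<in> I \<Longrightarrow> V (x i) = y i"
    using unitary_extension[of I x y, OF xy] by metis
  ultimately have "unitary_between V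
      ((fibre E s \<otimes>\<^sub>H fibre F s) \<otimes>\<^sub>H (fibre E t \<otimes>\<^sub>H fibre F t)) (fibre E (s + t) \<otimes>\<^sub>H fibre F (s + t))"
    by simp
  moreover have "V ((a \<otimes> b) \<otimes> (a' \<otimes> b')) = mul E s t (a \<otimes> a') \<otimes> mul F s t (b \<otimes> b')"
    if "a \<in> fibre E s" "b \<in> fibre F s" "a' \<in> fibre E t" "b' \<in> fibre F t" for a b a' b'
    using V[of "((a, b), (a', b'))"] that by (simp add: I_def x_def y_def)
  ultimately show ?thesis by blast
qed

lemma
  assumes "product_system E" "product_system F" "0 < s" "0 < t"
  shows unitary_tensor_mul: "unitary_between (tensor_mul E F s t)
      ((fibre E s \<otimes>\<^sub>H fibre F s) \<otimes>\<^sub>H (fibre E t \<otimes>\<^sub>H fibre F t)) (fibre E (s + t) \<otimes>\<^sub>H fibre F (s + t))"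
    and tensor_mul_eq: "a \<in> fibre E s \<Longrightarrow> b \<in> fibre F s \<Longrightarrow> a' \<in> fibre E t \<Longrightarrow> b' \<in> fibre F t \<Longrightarrow>
      tensor_mul E F s t ((a \<otimes> b) \<otimes> (a' \<otimes> b')) = mul E s t (a \<otimes> a') \<otimes> mul F s t (b \<otimes> b')"
proof -
  note * = someI_ex[OF tensor_mul_exists[OF assms], folded tensor_mul_def]
  show "unitary_between (tensor_mul E F s t)
      ((fibre E s \<otimes>\<^sub>H fibre F s) \<otimes>\<^sub>H (fibre E t \<otimes>\<^sub>H fibre F t)) (fibre E (s + t) \<otimes>\<^sub>H fibre F (s + t))"
    using * by (rule conjunct1)
  show "tensor_mul E F s t ((a \<otimes> b) \<otimes> (a' \<otimes> b')) = mul E s t (a \<otimes> a') \<otimes> mul F s t (b \<otimes> b')"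
    if "a \<in> fibre E s" "b \<in> fibre F s" "a' \<in> fibre E t" "b' \<in> fibre F t"
    using *[THEN conjunct2] that by simp
qed

lemma subspace_tensor_space: "cvec.subspace (H \<otimes>\<^sub>H K)" and closed_tensor_space: "closed (H \<otimes>\<^sub>H K)"
  unfolding tensor_space_def by (simp_all add: subspace_closed_span)

lemma eq_on_closed_span:
  assumes "continuous_on (closed_span X) L" "continuous_on (closed_span X) R"
    and "\<And>x y. x \<in> closed_span X \<Longrightarrow> y \<in> closed_span X \<Longrightarrow> L (x + y) = L x + L y"
    and "\<And>x y. x \<in> closed_span X \<Longrightarrow> y \<in> closed_span X \<Longrightarrow> R (x + y) = R x + R y"
    and "\<And>c x. x \<in> closed_span X \<Longrightarrow> L (c *\<^sub>C x) = c *\<^sub>C L x"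
    and "\<And>c x. x \<in> closed_span X \<Longrightarrow> R (c *\<^sub>C x) = c *\<^sub>C R x"
    and "\<And>x. x \<in> X \<Longrightarrow> L x = R x"
    and "x \<in> closed_span X"
  shows "L x = (R x :: 'b::complex_inner)"
proof -
  have 0: "0 \<in> closed_span X" by (rule cvec.subspace_0[OF subspace_closed_span])
  have LR0: "L 0 = R 0" using assms(5)[OF 0, of 0] assms(6)[OF 0, of 0] by simp
  have "y \<in> cvec.span X \<and> L y = R y" if "y \<in> cvec.span X" for y
    using that
  proof (induction rule: cvec.span_induct_alt)
    case base
    show ?case using LR0 by (simp add: cvec.span_zero)
  next
    case (step c a y)
    then have *: "a \<in> cvec.span X" "c *\<^sub>C a \<in> cvec.span X" "y \<in> cvec.span X"
      by (simp_all add: cvec.span_base cvec.span_scale)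
    then have **: "a \<in> closed_span X" "c *\<^sub>C a \<in> closed_span X" "y \<in> closed_span X"
      using closure_subset by blast+
    have "L (c *\<^sub>C a + y) = R (c *\<^sub>C a + y)"
      using step by (simp add: assms(3)[OF **(2,3)] assms(4)[OF **(2,3)] assms(5)[OF **(1)] assms(6)[OF **(1)] assms(7))
    then show ?case using * by (simp add: cvec.span_add)
  qed
  then have "L y - R y = 0" if "y \<in> cvec.span X" for y using that by simp
  from continuous_constant_on_closure[OF continuous_on_diff[OF assms(1,2)] this assms(8)]
  show ?thesis by simp
qed

lemma
  assumes E: "product_system E" and st: "0 < s" "0 < t"
  shows mul_add_left: "x \<in> fibre E s \<Longrightarrow> x' \<in> fibre E s \<Longrightarrow> y \<in> fibre E t \<Longrightarrow>
      mul E s t ((x + x') \<otimes> y) = mul E s t (x \<otimes> y) + mul E s t (x' \<otimes> y)"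
    and mul_add_right: "x \<in> fibre E s \<Longrightarrow> y \<in> fibre E t \<Longrightarrow> y' \<in> fibre E t \<Longrightarrow>
      mul E s t (x \<otimes> (y + y')) = mul E s t (x \<otimes> y) + mul E s t (x \<otimes> y')"
    and mul_scaleC_left: "x \<in> fibre E s \<Longrightarrow> y \<in> fibre E t \<Longrightarrow>
      mul E s t ((c *\<^sub>C x) \<otimes> y) = c *\<^sub>C mul E s t (x \<otimes> y)"
    and mul_scaleC_right: "x \<in> fibre E s \<Longrightarrow> y \<in> fibre E t \<Longrightarrow>
      mul E s t (x \<otimes> (c *\<^sub>C y)) = c *\<^sub>C mul E s t (x \<otimes> y)"
proof -
  note V = unitary_betweenD(1,2)[OF product_systemD(4)[OF E st]]
  show "mul E s t ((x + x') \<otimes> y) = mul E s t (x \<otimes> y) + mul E s t (x' \<otimes> y)"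
    if "x \<in> fibre E s" "x' \<in> fibre E s" "y \<in> fibre E t"
    unfolding tensor_add_left by (intro V tensor_space_I that)
  show "mul E s t (x \<otimes> (y + y')) = mul E s t (x \<otimes> y) + mul E s t (x \<otimes> y')"
    if "x \<in> fibre E s" "y \<in> fibre E t" "y' \<in> fibre E t"
    unfolding tensor_add_right by (intro V tensor_space_I that)
  show "mul E s t ((c *\<^sub>C x) \<otimes> y) = c *\<^sub>C mul E s t (x \<otimes> y)"
    if "x \<in> fibre E s" "y \<in> fibre E t"
    unfolding tensor_scaleC_left by (intro V tensor_space_I that)
  show "mul E s t (x \<otimes> (c *\<^sub>C y)) = c *\<^sub>C mul E s t (x \<otimes> y)"
    if "x \<in> fibre E s" "y \<in> fibre E t"
    unfolding tensor_scaleC_right by (intro V tensor_space_I that)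
qed

section \<open>The tensor product of product systems is a product system\<close>

definition lin_cont :: "'a::complex_inner set \<Rightarrow> ('a \<Rightarrow> 'b::complex_inner) \<Rightarrow> bool"
  where "lin_cont H L \<longleftrightarrow> continuous_on H L \<and> (\<forall>x\<in>H. \<forall>y\<in>H. L (x + y) = L x + L y) \<and>
    (\<forall>c. \<forall>x\<in>H. L (c *\<^sub>C x) = c *\<^sub>C L x)"

lemma lin_cont_compose:
  assumes "lin_cont H f" "lin_cont K g" "f ` H \<subseteq> K"
  shows "lin_cont H (\<lambda>x. g (f x))"
proof -
  have "continuous_on H (\<lambda>x. g (f x))"
    using assms by (intro continuous_on_compose2[of K g H f]) (simp_all add: lin_cont_def)
  moreover have "f x \<in> K" if "x \<in> H" for x using assms(3) that by blast
  ultimately show ?thesis using assms(1,2) by (simp add: lin_cont_def)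
qed

lemma lin_cont_unitary:
  assumes "unitary_between U H K" "cvec.subspace H" shows "lin_cont H U"
  unfolding lin_cont_def using unitary_between_continuous[OF assms] assms(1)
  by (simp add: unitary_between_def)

lemma lin_cont_tensor: "lin_cont H (\<lambda>x. x \<otimes> k)" "lin_cont K (\<lambda>y. h \<otimes> y)"
  unfolding lin_cont_def
  by (simp_all add: tensor_add_left tensor_add_right tensor_scaleC_left tensor_scaleC_right
      linear_continuous_on[OF bounded_bilinear.bounded_linear_left[OF bounded_bilinear_tensor]]
      linear_continuous_on[OF bounded_bilinear.bounded_linear_right[OF bounded_bilinear_tensor]])

lemma lin_cont_mul:
  assumes "unitary_between U (H \<otimes>\<^sub>H K) L"
  shows "k \<in> K \<Longrightarrow> lin_cont H (\<lambda>x. U (x \<otimes> k))" "h \<in> H \<Longrightarrow> lin_cont K (\<lambda>y. U (h \<otimes> y))"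
  by (rule lin_cont_compose[OF lin_cont_tensor(1) lin_cont_unitary[OF assms subspace_tensor_space]],
      auto intro: tensor_space_I,
      rule lin_cont_compose[OF lin_cont_tensor(2) lin_cont_unitary[OF assms subspace_tensor_space]],
      auto intro: tensor_space_I)

lemma lin_cont_eq:
  assumes "lin_cont (closed_span X) L" "lin_cont (closed_span X) R" "\<And>x. x \<in> X \<Longrightarrow> L x = R x"
    and "x \<in> closed_span X"
  shows "L x = R x"
  by (rule eq_on_closed_span[of X]) (use assms in \<open>auto simp: lin_cont_def\<close>)

lemma tensor_mul_assoc:
  assumes E: "product_system E" and F: "product_system F" and rst: "0 < r" "0 < s" "0 < t"
    and abc: "a \<in> fibre E r \<otimes>\<^sub>H fibre F r" "b \<in> fibre E s \<otimes>\<^sub>H fibre F s" "c \<in> fibre E t \<otimes>\<^sub>H fibre F t"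
  shows "tensor_mul E F r (s + t) (a \<otimes> tensor_mul E F s t (b \<otimes> c))
    = tensor_mul E F (r + s) t (tensor_mul E F r s (a \<otimes> b) \<otimes> c)"
proof -
  define H where "H t = fibre E t \<otimes>\<^sub>H fibre F t" for t
  define X where "X t = {x \<otimes> y | x y. x \<in> fibre E t \<and> y \<in> fibre F t}" for t
  have HX: "H t = closed_span (X t)" for t by (simp add: H_def X_def tensor_space_def)
  have XH: "x \<in> H t" if "x \<in> X t" for x t using that unfolding HX by (rule closed_span_superset)
  define m where "m = tensor_mul E F"
  have U: "unitary_between (m s t) (H s \<otimes>\<^sub>H H t) (H (s + t))" if "0 < s" "0 < t" for s t
    unfolding m_def H_def by (rule unitary_tensor_mul[OF E F that])
  have mH: "m s t (x \<otimes> y) \<in> H (s + t)" if "0 < s" "0 < t" "x \<in> H s" "y \<in> H t" for s t x y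
    by (intro unitary_betweenD(5)[OF U] tensor_space_I that)
  have pos: "0 < r + s" "0 < s + t" using rst by simp_all
  have lc1: "lin_cont (H r) (\<lambda>x. m r (s + t) (x \<otimes> m s t (b \<otimes> c)))"
    "lin_cont (H r) (\<lambda>x. m (r + s) t (m r s (x \<otimes> b) \<otimes> c))"
    if "b \<in> H s" "c \<in> H t" for b c
     apply (rule lin_cont_mul(1)[OF U[OF rst(1) pos(2)] mH[OF rst(2,3) that]])
    apply (rule lin_cont_compose[OF lin_cont_mul(1)[OF U[OF rst(1,2)] that(1)]
          lin_cont_mul(1)[OF U[OF pos(1) rst(3)] that(2)]])
    using mH rst that by blast
  have lc2: "lin_cont (H s) (\<lambda>x. m r (s + t) (a \<otimes> m s t (x \<otimes> c)))"
    "lin_cont (H s) (\<lambda>x. m (r + s) t (m r s (a \<otimes> x) \<otimes> c))"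
    if "a \<in> H r" "c \<in> H t" for a c
     apply (rule lin_cont_compose[OF lin_cont_mul(1)[OF U[OF rst(2,3)] that(2)]
          lin_cont_mul(2)[OF U[OF rst(1) pos(2)] that(1)]])
    using mH rst that apply blast
    apply (rule lin_cont_compose[OF lin_cont_mul(2)[OF U[OF rst(1,2)] that(1)]
          lin_cont_mul(1)[OF U[OF pos(1) rst(3)] that(2)]])
    using mH rst that by blast
  have lc3: "lin_cont (H t) (\<lambda>x. m r (s + t) (a \<otimes> m s t (b \<otimes> x)))"
    "lin_cont (H t) (\<lambda>x. m (r + s) t (m r s (a \<otimes> b) \<otimes> x))"
    if "a \<in> H r" "b \<in> H s" for a b
     apply (rule lin_cont_compose[OF lin_cont_mul(2)[OF U[OF rst(2,3)] that(2)]
          lin_cont_mul(2)[OF U[OF rst(1) pos(2)] that(1)]])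
    using mH rst that apply blast
    by (rule lin_cont_mul(2)[OF U[OF pos(1) rst(3)] mH[OF rst(1,2) that]])
  have elem: "m r (s + t) (a \<otimes> m s t (b \<otimes> c)) = m (r + s) t (m r s (a \<otimes> b) \<otimes> c)"
    if a: "a \<in> X r" and b: "b \<in> X s" and c: "c \<in> X t" for a b c
  proof -
    obtain a1 a2 where a': "a = a1 \<otimes> a2" "a1 \<in> fibre E r" "a2 \<in> fibre F r" using a by (auto simp: X_def)
    obtain b1 b2 where b': "b = b1 \<otimes> b2" "b1 \<in> fibre E s" "b2 \<in> fibre F s" using b by (auto simp: X_def)
    obtain c1 c2 where c': "c = c1 \<otimes> c2" "c1 \<in> fibre E t" "c2 \<in> fibre F t" using c by (auto simp: X_def)
    have "m r (s + t) (a \<otimes> m s t (b \<otimes> c))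
        = mul E r (s + t) (a1 \<otimes> mul E s t (b1 \<otimes> c1)) \<otimes> mul F r (s + t) (a2 \<otimes> mul F s t (b2 \<otimes> c2))"
      unfolding m_def a'(1) b'(1) c'(1)
      using a' b' c' rst pos by (simp add: tensor_mul_eq[OF E F] mul_in_fibre[OF E] mul_in_fibre[OF F])
    also have "\<dots> = mul E (r + s) t (mul E r s (a1 \<otimes> b1) \<otimes> c1) \<otimes> mul F (r + s) t (mul F r s (a2 \<otimes> b2) \<otimes> c2)"
      using a' b' c' rst by (simp add: product_systemD(5)[OF E] product_systemD(5)[OF F])
    also have "\<dots> = m (r + s) t (m r s (a \<otimes> b) \<otimes> c)"
      unfolding m_def a'(1) b'(1) c'(1)
      using a' b' c' rst pos by (simp add: tensor_mul_eq[OF E F] mul_in_fibre[OF E] mul_in_fibre[OF F])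
    finally show ?thesis .
  qed
  have 1: "m r (s + t) (a \<otimes> m s t (b \<otimes> c)) = m (r + s) t (m r s (a \<otimes> b) \<otimes> c)"
    if "a \<in> H r" "b \<in> X s" "c \<in> X t" for a b c
    by (rule lin_cont_eq[OF lc1[OF XH[OF that(2)] XH[OF that(3)], unfolded HX[of r]]])
       (use elem that HX in auto)
  have 2: "m r (s + t) (a \<otimes> m s t (b \<otimes> c)) = m (r + s) t (m r s (a \<otimes> b) \<otimes> c)"
    if "a \<in> H r" "b \<in> H s" "c \<in> X t" for a b c
    by (rule lin_cont_eq[OF lc2[OF that(1) XH[OF that(3)], unfolded HX[of s]]])
       (use 1 that HX in auto)
  have 3: "m r (s + t) (a \<otimes> m s t (b \<otimes> c)) = m (r + s) t (m r s (a \<otimes> b) \<otimes> c)"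
    if "a \<in> H r" "b \<in> H s" "c \<in> H t" for a b c
    by (rule lin_cont_eq[OF lc3[OF that(1,2), unfolded HX[of t]]])
       (use 2 that HX in auto)
  show ?thesis using 3 abc by (simp add: m_def H_def)
qed

lemma product_system_tensor:
  assumes E: "product_system E" and F: "product_system F"
  shows "product_system (tensor_psys E F)"
proof -
  let ?G = "tensor_psys E F"
  have fib: "fibre ?G t = fibre E t \<otimes>\<^sub>H fibre F t" for t
    by (simp add: tensor_psys_def tensor_family_def)
  have mul: "mul ?G = tensor_mul E F" by (simp add: tensor_psys_def)
  have sec: "sec ?G n t = sec E (fst (prod_decode n)) t \<otimes> sec F (snd (prod_decode n)) t" for n t
    by (simp add: tensor_psys_def)
  have nz: "fibre ?G t \<noteq> {0}" if t: "0 < t" for t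
  proof -
    obtain x where x: "x \<in> fibre E t" "x \<noteq> 0"
      using product_systemD(3)[OF E t] cvec.subspace_0[OF product_systemD(1)[OF E t]] by blast
    obtain y where y: "y \<in> fibre F t" "y \<noteq> 0"
      using product_systemD(3)[OF F t] cvec.subspace_0[OF product_systemD(1)[OF F t]] by blast
    have "norm (x \<otimes> y) \<noteq> 0" using x y by (simp add: norm_tensor)
    moreover have "x \<otimes> y \<in> fibre ?G t" unfolding fib by (intro tensor_space_I x y)
    ultimately show ?thesis by auto
  qed
  have total: "closed_span (range (\<lambda>n. sec ?G n t)) = fibre ?G t" if t: "0 < t" for t
  proof -
    have "range (\<lambda>n. sec ?G n t)
        = {x \<otimes> y | x y. x \<in> range (\<lambda>n. sec E n t) \<and> y \<in> range (\<lambda>n. sec F n t)}" (is "_ = ?R")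
    proof
      show "range (\<lambda>n. sec ?G n t) \<subseteq> ?R" unfolding sec by blast
      show "?R \<subseteq> range (\<lambda>n. sec ?G n t)"
      proof safe
        fix i j
        show "sec E i t \<otimes> sec F j t \<in> range (\<lambda>n. sec ?G n t)"
          by (rule range_eqI[of _ _ "prod_encode (i, j)"]) (simp add: sec)
      qed
    qed
    then show ?thesis
      unfolding fib product_systemD(6)[OF E t, symmetric] product_systemD(6)[OF F t, symmetric]
      by (simp add: tensor_space_closed_span)
  qed
  have meas1: "(\<lambda>t. cinner (sec ?G m t) (sec ?G n t)) \<in> borel_measurable (restrict_space borel {0<..})" for m n
    unfolding sec cinner_tensor
    by (intro borel_measurable_times product_systemD(7) E F)
  have meas2: "(\<lambda>(s, t). cinner (mul ?G s t (sec ?G k s \<otimes> sec ?G l t)) (sec ?G m (s + t)))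
      \<in> borel_measurable (restrict_space borel ({0<..} \<times> {0<..}))" for k l m
  proof -
    obtain k1 k2 where k: "prod_decode k = (k1, k2)" by (cases "prod_decode k")
    obtain l1 l2 where l: "prod_decode l = (l1, l2)" by (cases "prod_decode l")
    obtain m1 m2 where m: "prod_decode m = (m1, m2)" by (cases "prod_decode m")
    have "(\<lambda>p. (case p of (s, t) \<Rightarrow> cinner (mul E s t (sec E k1 s \<otimes> sec E l1 t)) (sec E m1 (s + t)))
          * (case p of (s, t) \<Rightarrow> cinner (mul F s t (sec F k2 s \<otimes> sec F l2 t)) (sec F m2 (s + t))))
      \<in> borel_measurable (restrict_space borel ({0<..} \<times> {0<..}))"
      by (intro borel_measurable_times product_systemD(8) E F)
    then show ?thesis
    proof (rule measurable_cong[THEN iffD1, rotated])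
      fix p :: "real \<times> real" assume "p \<in> space (restrict_space borel ({0<..} \<times> {0<..}))"
      then obtain s t where p: "p = (s, t)" "0 < s" "0 < t" by (auto simp: space_restrict_space)
      show "(case p of (s, t) \<Rightarrow> cinner (mul E s t (sec E k1 s \<otimes> sec E l1 t)) (sec E m1 (s + t)))
          * (case p of (s, t) \<Rightarrow> cinner (mul F s t (sec F k2 s \<otimes> sec F l2 t)) (sec F m2 (s + t)))
        = (case p of (s, t) \<Rightarrow> cinner (mul ?G s t (sec ?G k s \<otimes> sec ?G l t)) (sec ?G m (s + t)))"
        using p by (simp add: sec mul k l m tensor_mul_eq[OF E F] sec_in_fibre[OF E] sec_in_fibre[OF F] cinner_tensor)
    qed
  qed
  show ?thesis
    unfolding product_system_def
  proof (intro conjI allI impI ballI)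
    fix t :: real assume t: "0 < t"
    show "cvec.subspace (fibre ?G t)" "closed (fibre ?G t)"
      by (simp_all add: fib subspace_tensor_space closed_tensor_space)
    show "fibre ?G t \<noteq> {0}" by (rule nz[OF t])
    show "closed_span (range (\<lambda>n. sec ?G n t)) = fibre ?G t" by (rule total[OF t])
  next
    fix s t :: real assume "0 < s" "0 < t"
    then show "unitary_between (mul ?G s t) (fibre ?G s \<otimes>\<^sub>H fibre ?G t) (fibre ?G (s + t))"
      unfolding fib mul by (rule unitary_tensor_mul[OF E F])
  next
    fix r s t :: real and a b c assume "0 < r" "0 < s" "0 < t" "a \<in> fibre ?G r" "b \<in> fibre ?G s" "c \<in> fibre ?G t"
    then show "mul ?G r (s + t) (a \<otimes> mul ?G s t (b \<otimes> c)) = mul ?G (r + s) t (mul ?G r s (a \<otimes> b) \<otimes> c)"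
      unfolding fib mul by (intro tensor_mul_assoc[OF E F])
  qed (rule meas1 meas2)+
qed

end

theory Submission
  imports Defs
begin

text \<open>
  Write \<open>J\<close> for the left-hand side. A product subsystem is contained in its cluster, so \<open>J\<close> is
  contained in the right-hand side. For the converse, \<open>J\<close> is closed under multiplication, and by
  symmetry it is enough to show \<open>e \<otimes> z \<in> J\<^sub>t\<close> for \<open>e \<in> E\<^sub>t\<close> and \<open>z \<in> N'\<^sub>t\<close>, where
  \<open>N'\<close> is the family \<open>cluster_prime F N\<close> that generates the cluster.

  Cut \<open>[0, t]\<close> into small intervals and split each factor of \<open>F\<^sub>t\<close> accordingly into \<open>N\<close> and its
  complement. As \<open>z\<close> is orthogonal to all products of two vectors orthogonal to \<open>N\<close>, at most one
  interval carries a factor orthogonal to \<open>N\<close>; thus \<open>z = z\<^sub>0 + \<Sum>\<^sub>i z\<^sub>i\<close>, an orthogonal sum with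
  \<open>z\<^sub>0 \<in> N\<^sub>t\<close> and \<open>z\<^sub>i\<close> in \<open>N\<close> outside the \<open>i\<close>-th interval. If \<open>e\<^sub>i\<close> is in \<open>M\<close> on the
  \<open>i\<close>-th interval, then \<open>e\<^sub>i \<otimes> z\<^sub>i\<close> is a limit of sums of products of vectors in \<open>E \<otimes> N\<close> and
  \<open>M \<otimes> F\<close>, hence in \<open>J\<^sub>t\<close>. So the distance of \<open>e \<otimes> z\<close> from \<open>J\<^sub>t\<close> is at most
  \<open>max\<^sub>i \<parallel>e - e\<^sub>i\<parallel> \<parallel>z\<parallel>\<close>, and it remains to see that every \<open>e\<close> can be approximated on each
  sufficiently short interval by vectors that are in \<open>M\<close> there (\<open>local_space_dense\<close>); the passage from
  short intervals to \<open>[0, t]\<close> is a compactness argument (\<open>pair_near_J\<close>).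

  The approximation rests on \<open>left_germ_trivial\<close>: no nonzero vector is orthogonal to
  \<open>E\<^sub>t\<^sub>-\<^sub>h \<circ> M\<^sub>h\<close> for all \<open>h\<close>. Shifting such a vector in time and filling up with vectors of \<open>M\<close> would
  give an uncountable orthogonal family of nonzero vectors in a separable fibre.

  The multiplications of \<open>E\<close> and \<open>F\<close> enter through the locale \<open>graded_multiplication\<close>, which is stable
  under reversing the order of the factors, and the tensor product through the locale
  \<open>subsystem_pairing\<close>, which is stable under exchanging \<open>E\<close> and \<open>F\<close>. So one
  proof covers both sides in the statement on germs, and one proof both halves of the converse.
\<close>

section \<open>Projections and orthogonal families in Hilbert space\<close>

lemma cinner_eq_0_commute: "cinner x y = 0 \<longleftrightarrow> cinner y (x::'a::complex_inner) = 0"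
  by (metis cinner_commute complex_cnj_zero_iff)


lemma orthogonal_closed_span:
  assumes "\<And>x. x \<in> X \<Longrightarrow> cinner y x = 0" "z \<in> closed_span X"
  shows "cinner y (z::'a::complex_inner) = 0"
proof -
  have "closed_span X \<subseteq> {z. cinner y z = 0}"
  proof (rule closed_span_minimal)
    show "closed {z. cinner y z = 0}"
      by (intro closed_Collect_eq continuous_on_const
          linear_continuous_on[OF bounded_bilinear.bounded_linear_right[OF bounded_bilinear_cinner]])
    show "cvec.subspace {z. cinner y z = 0}"
      by (rule cvec.subspaceI) (auto simp: cinner_add_right cinner_scaleC_right)
  qed (use assms in auto)
  then show ?thesis using assms(2) by blast
qed

lemma orthogonal_closed_span_left:
  assumes "\<And>x. x \<in> X \<Longrightarrow> cinner x y = 0" "z \<in> closed_span X"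
  shows "cinner z (y::'a::complex_inner) = 0"
  using orthogonal_closed_span[of X y z] assms cinner_eq_0_commute by blast

lemma lin_cont_maps_closed_span:
  fixes L :: "'a::complex_inner \<Rightarrow> 'b::complex_inner"
  assumes L: "lin_cont H L" and H: "cvec.subspace H" "closed H"
    and S: "cvec.subspace S" "closed S"
    and X: "X \<subseteq> H" "\<And>x. x \<in> X \<Longrightarrow> L x \<in> S" and x: "x \<in> closed_span X"
  shows "L x \<in> S"
proof -
  have "closed_span X \<subseteq> H \<inter> L -` S"
  proof (rule closed_span_minimal)
    show "closed (H \<inter> L -` S)"
      using L by (intro continuous_closed_preimage H S) (simp add: lin_cont_def)
    have L0: "L 0 = 0"
      using L cvec.subspace_0[OF H(1)] unfolding lin_cont_def by (metis cvec.scale_zero_left)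
    show "cvec.subspace (H \<inter> L -` S)"
      using L H(1) S(1) L0
      by (intro cvec.subspaceI) (auto simp: lin_cont_def cvec.subspace_0 cvec.subspace_add cvec.subspace_scale)
  qed (use X in auto)
  then show ?thesis using x by blast
qed

lemma exists_closest_point:
  fixes S :: "'a::chilbert_space set"
  assumes "convex S" "closed S" "S \<noteq> {}"
  obtains y where "y \<in> S" "\<And>z. z \<in> S \<Longrightarrow> dist x y \<le> dist x z"
proof -
  define d where "d = infdist x S"
  have d: "d \<le> dist x z" if "z \<in> S" for z unfolding d_def by (rule infdist_le[OF that])
  have d0: "d \<ge> 0" by (simp add: d_def infdist_nonneg)
  have "\<exists>y\<in>S. dist x y < d + inverse (real (Suc n))" for n
  proof -
    have "Inf (dist x ` S) < d + inverse (real (Suc n))"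
      using assms(3) by (simp add: d_def infdist_notempty del: of_nat_Suc)
    from cInf_lessD[OF _ this] show ?thesis using assms(3) by blast
  qed
  then obtain Y where Y: "\<And>n. Y n \<in> S" "\<And>n. dist x (Y n) < d + inverse (real (Suc n))" by metis
  have lim: "(\<lambda>n. dist x (Y n)) \<longlonglongrightarrow> d"
  proof (rule tendsto_sandwich[of "\<lambda>_. d" _ _ "\<lambda>n. d + inverse (real (Suc n))"])
    show "(\<lambda>n. d + inverse (real (Suc n))) \<longlonglongrightarrow> d"
      using tendsto_add[OF tendsto_const[of d] LIMSEQ_inverse_real_of_nat] by simp
    show "\<forall>\<^sub>F n in sequentially. d \<le> dist x (Y n)" using d[OF Y(1)] by (intro always_eventually allI)
    show "\<forall>\<^sub>F n in sequentially. dist x (Y n) \<le> d + inverse (real (Suc n))"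
      using less_imp_le[OF Y(2)] by (intro always_eventually allI)
  qed simp
  \<comment> \<open>the parallelogram law, applied at the midpoint of two almost minimising points\<close>
  have par: "(dist (Y m) (Y n))\<^sup>2 \<le> 2 * (dist x (Y m))\<^sup>2 + 2 * (dist x (Y n))\<^sup>2 - 4 * d\<^sup>2" for m n
  proof -
    define z where "z = (1/2) *\<^sub>R Y m + (1/2) *\<^sub>R Y n"
    have "z \<in> S" unfolding z_def using Y(1) assms(1) by (intro convexD) auto
    then have "d\<^sup>2 \<le> (dist x z)\<^sup>2" using d d0 by (simp add: power_mono)
    moreover have "(dist (Y m) (Y n))\<^sup>2 = 2 * (dist x (Y m))\<^sup>2 + 2 * (dist x (Y n))\<^sup>2 - 4 * (dist x z)\<^sup>2"
    proof -
      define u v where "u = x - Y m" and "v = x - Y n"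
      have "x = (1/2) *\<^sub>R x + (1/2) *\<^sub>R x" by (simp flip: scaleR_add_left)
      then have xz: "x - z = (1/2) *\<^sub>R (u + v)"
        unfolding z_def u_def v_def by (simp add: scaleR_add_right scaleR_diff_right)
      have "(dist x z)\<^sup>2 = (1/4) * (norm (u + v))\<^sup>2"
        unfolding dist_norm xz by (simp add: power2_eq_square)
      moreover have "(dist (Y m) (Y n))\<^sup>2 = (norm (v - u))\<^sup>2" by (simp add: dist_norm u_def v_def)
      moreover have "(norm (v - u))\<^sup>2 + (norm (u + v))\<^sup>2 = 2 * (norm u)\<^sup>2 + 2 * (norm v)\<^sup>2"
        unfolding power2_norm_eq_inner
        by (simp add: inner_diff_left inner_diff_right inner_add_left inner_add_right)
      ultimately show ?thesis by (simp add: dist_norm u_def v_def)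
    qed
    ultimately show ?thesis by linarith
  qed
  have "Cauchy Y"
  proof (rule metric_CauchyI)
    fix e :: real assume e: "e > 0"
    have "(\<lambda>n. (dist x (Y n))\<^sup>2) \<longlonglongrightarrow> d\<^sup>2" using lim by (intro tendsto_intros)
    moreover have "e\<^sup>2 / 4 > 0" using e by simp
    ultimately obtain N where N: "\<And>n. n \<ge> N \<Longrightarrow> dist ((dist x (Y n))\<^sup>2) (d\<^sup>2) < e\<^sup>2 / 4"
      using metric_LIMSEQ_D by blast
    have "dist (Y m) (Y n) < e" if "m \<ge> N" "n \<ge> N" for m n
    proof -
      have "(dist x (Y k))\<^sup>2 < d\<^sup>2 + e\<^sup>2 / 4" if "k \<ge> N" for k
        using abs_less_iff[THEN iffD1, OF N[OF that, unfolded dist_real_def]] by simp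
      from this[OF that(1)] this[OF that(2)] par[of m n]
      have "(dist (Y m) (Y n))\<^sup>2 < e\<^sup>2" by linarith
      then show ?thesis by (rule power2_less_imp_less) (use e in simp)
    qed
    then show "\<exists>N. \<forall>m\<ge>N. \<forall>n\<ge>N. dist (Y m) (Y n) < e" by blast
  qed
  then obtain y where y: "Y \<longlonglongrightarrow> y" using Cauchy_convergent convergent_def by blast
  have "dist x y = d"
    using LIMSEQ_unique[OF lim tendsto_dist[OF tendsto_const y]] by simp
  moreover have "y \<in> S" using closed_sequentially[OF assms(2)] Y(1) y by blast
  ultimately show ?thesis using that d by simp
qed

lemma orth_proj_exists:
  fixes S :: "'a::chilbert_space set"
  assumes S: "cvec.subspace S" "closed S"
  shows "\<exists>y\<in>S. \<forall>z\<in>S. cinner z (x - y) = 0"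
proof -
  have R: "r *\<^sub>R z \<in> S" if "z \<in> S" for r z
    using cvec.subspace_scale[OF S(1) that, of "complex_of_real r"] by (simp add: scaleC_of_real)
  have conv: "convex S" unfolding convex_def using R cvec.subspace_add[OF S(1)] by blast
  obtain y where y: "y \<in> S" "\<And>z. z \<in> S \<Longrightarrow> dist x y \<le> dist x z"
    using exists_closest_point[OF conv S(2), of x] cvec.subspace_0[OF S(1)] by blast
  have re: "inner (x - y) z = 0" if z: "z \<in> S" for z
  proof -
    have "inner (x - y) ((y + z) - y) \<le> 0" "inner (x - y) ((y - z) - y) \<le> 0"
      using y z by (intro any_closest_point_dot[OF conv S(2)] ballI
          cvec.subspace_add[OF S(1)] cvec.subspace_diff[OF S(1)]; blast)+
    then show ?thesis by simp
  qed
  have "cinner z (x - y) = 0" if z: "z \<in> S" for z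
  proof (rule complex_eqI)
    show "Re (cinner z (x - y)) = Re 0" using re[OF z] by (simp add: inner_commute flip: inner_eq_Re_cinner)
    \<comment> \<open>the imaginary part is a real part for the vector \<open>\<i> z\<close>\<close>
    have "inner (x - y) (\<i> *\<^sub>C z) = 0" by (intro re cvec.subspace_scale[OF S(1)] z)
    then have "Re (cinner (\<i> *\<^sub>C z) (x - y)) = 0" by (simp add: inner_commute flip: inner_eq_Re_cinner)
    then show "Im (cinner z (x - y)) = Im 0" by (simp add: cinner_scaleC_left)
  qed
  then show ?thesis using y(1) by blast
qed

lemma
  fixes S :: "'a::chilbert_space set"
  assumes S: "cvec.subspace S" "closed S"
  shows orth_proj_in: "orth_proj S x \<in> S"
    and orth_proj_orthogonal: "z \<in> S \<Longrightarrow> cinner z (x - orth_proj S x) = 0"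
    and orth_proj_unique: "y \<in> S \<Longrightarrow> (\<And>z. z \<in> S \<Longrightarrow> cinner z (x - y) = 0) \<Longrightarrow> orth_proj S x = y"
proof -
  have uniq: "y = y'" if "y \<in> S" "\<forall>z\<in>S. cinner z (x - y) = 0" "y' \<in> S" "\<forall>z\<in>S. cinner z (x - y') = 0" for y y'
  proof -
    have "y' - y \<in> S" by (intro cvec.subspace_diff[OF S(1)] that)
    then have "cinner (y' - y) (x - y) = 0" "cinner (y' - y) (x - y') = 0" using that by blast+
    then have "cinner (y' - y) (y' - y) = 0" by (simp add: cinner_diff_right)
    then show ?thesis by (simp add: cinner_self)
  qed
  have ex1: "\<exists>!y. y \<in> S \<and> (\<forall>z\<in>S. cinner z (x - y) = 0)"
    using orth_proj_exists[OF S, of x] uniq by (metis (no_types, lifting))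
  note the = theI'[OF ex1, folded orth_proj_def]
  show "orth_proj S x \<in> S" using the by (rule conjunct1)
  show "cinner z (x - orth_proj S x) = 0" if "z \<in> S" using the[THEN conjunct2] that by (rule bspec)
  show "orth_proj S x = y" if "y \<in> S" "\<And>z. z \<in> S \<Longrightarrow> cinner z (x - y) = 0"
    unfolding orth_proj_def by (rule the1_equality[OF ex1]) (use that in blast)
qed

lemma orthogonal_complement_trivial:
  fixes S :: "'a::chilbert_space set"
  assumes S: "cvec.subspace S" "closed S" "S \<subseteq> H" and H: "cvec.subspace H"
    and triv: "\<And>l. l \<in> H \<Longrightarrow> (\<And>z. z \<in> S \<Longrightarrow> cinner z l = 0) \<Longrightarrow> l = 0"
  shows "S = H"
proof
  show "H \<subseteq> S"
  proof
    fix x assume x: "x \<in> H"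
    have P: "orth_proj S x \<in> S" by (rule orth_proj_in[OF S(1,2)])
    have "x - orth_proj S x = 0"
      using P S(3) x by (intro triv cvec.subspace_diff[OF H] orth_proj_orthogonal[OF S(1,2)]) auto
    then show "x \<in> S" using P by simp
  qed
qed (rule S(3))

lemma closed_span_Un_orth_in:
  fixes S :: "'a::chilbert_space set"
  assumes S: "cvec.subspace S" "closed S" "S \<subseteq> H" and H: "cvec.subspace H" "closed H"
  shows "closed_span (S \<union> (H \<ominus> S)) = H"
proof (rule orthogonal_complement_trivial[OF subspace_closed_span closed_closure _ H(1)])
  show "closed_span (S \<union> (H \<ominus> S)) \<subseteq> H"
    using S(3) by (intro closed_span_minimal H) (auto simp: orth_in_def)
  fix l assume l: "l \<in> H" "\<And>z. z \<in> closed_span (S \<union> (H \<ominus> S)) \<Longrightarrow> cinner z l = 0"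
  then have "cinner y l = 0" if "y \<in> S" for y using that by (blast intro: closed_span_superset)
  then have "l \<in> H \<ominus> S" using l(1) cinner_eq_0_commute by (auto simp: orth_in_def)
  then have "cinner l l = 0" by (intro l(2) closed_span_superset) simp
  then show "l = 0" by (simp add: cinner_self)
qed

lemma Bessel_inequality:
  fixes w :: "'i \<Rightarrow> 'a::real_inner"
  assumes "finite I" "\<And>i j. i \<in> I \<Longrightarrow> j \<in> I \<Longrightarrow> i \<noteq> j \<Longrightarrow> inner (w i) (w j) = 0"
  shows "(\<Sum>i\<in>I. (inner x (w i))\<^sup>2 / (norm (w i))\<^sup>2) \<le> (norm x)\<^sup>2"
proof -
  define c where "c i = inner x (w i) / (norm (w i))\<^sup>2" for i
  define y where "y = (\<Sum>i\<in>I. c i *\<^sub>R w i)"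
  define s where "s = (\<Sum>i\<in>I. (inner x (w i))\<^sup>2 / (norm (w i))\<^sup>2)"
  have xy: "inner x y = s"
    by (simp add: y_def s_def c_def inner_sum_right power2_eq_square)
  have "inner (w i) y = inner x (w i)" if i: "i \<in> I" for i
  proof -
    have "inner (w i) y = (\<Sum>j\<in>I. if j = i then c i * inner (w i) (w i) else 0)"
      unfolding y_def inner_sum_right using assms(2) i by (intro sum.cong) auto
    also have "\<dots> = inner x (w i)"
      using assms(1) i by (simp add: c_def power2_norm_eq_inner)
    finally show ?thesis .
  qed
  then have "inner y y = (\<Sum>i\<in>I. c i * inner x (w i))"
    by (subst (1) y_def) (simp add: inner_sum_left)
  then have yy: "inner y y = s" by (simp add: s_def c_def power2_eq_square)
  have "0 \<le> inner (x - y) (x - y)" by simp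
  also have "\<dots> = (norm x)\<^sup>2 - s"
    using xy yy by (simp add: inner_diff_left inner_diff_right inner_commute power2_norm_eq_inner)
  finally show ?thesis by (simp add: s_def)
qed

lemma countable_orthogonal_not_zero:
  fixes w :: "'i \<Rightarrow> 'a::real_inner"
  assumes "\<And>i j. i \<in> I \<Longrightarrow> j \<in> I \<Longrightarrow> i \<noteq> j \<Longrightarrow> inner (w i) (w j) = 0"
  shows "countable {i \<in> I. inner x (w i) \<noteq> 0}"
proof -
  have "(\<lambda>i. (inner x (w i))\<^sup>2 / (norm (w i))\<^sup>2) summable_on I"
  proof (rule nonneg_bdd_above_summable_on)
    show "bdd_above (sum (\<lambda>i. (inner x (w i))\<^sup>2 / (norm (w i))\<^sup>2) ` {F. F \<subseteq> I \<and> finite F})"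
      using assms by (intro bdd_aboveI[of _ "(norm x)\<^sup>2"]) (auto intro!: Bessel_inequality)
  qed simp
  from summable_countable_real[OF this] show ?thesis
    by (rule countable_subset[rotated]) auto
qed

lemma countable_orthogonal_family:
  fixes w :: "'i \<Rightarrow> 'a::complex_inner"
  assumes D: "countable D" and w: "\<And>i. i \<in> I \<Longrightarrow> w i \<in> closed_span D" "\<And>i. i \<in> I \<Longrightarrow> w i \<noteq> 0"
    and orth: "\<And>i j. i \<in> I \<Longrightarrow> j \<in> I \<Longrightarrow> i \<noteq> j \<Longrightarrow> cinner (w i) (w j) = 0"
  shows "countable I"
proof -
  \<comment> \<open>The real inner products with \<open>d\<close> and \<open>\<i> d\<close> together detect the complex one.\<close>
  have "I \<subseteq> (\<Union>d\<in>D. {i \<in> I. inner d (w i) \<noteq> 0} \<union> {i \<in> I. inner (\<i> *\<^sub>C d) (w i) \<noteq> 0})"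
  proof
    fix i assume i: "i \<in> I"
    have "\<exists>d\<in>D. cinner d (w i) \<noteq> 0"
    proof (rule ccontr)
      assume "\<not> ?thesis"
      then have "cinner (w i) (w i) = 0" by (intro orthogonal_closed_span_left[OF _ w(1)[OF i]]) blast
      then show False using w(2)[OF i] by (simp add: cinner_self)
    qed
    then obtain d where d: "d \<in> D" "cinner d (w i) \<noteq> 0" by blast
    then have "inner d (w i) \<noteq> 0 \<or> inner (\<i> *\<^sub>C d) (w i) \<noteq> 0"
      by (simp add: inner_eq_Re_cinner cinner_scaleC_left complex_eq_iff)
    then show "i \<in> (\<Union>d\<in>D. {i \<in> I. inner d (w i) \<noteq> 0} \<union> {i \<in> I. inner (\<i> *\<^sub>C d) (w i) \<noteq> 0})"
      using i d(1) by blast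
  qed
  moreover have "countable \<dots>"
    using orth by (intro countable_UN D countable_Un countable_orthogonal_not_zero) (simp_all add: inner_eq_Re_cinner)
  ultimately show ?thesis by (rule countable_subset)
qed

section \<open>Graded multiplications and subsystems\<close>

text \<open>
  The multiplication of a product system, seen as a map \<open>m s t x y\<close> of pairs of vectors; \<open>opposite\<close>
  shows that the notion is stable under reversing the order of the factors.
\<close>

locale graded_multiplication =
  fixes H :: "real \<Rightarrow> 'a::chilbert_space set" and m :: "real \<Rightarrow> real \<Rightarrow> 'a \<Rightarrow> 'a \<Rightarrow> 'a"
  assumes subspace_H: "0 < t \<Longrightarrow> cvec.subspace (H t)"
    and closed_H: "0 < t \<Longrightarrow> closed (H t)"
    and separable_H: "0 < t \<Longrightarrow> \<exists>D. countable D \<and> closed_span D = H t"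
    and lin_cont_left: "0 < s \<Longrightarrow> 0 < t \<Longrightarrow> y \<in> H t \<Longrightarrow> lin_cont (H s) (\<lambda>x. m s t x y)"
    and lin_cont_right: "0 < s \<Longrightarrow> 0 < t \<Longrightarrow> x \<in> H s \<Longrightarrow> lin_cont (H t) (\<lambda>y. m s t x y)"
    and cinner_m: "0 < s \<Longrightarrow> 0 < t \<Longrightarrow> x \<in> H s \<Longrightarrow> x' \<in> H s \<Longrightarrow> y \<in> H t \<Longrightarrow> y' \<in> H t \<Longrightarrow>
      cinner (m s t x y) (m s t x' y') = cinner x x' * cinner y y'"
    and assoc: "0 < r \<Longrightarrow> 0 < s \<Longrightarrow> 0 < t \<Longrightarrow> a \<in> H r \<Longrightarrow> b \<in> H s \<Longrightarrow> c \<in> H t \<Longrightarrow>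
      m r (s + t) a (m s t b c) = m (r + s) t (m r s a b) c"
    and total: "0 < s \<Longrightarrow> 0 < t \<Longrightarrow> closed_span {m s t x y | x y. x \<in> H s \<and> y \<in> H t} = H (s + t)"
begin

text \<open>The closed linear span of the products, written \<open>X \<circ> Y\<close> below.\<close>

definition prods :: "real \<Rightarrow> real \<Rightarrow> 'a set \<Rightarrow> 'a set \<Rightarrow> 'a set"
  where "prods s t X Y = closed_span {m s t x y | x y. x \<in> X \<and> y \<in> Y}"

lemma subspace_prods: "cvec.subspace (prods s t X Y)" and closed_prods: "closed (prods s t X Y)"
  unfolding prods_def by (simp_all add: subspace_closed_span)

lemma prodsI: "x \<in> X \<Longrightarrow> y \<in> Y \<Longrightarrow> m s t x y \<in> prods s t X Y"
  unfolding prods_def by (rule closed_span_superset) blast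

lemma prods_subset:
  assumes "cvec.subspace S" "closed S" "\<And>x y. x \<in> X \<Longrightarrow> y \<in> Y \<Longrightarrow> m s t x y \<in> S"
  shows "prods s t X Y \<subseteq> S"
  unfolding prods_def by (rule closed_span_minimal) (use assms in auto)

lemma prods_mono: "X \<subseteq> X' \<Longrightarrow> Y \<subseteq> Y' \<Longrightarrow> prods s t X Y \<subseteq> prods s t X' Y'"
  by (intro prods_subset subspace_prods closed_prods prodsI) auto

lemma prods_H: "0 < s \<Longrightarrow> 0 < t \<Longrightarrow> u = s + t \<Longrightarrow> prods s t (H s) (H t) = H u"
  unfolding prods_def by (simp add: total)

lemma m_in_H: "0 < s \<Longrightarrow> 0 < t \<Longrightarrow> u = s + t \<Longrightarrow> x \<in> H s \<Longrightarrow> y \<in> H t \<Longrightarrow> m s t x y \<in> H u"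
  using prodsI[of x "H s" y "H t" s t] prods_H[of s t u] by simp

lemma m_assoc:
  "0 < r \<Longrightarrow> 0 < s \<Longrightarrow> 0 < t \<Longrightarrow> rs = r + s \<Longrightarrow> st = s + t \<Longrightarrow> a \<in> H r \<Longrightarrow> b \<in> H s \<Longrightarrow> c \<in> H t \<Longrightarrow>
    m r st a (m s t b c) = m rs t (m r s a b) c"
  using assoc by simp

lemma m_closed_span:
  assumes st: "0 < s" "0 < t" and XY: "X \<subseteq> H s" "Y \<subseteq> H t" and S: "cvec.subspace S" "closed S"
    and mem: "\<And>x y. x \<in> X \<Longrightarrow> y \<in> Y \<Longrightarrow> m s t x y \<in> S"
    and x: "x \<in> closed_span X" and y: "y \<in> closed_span Y"
  shows "m s t x y \<in> S"
proof -
  have "x \<in> H s" using closed_span_minimal[OF XY(1) closed_H subspace_H] st x by blast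
  have 1: "m s t x y \<in> S" if y: "y \<in> Y" for y
    using y XY(2) by (intro lin_cont_maps_closed_span[OF lin_cont_left[OF st] subspace_H[OF st(1)]
          closed_H[OF st(1)] S XY(1) mem x]) auto
  show ?thesis
    by (rule lin_cont_maps_closed_span[OF lin_cont_right[OF st \<open>x \<in> H s\<close>] subspace_H[OF st(2)]
          closed_H[OF st(2)] S XY(2) 1 y])
qed

lemma m_closed_span_orthogonal:
  assumes "0 < s" "0 < t" "X \<subseteq> H s" "Y \<subseteq> H t"
    and "\<And>x y. x \<in> X \<Longrightarrow> y \<in> Y \<Longrightarrow> cinner (m s t x y) v = 0"
    and "x \<in> closed_span X" "y \<in> closed_span Y"
  shows "cinner (m s t x y) v = 0"
proof -
  have "m s t x y \<in> closed_span {z. cinner z v = 0}"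
  proof (rule m_closed_span[OF assms(1-4) subspace_closed_span closed_closure _ assms(6,7)])
    fix x y assume "x \<in> X" "y \<in> Y"
    from assms(5)[OF this] show "m s t x y \<in> closed_span {z. cinner z v = 0}"
      by (intro closed_span_superset CollectI)
  qed
  then show ?thesis by (rule orthogonal_closed_span_left[rotated]) simp
qed

lemma prods_closed_span:
  assumes "0 < s" "0 < t" "X \<subseteq> H s" "Y \<subseteq> H t"
  shows "prods s t (closed_span X) (closed_span Y) = prods s t X Y"
proof
  show "prods s t (closed_span X) (closed_span Y) \<subseteq> prods s t X Y"
    by (rule prods_subset[OF subspace_prods closed_prods],
        rule m_closed_span[OF assms subspace_prods closed_prods prodsI])
  show "prods s t X Y \<subseteq> prods s t (closed_span X) (closed_span Y)"
    by (intro prods_mono) (auto intro: closed_span_superset)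
qed

lemma closed_span_mult_eq_H:
  assumes st: "0 < s" "0 < t" "u = s + t" and XY: "closed_span X = H s" "closed_span Y = H t"
  shows "closed_span {m s t x y | x y. x \<in> X \<and> y \<in> Y} = H u"
proof -
  have "X \<subseteq> H s" "Y \<subseteq> H t" using XY by (auto intro: closed_span_superset)
  from prods_closed_span[OF st(1,2) this] show ?thesis
    unfolding XY prods_H[OF st] by (simp add: prods_def)
qed

lemma opposite: "graded_multiplication H (\<lambda>s t x y. m t s y x)"
proof
  fix s t :: real assume st: "0 < s" "0 < t"
  have "{m t s y x | x y. x \<in> H s \<and> y \<in> H t} = {m t s x y | x y. x \<in> H t \<and> y \<in> H s}" by blast
  then show "closed_span {m t s y x | x y. x \<in> H s \<and> y \<in> H t} = H (s + t)"
    using total[OF st(2,1)] by (simp add: add.commute)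
next
  fix r s t :: real and a b c
  assume "0 < r" "0 < s" "0 < t" "a \<in> H r" "b \<in> H s" "c \<in> H t"
  then show "m (s + t) r (m t s c b) a = m t (r + s) c (m s r b a)"
    using assoc[of t s r c b a] by (simp add: add.commute)
qed (simp_all add: subspace_H closed_H separable_H lin_cont_left lin_cont_right cinner_m mult.commute)

end

text \<open>A product subsystem of a graded multiplication.\<close>

locale graded_subsystem = graded_multiplication H m
  for H :: "real \<Rightarrow> 'a::chilbert_space set" and m :: "real \<Rightarrow> real \<Rightarrow> 'a \<Rightarrow> 'a \<Rightarrow> 'a" +
  fixes G :: "real \<Rightarrow> 'a set"
  assumes subspace_G: "0 < t \<Longrightarrow> cvec.subspace (G t)"
    and closed_G: "0 < t \<Longrightarrow> closed (G t)"
    and G_nonzero: "0 < t \<Longrightarrow> G t \<noteq> {0}"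
    and G_subset_H: "0 < t \<Longrightarrow> G t \<subseteq> H t"
    and total_G: "0 < s \<Longrightarrow> 0 < t \<Longrightarrow> closed_span {m s t x y | x y. x \<in> G s \<and> y \<in> G t} = G (s + t)"
begin

lemma prods_G: "0 < s \<Longrightarrow> 0 < t \<Longrightarrow> u = s + t \<Longrightarrow> prods s t (G s) (G t) = G u"
  unfolding prods_def by (simp add: total_G)

lemma m_in_G: "0 < s \<Longrightarrow> 0 < t \<Longrightarrow> u = s + t \<Longrightarrow> x \<in> G s \<Longrightarrow> y \<in> G t \<Longrightarrow> m s t x y \<in> G u"
  using prodsI[of x "G s" y "G t" s t] prods_G[of s t u] by simp

lemma G_in_H: "0 < t \<Longrightarrow> x \<in> G t \<Longrightarrow> x \<in> H t"
  using G_subset_H by blast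

lemma opposite_subsystem: "graded_subsystem H (\<lambda>s t x y. m t s y x) G"
proof -
  interpret op: graded_multiplication H "\<lambda>s t x y. m t s y x" by (rule opposite)
  show ?thesis
  proof
    fix s t :: real assume st: "0 < s" "0 < t"
    have "{m t s y x | x y. x \<in> G s \<and> y \<in> G t} = {m t s x y | x y. x \<in> G t \<and> y \<in> G s}" by blast
    then show "closed_span {m t s y x | x y. x \<in> G s \<and> y \<in> G t} = G (s + t)"
      using total_G[OF st(2,1)] by (simp add: add.commute)
  qed (simp_all add: subspace_G closed_G G_nonzero G_subset_H)
qed

section \<open>Triviality of germs\<close>

text \<open>
  No nonzero vector is orthogonal to \<open>H (t - h) \<circ> G h\<close> for all \<open>0 < h < t\<close>. Otherwise such a vector
  \<open>l\<close> can be shifted: the vectors \<open>(g s \<circ> l) \<circ> g (1 - s)\<close> in \<open>H (t + 1)\<close>, where \<open>g\<close> is any section of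
  nonzero vectors of \<open>G\<close>, are pairwise orthogonal for \<open>0 < s < min 1 t\<close>, which contradicts separability.
\<close>

lemma left_germ_trivial:
  assumes t: "0 < t" and l: "l \<in> H t"
    and orth: "\<And>h x y. 0 < h \<Longrightarrow> h < t \<Longrightarrow> x \<in> H (t - h) \<Longrightarrow> y \<in> G h \<Longrightarrow> cinner (m (t - h) h x y) l = 0"
  shows "l = 0"
proof (rule ccontr)
  assume "l \<noteq> 0"
  have "\<exists>x\<in>G s. x \<noteq> 0" if "0 < s" for s
    using G_nonzero[OF that] cvec.subspace_0[OF subspace_G[OF that]] by blast
  then obtain g where g: "\<And>s. 0 < s \<Longrightarrow> g s \<in> G s" "\<And>s. 0 < s \<Longrightarrow> g s \<noteq> 0" by metis
  then have gH: "g s \<in> H s" if "0 < s" for s using G_in_H that by blast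
  define I where "I = {0<..<min 1 t}"
  define w where "w s = m (s + t) (1 - s) (m s t (g s) l) (g (1 - s))" for s
  have gl: "m s t (g s) l \<in> H (s + t)" if "0 < s" for s
    using that t l by (intro m_in_H gH) simp_all
  have wH: "w s \<in> H (t + 1)" if "s \<in> I" for s
    unfolding w_def using that t by (intro m_in_H gl gH) (auto simp: I_def)
  have wnz: "w s \<noteq> 0" if s: "s \<in> I" for s
  proof -
    have s': "0 < s" "s < 1" using s by (auto simp: I_def)
    have "cinner (w s) (w s) = cinner (m s t (g s) l) (m s t (g s) l) * cinner (g (1 - s)) (g (1 - s))"
      unfolding w_def using s' t by (intro cinner_m gl gH) auto
    also have "cinner (m s t (g s) l) (m s t (g s) l) = cinner (g s) (g s) * cinner l l"
      using s' t l by (intro cinner_m gH) auto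
    finally have "cinner (w s) (w s) \<noteq> 0" using g(2) s' \<open>l \<noteq> 0\<close> by (simp add: cinner_self)
    then show ?thesis by auto
  qed
  have orth_less: "cinner (w s) (w s') = 0" if s: "s \<in> I" "s' \<in> I" "s < s'" for s s'
  proof -
    define h where "h = s' - s"
    have s': "0 < s" "s < 1" "s < t" "0 < s'" "s' < 1" "s' < t" "0 < h" "h < t" "0 < s + t" "0 < s' + t" "0 < t - h"
      using s t by (auto simp: I_def h_def)
    have GH: "G h \<subseteq> H h" "G (1 - s') \<subseteq> H (1 - s')" using s' by (auto intro: G_in_H)
    \<comment> \<open>On \<open>[s + t, s' + t]\<close> the vector \<open>w s\<close> is in \<open>G\<close>, whereas \<open>w s'\<close> is orthogonal to
      \<open>G\<close> there, because this is the final segment, of length \<open>h\<close>, of the factor \<open>l\<close>.\<close>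
    have a: "cinner (m (s + t) h x n) (m s' t (g s') l) = 0" if x: "x \<in> H (s + t)" and n: "n \<in> G h" for x n
    proof (rule m_closed_span_orthogonal[of _ _ "{m s' (t - h) p q | p q. p \<in> H s' \<and> q \<in> H (t - h)}" "G h"])
      show "{m s' (t - h) p q | p q. p \<in> H s' \<and> q \<in> H (t - h)} \<subseteq> H (s + t)"
        using s' by (auto intro!: m_in_H simp: h_def)
      show "x \<in> closed_span {m s' (t - h) p q | p q. p \<in> H s' \<and> q \<in> H (t - h)}"
        using x prods_H[of s' "t - h" "s + t"] s' by (simp add: prods_def h_def)
      show "n \<in> closed_span (G h)" using n by (rule closed_span_superset)
      fix x n assume "x \<in> {m s' (t - h) p q | p q. p \<in> H s' \<and> q \<in> H (t - h)}" and n: "n \<in> G h"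
      then obtain p q where x: "x = m s' (t - h) p q" and pq: "p \<in> H s'" "q \<in> H (t - h)" by blast
      have nH: "n \<in> H h" using n GH by blast
      have "m (s + t) h x n = m s' t p (m (t - h) h q n)"
        unfolding x by (rule m_assoc[symmetric]) (use s' pq nH in \<open>simp_all add: h_def\<close>)
      moreover have "cinner (m s' t p (m (t - h) h q n)) (m s' t (g s') l) = cinner p (g s') * cinner (m (t - h) h q n) l"
        by (intro cinner_m m_in_H gH) (use s' t pq l nH in simp_all)
      ultimately show "cinner (m (s + t) h x n) (m s' t (g s') l) = 0"
        using orth[of h q n] s' pq n by simp
    qed (use s' GH in auto)
    have "cinner (m (s + t) (1 - s) (m s t (g s) l) (g (1 - s))) (w s') = 0"
    proof (rule m_closed_span_orthogonal[of _ _ "{m s t (g s) l}" "{m h (1 - s') n n' | n n'. n \<in> G h \<and> n' \<in> G (1 - s')}"])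
      show "{m h (1 - s') n n' | n n'. n \<in> G h \<and> n' \<in> G (1 - s')} \<subseteq> H (1 - s)"
        using s' GH by (auto intro!: m_in_H simp: h_def)
      show "g (1 - s) \<in> closed_span {m h (1 - s') n n' | n n'. n \<in> G h \<and> n' \<in> G (1 - s')}"
        using g(1)[of "1 - s"] prods_G[of h "1 - s'" "1 - s"] s' by (simp add: prods_def h_def)
      show "m s t (g s) l \<in> closed_span {m s t (g s) l}" by (rule closed_span_superset) simp
      show "{m s t (g s) l} \<subseteq> H (s + t)" using gl s' by simp
      fix x y assume x: "x \<in> {m s t (g s) l}" and "y \<in> {m h (1 - s') n n' | n n'. n \<in> G h \<and> n' \<in> G (1 - s')}"
      then obtain n n' where y: "y = m h (1 - s') n n'" and nn: "n \<in> G h" "n' \<in> G (1 - s')" by blast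
      have xH: "x \<in> H (s + t)" using x gl s' by simp
      have nH: "n \<in> H h" "n' \<in> H (1 - s')" using nn GH by auto
      have "m (s + t) (1 - s) x y = m (s' + t) (1 - s') (m (s + t) h x n) n'"
        unfolding y by (rule m_assoc) (use s' xH nH in \<open>simp_all add: h_def\<close>)
      moreover have "cinner (m (s' + t) (1 - s') (m (s + t) h x n) n') (w s')
          = cinner (m (s + t) h x n) (m s' t (g s') l) * cinner n' (g (1 - s'))"
        unfolding w_def by (intro cinner_m m_in_H gH gl) (use s' xH nH t l in \<open>simp_all add: h_def gH\<close>)
      ultimately show "cinner (m (s + t) (1 - s) x y) (w s') = 0" using a[OF xH nn(1)] by simp
    qed (use s' in auto)
    then show ?thesis by (simp add: w_def)
  qed
  obtain D where D: "countable D" "closed_span D = H (t + 1)" using separable_H[of "t + 1"] t by auto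
  have "countable I"
  proof (rule countable_orthogonal_family[OF D(1)])
    show "w s \<in> closed_span D" "w s \<noteq> 0" if "s \<in> I" for s using that wH wnz D by auto
    show "cinner (w s) (w s') = 0" if "s \<in> I" "s' \<in> I" "s \<noteq> s'" for s s'
      using orth_less[of s s'] orth_less[of s' s] that cinner_eq_0_commute by (cases "s < s'") auto
  qed
  then show False using uncountable_open_interval[of 0 "min 1 t"] t by (simp add: I_def)
qed

lemma left_germ_dense:
  assumes t: "0 < t"
  shows "closed_span {m a (t - a) x y | a x y. 0 < a \<and> a < t \<and> x \<in> H a \<and> y \<in> G (t - a)} = H t"
    (is "closed_span ?X = _")
proof (rule orthogonal_complement_trivial[OF subspace_closed_span closed_closure _ subspace_H[OF t]])
  have "?X \<subseteq> H t" using G_in_H by (auto intro!: m_in_H)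
  then show "closed_span ?X \<subseteq> H t" by (intro closed_span_minimal closed_H subspace_H t)
  fix l assume l: "l \<in> H t" "\<And>z. z \<in> closed_span ?X \<Longrightarrow> cinner z l = 0"
  show "l = 0"
  proof (rule left_germ_trivial[OF t l(1)])
    fix h x y assume h: "0 < h" "h < t" "x \<in> H (t - h)" "y \<in> G h"
    then have "m (t - h) h x y \<in> ?X" by (intro CollectI exI[of _ "t - h"] exI[of _ x] exI[of _ y]) simp
    then show "cinner (m (t - h) h x y) l = 0" by (intro l(2) closed_span_superset)
  qed
qed

lemma right_germ_dense:
  assumes t: "0 < t"
  shows "closed_span {m a (t - a) x y | a x y. 0 < a \<and> a < t \<and> x \<in> G a \<and> y \<in> H (t - a)} = H t"
    (is "closed_span ?X = _")
proof -
  interpret op: graded_subsystem H "\<lambda>s t x y. m t s y x" G by (rule opposite_subsystem)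
  have "?X = {m (t - a) a y x | a x y. 0 < a \<and> a < t \<and> x \<in> H a \<and> y \<in> G (t - a)}" (is "_ = ?Y")
  proof
    show "?X \<subseteq> ?Y"
    proof safe
      fix a x y assume "0 < a" "a < t" "x \<in> G a" "y \<in> H (t - a)"
      then show "\<exists>a' x' y'. m a (t - a) x y = m (t - a') a' y' x' \<and> 0 < a' \<and> a' < t \<and> x' \<in> H a' \<and> y' \<in> G (t - a')"
        by (intro exI[of _ "t - a"] exI[of _ x] exI[of _ y]) simp
    qed
    show "?Y \<subseteq> ?X"
    proof safe
      fix a x y assume "0 < a" "a < t" "x \<in> H a" "y \<in> G (t - a)"
      then show "\<exists>a' x' y'. m (t - a) a y x = m a' (t - a') x' y' \<and> 0 < a' \<and> a' < t \<and> x' \<in> G a' \<and> y' \<in> H (t - a')"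
        by (intro exI[of _ "t - a"] exI[of _ y] exI[of _ x]) simp
    qed
  qed
  then show ?thesis using op.left_germ_dense[OF t] by simp
qed

end

context graded_subsystem
begin

section \<open>Vectors that lie in the subsystem outside an interval\<close>

text \<open>
  \<open>left_part t s\<close> is the space \<open>G s \<circ> H (t - s)\<close> of the vectors in \<open>H t\<close> that belong to the subsystem
  on \<open>[0, s]\<close>, and \<open>right_part t s\<close> is \<open>H s \<circ> G (t - s)\<close>. Both are defined for all real \<open>s\<close>, with \<open>s\<close>
  clamped to \<open>[0, t]\<close>; the fibre at time 0 is then an omitted factor.
\<close>

definition left_part :: "real \<Rightarrow> real \<Rightarrow> 'a set"
  where "left_part t s =
    (if s \<le> 0 then H t else if s < t then prods s (t - s) (G s) (H (t - s)) else G t)"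

definition right_part :: "real \<Rightarrow> real \<Rightarrow> 'a set"
  where "right_part t s =
    (if t \<le> s then H t else if 0 < s then prods s (t - s) (H s) (G (t - s)) else G t)"

lemma
  assumes "0 < t"
  shows subspace_left_part: "cvec.subspace (left_part t s)"
    and closed_left_part: "closed (left_part t s)"
    and left_part_subset_H: "left_part t s \<subseteq> H t"
proof -
  show "cvec.subspace (left_part t s)" "closed (left_part t s)"
    using assms by (simp_all add: left_part_def subspace_H subspace_G subspace_prods closed_H closed_G closed_prods)
  have "prods s (t - s) (G s) (H (t - s)) \<subseteq> H t" if "0 < s" "s < t"
    using that assms by (intro prods_subset subspace_H closed_H) (auto intro: m_in_H G_in_H)
  then show "left_part t s \<subseteq> H t"
    using assms G_subset_H by (simp add: left_part_def)
qed

lemma left_part_antimono: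
  assumes t: "0 < t" and ab: "a \<le> b"
  shows "left_part t b \<subseteq> left_part t a"
proof -
  consider "a \<le> 0" | "t \<le> a" | "0 < a" "a < t" "t \<le> b" | "0 < a" "a < b" "b < t" | "a = b"
    using ab by linarith
  then show ?thesis
  proof cases
    case 1
    then show ?thesis using left_part_subset_H[OF t] by (simp add: left_part_def)
  next
    case 2
    then show ?thesis using t ab by (simp add: left_part_def)
  next
    case 3
    have "G t \<subseteq> prods a (t - a) (G a) (H (t - a))"
      using prods_G[of a "t - a" t] prods_mono[of "G a" "G a" "G (t - a)" "H (t - a)"] G_subset_H 3 by auto
    then show ?thesis using 3 t by (simp add: left_part_def)
  next
    case 4
    let ?S = "prods a (t - a) (G a) (H (t - a))" and ?X = "{m a (b - a) x y | x y. x \<in> G a \<and> y \<in> G (b - a)}"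
    have "prods b (t - b) (G b) (H (t - b)) \<subseteq> ?S"
    proof (rule prods_subset[OF subspace_prods closed_prods])
      fix x y assume xy: "x \<in> G b" "y \<in> H (t - b)"
      show "m b (t - b) x y \<in> ?S"
      proof (rule m_closed_span[OF _ _ _ _ subspace_prods closed_prods])
        show "?X \<subseteq> H b" "H (t - b) \<subseteq> H (t - b)" using 4 by (auto intro!: G_in_H m_in_G)
        show "x \<in> closed_span ?X" using prods_G[of a "b - a" b] xy 4 by (simp add: prods_def)
        show "y \<in> closed_span (H (t - b))" using xy by (intro closed_span_superset)
        fix x y assume "x \<in> ?X" and y: "y \<in> H (t - b)"
        then obtain p q where x: "x = m a (b - a) p q" "p \<in> G a" "q \<in> G (b - a)" by blast
        have "m b (t - b) x y = m a (t - a) p (m (b - a) (t - b) q y)"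
          unfolding x(1) by (rule m_assoc[symmetric]) (use 4 x y in \<open>simp_all add: G_in_H\<close>)
        moreover have "m (b - a) (t - b) q y \<in> H (t - a)"
          by (rule m_in_H) (use 4 x y in \<open>simp_all add: G_in_H\<close>)
        ultimately show "m b (t - b) x y \<in> ?S" using x(2) by (simp add: prodsI)
      qed (use 4 in auto)
    qed
    then show ?thesis using 4 by (simp add: left_part_def)
  qed simp
qed

lemma right_part_opposite:
  "right_part t s = graded_subsystem.left_part H (\<lambda>s t x y. m t s y x) G t (t - s)"
proof -
  interpret op: graded_subsystem H "\<lambda>s t x y. m t s y x" G by (rule opposite_subsystem)
  have "op.prods a b X Y = prods b a Y X" for a b X Y
    unfolding op.prods_def prods_def by (rule arg_cong[where f = "\<lambda>S. closed_span S"]) blast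
  then show ?thesis by (simp add: op.left_part_def right_part_def)
qed

lemma
  assumes t: "0 < t"
  shows subspace_right_part: "cvec.subspace (right_part t s)"
    and closed_right_part: "closed (right_part t s)"
    and right_part_subset_H: "right_part t s \<subseteq> H t"
    and right_part_mono: "a \<le> b \<Longrightarrow> right_part t a \<subseteq> right_part t b"
proof -
  interpret op: graded_subsystem H "\<lambda>s t x y. m t s y x" G by (rule opposite_subsystem)
  show "cvec.subspace (right_part t s)" "closed (right_part t s)" "right_part t s \<subseteq> H t"
    unfolding right_part_opposite
    by (rule op.subspace_left_part[OF t] op.closed_left_part[OF t] op.left_part_subset_H[OF t])+
  show "right_part t a \<subseteq> right_part t b" if "a \<le> b"
    unfolding right_part_opposite using that by (intro op.left_part_antimono t) simp
qed

text \<open>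
  A vector that is in the subsystem on \<open>[0, a]\<close> and on \<open>[b, t]\<close> lies in \<open>G a \<circ> H (b - a) \<circ> G (t - b)\<close>.
\<close>

lemma left_part_Int_right_part:
  assumes abt: "0 < a" "a < b" "b < t"
  shows "left_part t a \<inter> right_part t b
    \<subseteq> closed_span {m a (t - a) x (m (b - a) (t - b) y z) | x y z. x \<in> G a \<and> y \<in> H (b - a) \<and> z \<in> G (t - b)}"
    (is "_ \<subseteq> closed_span ?X")
proof
  fix v assume v: "v \<in> left_part t a \<inter> right_part t b"
  have t: "0 < t" using abt by simp
  let ?T = "closed_span ?X" and ?P = "orth_proj (closed_span ?X) v"
  have PT: "?P \<in> ?T" by (rule orth_proj_in[OF subspace_closed_span closed_closure])
  have L: "left_part t a = prods a (t - a) (G a) (H (t - a))" and R: "right_part t b = prods b (t - b) (H b) (G (t - b))"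
    using abt by (simp_all add: left_part_def right_part_def)
  have yz: "m (b - a) (t - b) y z \<in> H (t - a)" if "y \<in> H (b - a)" "z \<in> H (t - b)" for y z
    by (rule m_in_H) (use abt that in simp_all)
  have ass: "m a (t - a) x (m (b - a) (t - b) y z) = m b (t - b) (m a (b - a) x y) z"
    if "x \<in> H a" "y \<in> H (b - a)" "z \<in> H (t - b)" for x y z
    by (rule m_assoc) (use abt that in simp_all)
  have "?X \<subseteq> left_part t a"
  proof safe
    fix x y z assume xyz: "x \<in> G a" "y \<in> H (b - a)" "z \<in> G (t - b)"
    then show "m a (t - a) x (m (b - a) (t - b) y z) \<in> left_part t a"
      unfolding L using abt by (intro prodsI yz) (simp_all add: G_in_H)
  qed
  then have TL: "?T \<subseteq> left_part t a" by (intro closed_span_minimal subspace_left_part closed_left_part t)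
  have "?X \<subseteq> right_part t b"
  proof safe
    fix x y z assume xyz: "x \<in> G a" "y \<in> H (b - a)" "z \<in> G (t - b)"
    have "m a (b - a) x y \<in> H b" by (rule m_in_H) (use abt xyz in \<open>simp_all add: G_in_H\<close>)
    then show "m a (t - a) x (m (b - a) (t - b) y z) \<in> right_part t b"
      unfolding R using ass[of x y z] xyz abt by (simp add: G_in_H prodsI)
  qed
  then have TR: "?T \<subseteq> right_part t b" by (intro closed_span_minimal subspace_right_part closed_right_part t)
  define r where "r = v - ?P"
  have rT: "cinner z r = 0" if "z \<in> ?T" for z
    unfolding r_def by (rule orth_proj_orthogonal[OF subspace_closed_span closed_closure that])
  have rL: "r \<in> left_part t a" and rR: "r \<in> right_part t b"
    using v PT TL TR unfolding r_def
    by (auto intro!: cvec.subspace_diff subspace_left_part subspace_right_part t)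
  \<comment> \<open>A product whose last factor is orthogonal to \<open>G\<close> is orthogonal to \<open>right_part t b\<close>, and one whose
    last factor is in \<open>G\<close> belongs to the space onto which \<open>v\<close> was projected.\<close>
  have prod_orth: "cinner (m a (t - a) x (m (b - a) (t - b) y z)) r = 0"
    if x: "x \<in> G a" and y: "y \<in> H (b - a)" and z: "z \<in> G (t - b) \<union> (H (t - b) \<ominus> G (t - b))" for x y z
  proof (cases "z \<in> G (t - b)")
    case True
    then show ?thesis using x y by (intro rT closed_span_superset) blast
  next
    case False
    then have z: "z \<in> H (t - b)" "\<And>g. g \<in> G (t - b) \<Longrightarrow> cinner z g = 0" using z by (auto simp: orth_in_def)
    have xy: "m a (b - a) x y \<in> H b" by (rule m_in_H) (use abt x y in \<open>simp_all add: G_in_H\<close>)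
    have "cinner (m b (t - b) (m a (b - a) x y) z) r = 0"
    proof (rule orthogonal_closed_span)
      show "r \<in> closed_span {m b (t - b) p q | p q. p \<in> H b \<and> q \<in> G (t - b)}"
        using rR by (simp add: R prods_def)
      fix w assume "w \<in> {m b (t - b) p q | p q. p \<in> H b \<and> q \<in> G (t - b)}"
      then obtain p q where w: "w = m b (t - b) p q" "p \<in> H b" "q \<in> G (t - b)" by blast
      have "cinner (m b (t - b) (m a (b - a) x y) z) (m b (t - b) p q) = cinner (m a (b - a) x y) p * cinner z q"
        by (rule cinner_m) (use abt xy z w in \<open>simp_all add: G_in_H\<close>)
      then show "cinner (m b (t - b) (m a (b - a) x y) z) w = 0" using z(2) w by simp
    qed
    then show ?thesis using ass[of x y z] x y z abt by (simp add: G_in_H)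
  qed
  have dense: "closed_span {m (b - a) (t - b) y z | y z. y \<in> H (b - a) \<and> z \<in> G (t - b) \<union> (H (t - b) \<ominus> G (t - b))} = H (t - a)"
    using abt by (intro closed_span_mult_eq_H closed_span_Un_orth_in subspace_G closed_G G_subset_H subspace_H closed_H
        closed_span_eq) auto
  have "cinner r r = 0"
  proof (rule orthogonal_closed_span_left)
    show "r \<in> closed_span {m a (t - a) x y | x y. x \<in> G a \<and> y \<in> H (t - a)}" using rL by (simp add: L prods_def)
    fix w assume "w \<in> {m a (t - a) x y | x y. x \<in> G a \<and> y \<in> H (t - a)}"
    then obtain x y where w: "w = m a (t - a) x y" "x \<in> G a" "y \<in> H (t - a)" by blast
    show "cinner w r = 0" unfolding w(1)
    proof (rule m_closed_span_orthogonal[where X = "G a"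
          and Y = "{m (b - a) (t - b) y z | y z. y \<in> H (b - a) \<and> z \<in> G (t - b) \<union> (H (t - b) \<ominus> G (t - b))}"])
      show "{m (b - a) (t - b) y z | y z. y \<in> H (b - a) \<and> z \<in> G (t - b) \<union> (H (t - b) \<ominus> G (t - b))} \<subseteq> H (t - a)"
        unfolding dense[symmetric] by (blast intro: closed_span_superset)
      show "y \<in> closed_span {m (b - a) (t - b) y z | y z. y \<in> H (b - a) \<and> z \<in> G (t - b) \<union> (H (t - b) \<ominus> G (t - b))}"
        unfolding dense by (rule w(3))
      show "x \<in> closed_span (G a)" using w by (intro closed_span_superset)
    qed (use abt prod_orth G_in_H in auto)
  qed
  then have "r = 0" by (simp add: cinner_self)
  then show "v \<in> ?T" using PT by (simp add: r_def)
qed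

text \<open>
  The vector \<open>z\<close> has no component that is orthogonal to \<open>G\<close> both on \<open>[0, s]\<close> and on \<open>[s, t]\<close>. Hence
  the part of it that is orthogonal to \<open>G\<close> on \<open>[0, s]\<close> is in \<open>G\<close> on \<open>[s, t]\<close>.
\<close>

lemma diff_orth_proj_left_part:
  assumes t: "0 < t" and z: "z \<in> H t"
    and prime: "\<And>r x y. 0 < r \<Longrightarrow> r < t \<Longrightarrow> x \<in> H r \<ominus> G r \<Longrightarrow> y \<in> H (t - r) \<ominus> G (t - r) \<Longrightarrow>
      cinner (m r (t - r) x y) z = 0"
  shows "z - orth_proj (left_part t s) z \<in> right_part t s"
proof -
  note L = subspace_left_part[OF t] closed_left_part[OF t] and R = subspace_right_part[OF t] closed_right_part[OF t]
  have PL: "orth_proj (left_part t s) z \<in> left_part t s" by (rule orth_proj_in[OF L])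
  consider "s \<le> 0" | "t \<le> s" | "0 < s" "s < t" by linarith
  then show ?thesis
  proof cases
    case 1
    then have "orth_proj (left_part t s) z = z"
      using z by (intro orth_proj_unique L) (simp_all add: left_part_def)
    then show ?thesis using cvec.subspace_0[OF R(1)] by simp
  next
    case 2
    have "orth_proj (left_part t s) z \<in> H t" using PL left_part_subset_H[OF t] by blast
    then show ?thesis using 2 z by (simp add: right_part_def cvec.subspace_diff subspace_H t)
  next
    case 3
    let ?d = "z - orth_proj (left_part t s) z"
    define d' where "d' = ?d - orth_proj (right_part t s) ?d"
    have PR: "orth_proj (right_part t s) ?d \<in> right_part t s" by (rule orth_proj_in[OF R])
    have d'R: "cinner v d' = 0" if "v \<in> right_part t s" for v
      unfolding d'_def by (rule orth_proj_orthogonal[OF R that])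
    have dL: "cinner v ?d = 0" if "v \<in> left_part t s" for v
      by (rule orth_proj_orthogonal[OF L that])
    have Leq: "left_part t s = closed_span {m s (t - s) x y | x y. x \<in> G s \<and> y \<in> H (t - s)}"
      and Req: "right_part t s = closed_span {m s (t - s) x y | x y. x \<in> H s \<and> y \<in> G (t - s)}"
      using 3 by (simp_all add: left_part_def right_part_def prods_def)
    let ?X = "\<lambda>s. G s \<union> (H s \<ominus> G s)"
    have XH: "x \<in> H r" if "x \<in> ?X r" "0 < r" for x r using that G_in_H by (auto simp: orth_in_def)
    have orthR: "cinner (m s (t - s) x y) v = 0"
      if x: "x \<in> H s" and y: "y \<in> H (t - s) \<ominus> G (t - s)" and v: "v \<in> right_part t s" for x y v
    proof (rule orthogonal_closed_span[OF _ v[unfolded Req]])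
      fix w assume "w \<in> {m s (t - s) x y | x y. x \<in> H s \<and> y \<in> G (t - s)}"
      then obtain p q where w: "w = m s (t - s) p q" "p \<in> H s" "q \<in> G (t - s)" by blast
      have "cinner (m s (t - s) x y) w = cinner x p * cinner y q"
        unfolding w(1) by (rule cinner_m) (use 3 x y w in \<open>simp_all add: G_in_H orth_in_def\<close>)
      then show "cinner (m s (t - s) x y) w = 0" using y w by (simp add: orth_in_def)
    qed
    have orthL: "cinner (m s (t - s) x y) v = 0"
      if x: "x \<in> H s \<ominus> G s" and y: "y \<in> H (t - s)" and v: "v \<in> left_part t s" for x y v
    proof (rule orthogonal_closed_span[OF _ v[unfolded Leq]])
      fix w assume "w \<in> {m s (t - s) x y | x y. x \<in> G s \<and> y \<in> H (t - s)}"
      then obtain p q where w: "w = m s (t - s) p q" "p \<in> G s" "q \<in> H (t - s)" by blast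
      have "cinner (m s (t - s) x y) w = cinner x p * cinner y q"
        unfolding w(1) by (rule cinner_m) (use 3 x y w in \<open>simp_all add: G_in_H orth_in_def\<close>)
      then show "cinner (m s (t - s) x y) w = 0" using x w by (simp add: orth_in_def)
    qed
    have gen: "cinner (m s (t - s) x y) d' = 0" if xy: "x \<in> ?X s" "y \<in> ?X (t - s)" for x y
    proof -
      have xyH: "x \<in> H s" "y \<in> H (t - s)" using XH xy 3 by auto
      show ?thesis
      proof (cases "y \<in> G (t - s)")
        case True
        then show ?thesis using xyH 3 by (intro d'R) (auto simp: right_part_def intro: prodsI)
      next
        case False
        then have y: "y \<in> H (t - s) \<ominus> G (t - s)" using xy by blast
        have "cinner (m s (t - s) x y) ?d = 0"
        proof (cases "x \<in> G s")
          case True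
          then show ?thesis using xyH 3 by (intro dL) (auto simp: left_part_def intro: prodsI)
        next
          case False
          then have x: "x \<in> H s \<ominus> G s" using xy by blast
          show ?thesis
            using prime[OF 3 x y] orthL[OF x xyH(2) PL] by (simp add: cinner_diff_right)
        qed
        then show ?thesis
          using orthR[OF xyH(1) y PR] by (simp add: d'_def cinner_diff_right)
      qed
    qed
    have span: "closed_span (?X r) = H r" if "0 < r" for r
      using that by (intro closed_span_Un_orth_in subspace_G closed_G G_subset_H subspace_H closed_H)
    have "d' \<in> H t"
      unfolding d'_def using z PL PR left_part_subset_H[OF t] right_part_subset_H[OF t]
      by (intro cvec.subspace_diff subspace_H t) auto
    also have "H t = closed_span {m s (t - s) x y | x y. x \<in> ?X s \<and> y \<in> ?X (t - s)}"
      using 3 by (intro closed_span_mult_eq_H[symmetric] span) auto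
    finally have "cinner d' d' = 0"
      by (rule orthogonal_closed_span_left[rotated]) (use gen in blast)
    then have "?d = orth_proj (right_part t s) ?d" by (simp add: cinner_self d'_def)
    then show ?thesis using PR by simp
  qed
qed

end

section \<open>Pairings of two subsystems\<close>

text \<open>
  The situation of the theorem with the tensor product replaced by a map \<open>\<tau>\<close>, which may be \<open>x \<otimes> y\<close>
  or \<open>y \<otimes> x\<close>. The family \<open>J\<close> stands for the subsystem generated by \<open>\<tau>(H, N)\<close> and \<open>\<tau>(M, K)\<close>; only
  closure properties of it are needed.
\<close>

locale subsystem_pairing =
  E: graded_subsystem H m M + F: graded_subsystem K n N
  for H :: "real \<Rightarrow> 'a::chilbert_space set" and m M
    and K :: "real \<Rightarrow> 'b::chilbert_space set" and n N +
  fixes \<tau> :: "'a \<Rightarrow> 'b \<Rightarrow> 'c::chilbert_space" and J :: "real \<Rightarrow> 'c set"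
  assumes cinner_\<tau>: "cinner (\<tau> x y) (\<tau> x' y') = cinner x x' * cinner y y'"
    and lin_cont_\<tau>_left: "lin_cont UNIV (\<lambda>x. \<tau> x y)"
    and lin_cont_\<tau>_right: "lin_cont UNIV (\<lambda>y. \<tau> x y)"
    and subspace_J: "0 < t \<Longrightarrow> cvec.subspace (J t)"
    and closed_J: "0 < t \<Longrightarrow> closed (J t)"
    and J_mult: "0 < s \<Longrightarrow> 0 < t \<Longrightarrow> x \<in> H s \<Longrightarrow> y \<in> K s \<Longrightarrow> x' \<in> H t \<Longrightarrow> y' \<in> K t \<Longrightarrow>
      \<tau> x y \<in> J s \<Longrightarrow> \<tau> x' y' \<in> J t \<Longrightarrow> \<tau> (m s t x x') (n s t y y') \<in> J (s + t)"
    and J_right: "0 < t \<Longrightarrow> x \<in> H t \<Longrightarrow> y \<in> N t \<Longrightarrow> \<tau> x y \<in> J t"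
    and J_left: "0 < t \<Longrightarrow> x \<in> M t \<Longrightarrow> y \<in> K t \<Longrightarrow> \<tau> x y \<in> J t"
begin

lemma \<tau>_add_left: "\<tau> (x + x') y = \<tau> x y + \<tau> x' y" and \<tau>_add_right: "\<tau> x (y + y') = \<tau> x y + \<tau> x y'"
  and \<tau>_scaleC_left: "\<tau> (c *\<^sub>C x) y = c *\<^sub>C \<tau> x y"
  using lin_cont_\<tau>_left[of y] lin_cont_\<tau>_right[of x] by (simp_all add: lin_cont_def)

lemma \<tau>_diff_left: "\<tau> (x - x') y = \<tau> x y - \<tau> x' y"
  using \<tau>_add_left[of "x - x'" x' y] by simp

lemma \<tau>_diff_right: "\<tau> x (y - y') = \<tau> x y - \<tau> x y'"
  using \<tau>_add_right[of x "y - y'" y'] by simp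

lemma \<tau>_zero_left: "\<tau> 0 y = 0"
  using \<tau>_diff_left[of 0 0 y] by simp

lemma norm_\<tau>: "norm (\<tau> x y) = norm x * norm y"
proof -
  have "complex_of_real ((norm (\<tau> x y))\<^sup>2) = complex_of_real ((norm x * norm y)\<^sup>2)"
    using cinner_\<tau>[of x y x y] by (simp add: cinner_self power_mult_distrib)
  then have "(norm (\<tau> x y))\<^sup>2 = (norm x * norm y)\<^sup>2" using of_real_eq_iff by blast
  then show ?thesis by (simp add: power2_eq_iff_nonneg)
qed

lemma J_closed_span_right:
  assumes "0 < t" "\<And>y. y \<in> Y \<Longrightarrow> \<tau> x y \<in> J t" "y \<in> closed_span Y"
  shows "\<tau> x y \<in> J t"
  by (rule lin_cont_maps_closed_span[OF lin_cont_\<tau>_right cvec.subspace_UNIV closed_UNIV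
        subspace_J[OF assms(1)] closed_J[OF assms(1)] subset_UNIV assms(2,3)])

lemma J_closed_span_left:
  assumes "0 < t" "\<And>x. x \<in> X \<Longrightarrow> \<tau> x y \<in> J t" "x \<in> closed_span X"
  shows "\<tau> x y \<in> J t"
  by (rule lin_cont_maps_closed_span[OF lin_cont_\<tau>_left cvec.subspace_UNIV closed_UNIV
        subspace_J[OF assms(1)] closed_J[OF assms(1)] subset_UNIV assms(2,3)])

lemma J_mult':
  "0 < s \<Longrightarrow> 0 < t \<Longrightarrow> u = s + t \<Longrightarrow> x \<in> H s \<Longrightarrow> y \<in> K s \<Longrightarrow> x' \<in> H t \<Longrightarrow> y' \<in> K t \<Longrightarrow>
      \<tau> x y \<in> J s \<Longrightarrow> \<tau> x' y' \<in> J t \<Longrightarrow> \<tau> (m s t x x') (n s t y y') \<in> J u"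
  using J_mult by simp

text \<open>
  The vectors \<open>e\<close> for which there is a neighbourhood of \<open>x\<close> such that \<open>\<tau> e z\<close> is in \<open>J\<close> for every \<open>z\<close>
  that is in \<open>N\<close> outside this neighbourhood. Among them are the vectors that are in \<open>M\<close> near \<open>x\<close>,
  which are dense by the triviality of germs.
\<close>

definition local_space :: "real \<Rightarrow> real \<Rightarrow> 'a set"
  where "local_space t x = {e \<in> H t. \<exists>a<x. \<exists>b>x. \<forall>z \<in> F.left_part t a \<inter> F.right_part t b. \<tau> e z \<in> J t}"

lemma local_spaceI:
  "e \<in> H t \<Longrightarrow> a < x \<Longrightarrow> x < b \<Longrightarrow> (\<And>z. z \<in> F.left_part t a \<Longrightarrow> z \<in> F.right_part t b \<Longrightarrow> \<tau> e z \<in> J t)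
    \<Longrightarrow> e \<in> local_space t x"
  unfolding local_space_def by blast

lemma subspace_local_space:
  assumes t: "0 < t"
  shows "cvec.subspace (local_space t x)"
proof (rule cvec.subspaceI)
  show "0 \<in> local_space t x"
    by (rule local_spaceI[of _ _ "x - 1" _ "x + 1"])
       (simp_all add: \<tau>_zero_left cvec.subspace_0 E.subspace_H subspace_J t)
next
  fix e e' assume "e \<in> local_space t x" "e' \<in> local_space t x"
  then obtain a b a' b' where e: "e \<in> H t" "a < x" "x < b" "\<And>z. z \<in> F.left_part t a \<inter> F.right_part t b \<Longrightarrow> \<tau> e z \<in> J t"
    and e': "e' \<in> H t" "a' < x" "x < b'" "\<And>z. z \<in> F.left_part t a' \<inter> F.right_part t b' \<Longrightarrow> \<tau> e' z \<in> J t"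
    unfolding local_space_def by blast
  show "e + e' \<in> local_space t x"
  proof (rule local_spaceI[of _ _ "max a a'" _ "min b b'"])
    fix z assume z: "z \<in> F.left_part t (max a a')" "z \<in> F.right_part t (min b b')"
    have "z \<in> F.left_part t a" "z \<in> F.left_part t a'" "z \<in> F.right_part t b" "z \<in> F.right_part t b'"
      using F.left_part_antimono[OF t, of a "max a a'"] F.left_part_antimono[OF t, of a' "max a a'"]
        F.right_part_mono[OF t, of "min b b'" b] F.right_part_mono[OF t, of "min b b'" b'] z by auto
    then show "\<tau> (e + e') z \<in> J t"
      using e(4) e'(4) by (simp add: \<tau>_add_left cvec.subspace_add subspace_J t)
  qed (use e e' in \<open>simp_all add: cvec.subspace_add E.subspace_H t\<close>)
next
  fix c e assume "e \<in> local_space t x"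
  then obtain a b where e: "e \<in> H t" "a < x" "x < b" "\<And>z. z \<in> F.left_part t a \<inter> F.right_part t b \<Longrightarrow> \<tau> e z \<in> J t"
    unfolding local_space_def by blast
  show "c *\<^sub>C e \<in> local_space t x"
    by (rule local_spaceI[of _ _ a _ b])
       (use e in \<open>simp_all add: \<tau>_scaleC_left cvec.subspace_scale E.subspace_H subspace_J t\<close>)
qed

text \<open>
  At an interior point, \<open>H t = H x \<circ> H (t - x)\<close> and both factors are approximated; at the end points
  only one side of \<open>x\<close> is present.
\<close>

lemma local_space_dense:
  assumes t: "0 < t" and x: "0 \<le> x" "x \<le> t"
  shows "H t \<subseteq> closure (local_space t x)"
proof -
  have "\<exists>X. X \<subseteq> local_space t x \<and> closed_span X = H t"
  proof -
    consider "x = 0" | "x = t" | "0 < x" "x < t" using x by linarith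
    then show ?thesis
    proof cases
      case 1
      have "m a (t - a) g y \<in> local_space t x" if a: "0 < a" "a < t" and gy: "g \<in> M a" "y \<in> H (t - a)" for a g y
      proof (rule local_spaceI[of _ _ "- 1" _ a])
        fix z assume "z \<in> F.right_part t a"
        then have z: "z \<in> closed_span {n a (t - a) p q | p q. p \<in> K a \<and> q \<in> N (t - a)}"
          using a by (simp add: F.right_part_def F.prods_def)
        show "\<tau> (m a (t - a) g y) z \<in> J t"
        proof (rule J_closed_span_right[OF t _ z])
          fix w assume "w \<in> {n a (t - a) p q | p q. p \<in> K a \<and> q \<in> N (t - a)}"
          then obtain p q where w: "w = n a (t - a) p q" "p \<in> K a" "q \<in> N (t - a)" by blast
          show "\<tau> (m a (t - a) g y) w \<in> J t"
            unfolding w(1) by (rule J_mult') (use a gy w in \<open>simp_all add: E.G_in_H F.G_in_H J_left J_right\<close>)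
        qed
      qed (use a gy 1 in \<open>auto intro!: E.m_in_H intro: E.G_in_H\<close>)
      then have "{m a (t - a) g y | a g y. 0 < a \<and> a < t \<and> g \<in> M a \<and> y \<in> H (t - a)} \<subseteq> local_space t x"
        by blast
      then show ?thesis using E.right_germ_dense[OF t] by blast
    next
      case 2
      have "m a (t - a) y g \<in> local_space t x" if a: "0 < a" "a < t" and gy: "y \<in> H a" "g \<in> M (t - a)" for a g y
      proof (rule local_spaceI[of _ _ a _ "t + 1"])
        fix z assume "z \<in> F.left_part t a"
        then have z: "z \<in> closed_span {n a (t - a) p q | p q. p \<in> N a \<and> q \<in> K (t - a)}"
          using a by (simp add: F.left_part_def F.prods_def)
        show "\<tau> (m a (t - a) y g) z \<in> J t"
        proof (rule J_closed_span_right[OF t _ z])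
          fix w assume "w \<in> {n a (t - a) p q | p q. p \<in> N a \<and> q \<in> K (t - a)}"
          then obtain p q where w: "w = n a (t - a) p q" "p \<in> N a" "q \<in> K (t - a)" by blast
          show "\<tau> (m a (t - a) y g) w \<in> J t"
            unfolding w(1) by (rule J_mult') (use a gy w in \<open>simp_all add: E.G_in_H F.G_in_H J_left J_right\<close>)
        qed
      qed (use a gy 2 in \<open>auto intro!: E.m_in_H intro: E.G_in_H\<close>)
      then have "{m a (t - a) y g | a y g. 0 < a \<and> a < t \<and> y \<in> H a \<and> g \<in> M (t - a)} \<subseteq> local_space t x"
        by blast
      then show ?thesis using E.left_germ_dense[OF t] by blast
    next
      case 3
      let ?P = "{m a (x - a) u g | a u g. 0 < a \<and> a < x \<and> u \<in> H a \<and> g \<in> M (x - a)}"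
      let ?Q = "{m b (t - x - b) g u | b g u. 0 < b \<and> b < t - x \<and> g \<in> M b \<and> u \<in> H (t - x - b)}"
      have "m x (t - x) p q \<in> local_space t x" if p: "p \<in> ?P" and q: "q \<in> ?Q" for p q
      proof -
        obtain a u g where p: "p = m a (x - a) u g" and a: "0 < a" "a < x" and ug: "u \<in> H a" "g \<in> M (x - a)"
          using p by blast
        obtain b u' g' where q: "q = m b (t - x - b) g' u'" and b: "0 < b" "b < t - x"
          and ug': "u' \<in> H (t - x - b)" "g' \<in> M b"
          using q by blast
        define c where "c = x + b"
        have abc: "0 < a" "a < x" "x < c" "c < t" "b = c - x" "t - x - b = t - c" using a b by (auto simp: c_def)
        have qc: "q = m (c - x) (t - c) g' u'" unfolding q abc(6) by (simp add: c_def)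
        have gH: "g \<in> H (x - a)" "g' \<in> H (c - x)" and ugc: "u' \<in> H (t - c)" "g' \<in> M (c - x)"
          using ug ug' abc by (simp_all add: E.G_in_H)
        have pH: "p \<in> H x" unfolding p by (rule E.m_in_H) (use abc ug gH in simp_all)
        have qH: "q \<in> H (t - x)" unfolding qc by (rule E.m_in_H) (use abc ugc gH in simp_all)
        have G: "m (x - a) (c - x) g g' \<in> M (c - a)"
          by (rule E.m_in_G) (use abc ug ugc in simp_all)
        have 1: "m x (t - x) p q = m a (t - a) u (m (x - a) (t - x) g q)"
          unfolding p by (rule E.m_assoc[symmetric]) (use abc ug gH qH in simp_all)
        have 2: "m (x - a) (t - x) g q = m (c - a) (t - c) (m (x - a) (c - x) g g') u'"
          unfolding qc by (rule E.m_assoc) (use abc ug gH ugc in \<open>simp_all add: E.G_in_H\<close>)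
        show ?thesis
        proof (rule local_spaceI[of _ _ a _ c])
          show "m x (t - x) p q \<in> H t" by (rule E.m_in_H) (use abc pH qH in simp_all)
          fix z assume "z \<in> F.left_part t a" "z \<in> F.right_part t c"
          then have z: "z \<in> closed_span {n a (t - a) k (n (c - a) (t - c) y l) | k y l.
              k \<in> N a \<and> y \<in> K (c - a) \<and> l \<in> N (t - c)}" (is "z \<in> closed_span ?Z")
            using F.left_part_Int_right_part[of a c t] abc by auto
          show "\<tau> (m x (t - x) p q) z \<in> J t"
          proof (rule J_closed_span_right[OF t _ z])
            fix w assume "w \<in> ?Z"
            then obtain k y l where w: "w = n a (t - a) k (n (c - a) (t - c) y l)"
              and kyl: "k \<in> N a" "y \<in> K (c - a)" "l \<in> N (t - c)" by blast
            have i: "m (c - a) (t - c) (m (x - a) (c - x) g g') u' \<in> H (t - a)"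
              by (rule E.m_in_H) (use abc ugc G in \<open>simp_all add: E.G_in_H\<close>)
            have ii: "n (c - a) (t - c) y l \<in> K (t - a)"
              by (rule F.m_in_H) (use abc kyl in \<open>simp_all add: F.G_in_H\<close>)
            have iii: "\<tau> (m (c - a) (t - c) (m (x - a) (c - x) g g') u') (n (c - a) (t - c) y l) \<in> J (t - a)"
              by (rule J_mult') (use abc ugc G kyl in \<open>simp_all add: E.G_in_H F.G_in_H J_left J_right\<close>)
            show "\<tau> (m x (t - x) p q) w \<in> J t"
              unfolding 1 2 w
              by (rule J_mult'[OF _ _ _ _ _ i ii _ iii]) (use abc ug kyl in \<open>simp_all add: F.G_in_H J_right\<close>)
          qed
        qed (use abc in auto)
      qed
      then have "{m x (t - x) p q | p q. p \<in> ?P \<and> q \<in> ?Q} \<subseteq> local_space t x" by blast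
      moreover have "closed_span {m x (t - x) p q | p q. p \<in> ?P \<and> q \<in> ?Q} = H t"
        by (intro E.closed_span_mult_eq_H E.left_germ_dense E.right_germ_dense) (use 3 in auto)
      ultimately show ?thesis by blast
    qed
  qed
  then obtain X where X: "X \<subseteq> local_space t x" "closed_span X = H t" by blast
  have "cvec.span X \<subseteq> local_space t x" by (intro cvec.span_minimal X subspace_local_space t)
  then show ?thesis using X(2) closure_mono by blast
qed

text \<open>
  Let \<open>A s\<close> be the projection of \<open>z\<close> to \<open>left_part t s\<close>. The increments \<open>A a - A b\<close> over disjoint
  intervals are orthogonal, and each is in \<open>N\<close> outside its interval. On a short interval, \<open>\<tau> e (A a - A b)\<close>
  differs from an element of \<open>J\<close> by a vector that is small relative to the increment, and the errors
  add up orthogonally.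
\<close>

lemma pair_near_J:
  assumes t: "0 < t" and e: "e \<in> H t" and z: "z \<in> K t"
    and prime: "\<And>r x y. 0 < r \<Longrightarrow> r < t \<Longrightarrow> x \<in> K r \<ominus> N r \<Longrightarrow> y \<in> K (t - r) \<ominus> N (t - r) \<Longrightarrow>
      cinner (n r (t - r) x y) z = 0"
    and d: "0 < d"
  shows "\<exists>v. \<tau> e z - v \<in> J t \<and> norm v \<le> d * norm (z - orth_proj (N t) z)"
proof -
  define A where "A s = orth_proj (F.left_part t s) z" for s
  note L = F.subspace_left_part[OF t] F.closed_left_part[OF t]
  have AL: "A s \<in> F.left_part t s" for s unfolding A_def by (rule orth_proj_in[OF L])
  have A_in: "A a - A b \<in> F.left_part t a" if "a \<le> b" for a b
    using AL[of a] AL[of b] F.left_part_antimono[OF t that] by (intro cvec.subspace_diff L) auto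
  have A_orth: "cinner y (A a - A b) = 0" if "a \<le> b" "y \<in> F.left_part t b" for a b y
  proof -
    have "cinner y (z - A b) = 0" "cinner y (z - A a) = 0"
      using that F.left_part_antimono[OF t that(1)] unfolding A_def by (auto intro: orth_proj_orthogonal[OF L])
    then show ?thesis by (simp add: cinner_diff_right)
  qed
  have A_right: "A a - A b \<in> F.right_part t b" if "a \<le> b" for a b
  proof -
    have b: "z - A b \<in> F.right_part t b" and "z - A a \<in> F.right_part t a"
      unfolding A_def by (rule F.diff_orth_proj_left_part[OF t z prime]; assumption)+
    then have a: "z - A a \<in> F.right_part t b" using F.right_part_mono[OF t that] by blast
    have "(z - A b) - (z - A a) \<in> F.right_part t b"
      by (rule cvec.subspace_diff[OF F.subspace_right_part[OF t] b a])
    then show ?thesis by simp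
  qed
  \<comment> \<open>The error for an interval \<open>[a, b]\<close> is in the closed span of \<open>V a\<close> and orthogonal to \<open>V b\<close>.\<close>
  define V where "V a = {\<tau> x y | x y. y \<in> F.left_part t a}" for a
  have V_antimono: "closed_span (V b) \<subseteq> closed_span (V a)" if "a \<le> b" for a b
    unfolding V_def using F.left_part_antimono[OF t that] by (intro closure_mono cvec.span_mono) blast
  define P where "P a b \<longleftrightarrow> (\<exists>v. v \<in> closed_span (V a) \<and> (\<forall>w\<in>V b. cinner w v = 0) \<and>
    \<tau> e (A a - A b) - v \<in> J t \<and> norm v \<le> d * norm (A a - A b))" for a b
  \<comment> \<open>\<open>P\<close> is additive over adjacent intervals because the errors \<open>v\<close> are orthogonal to each other.\<close>
  have "0 \<le> t" using t by simp
  then have "P 0 t"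
  proof (induction rule: Bolzano)
    case (trans a b c)
    obtain v where v: "v \<in> closed_span (V a)" "\<And>w. w \<in> V b \<Longrightarrow> cinner w v = 0"
        "\<tau> e (A a - A b) - v \<in> J t" "norm v \<le> d * norm (A a - A b)"
      using trans(1) unfolding P_def by blast
    obtain w where w: "w \<in> closed_span (V b)" "\<And>u. u \<in> V c \<Longrightarrow> cinner u w = 0"
        "\<tau> e (A b - A c) - w \<in> J t" "norm w \<le> d * norm (A b - A c)"
      using trans(2) unfolding P_def by blast
    have "cinner w v = 0" by (rule orthogonal_closed_span_left[OF v(2) w(1)])
    then have vw: "orthogonal v w" by (simp add: orthogonal_def inner_eq_Re_cinner cinner_eq_0_commute)
    have "cinner (A b - A c) (A a - A b) = 0" by (rule A_orth[OF trans(3) A_in[OF trans(4)]])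
    then have AA: "orthogonal (A a - A b) (A b - A c)"
      by (simp add: orthogonal_def inner_eq_Re_cinner cinner_eq_0_commute)
    have "(norm (v + w))\<^sup>2 = (norm v)\<^sup>2 + (norm w)\<^sup>2" by (rule norm_add_Pythagorean[OF vw])
    also have "\<dots> \<le> (d * norm (A a - A b))\<^sup>2 + (d * norm (A b - A c))\<^sup>2"
      using v(4) w(4) by (intro add_mono power_mono) simp_all
    also have "\<dots> = d\<^sup>2 * ((norm (A a - A b))\<^sup>2 + (norm (A b - A c))\<^sup>2)"
      by (simp add: power_mult_distrib distrib_left)
    also have "\<dots> = d\<^sup>2 * (norm ((A a - A b) + (A b - A c)))\<^sup>2"
      using norm_add_Pythagorean[OF AA] by simp
    also have "\<dots> = (d * norm (A a - A c))\<^sup>2" by (simp add: power_mult_distrib)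
    finally have norm: "norm (v + w) \<le> d * norm (A a - A c)"
      by (rule power2_le_imp_le) (use d in simp)
    have "\<tau> e (A a - A c) - (v + w) = (\<tau> e (A a - A b) - v) + (\<tau> e (A b - A c) - w)"
      by (simp add: \<tau>_diff_right)
    then have J: "\<tau> e (A a - A c) - (v + w) \<in> J t"
      using cvec.subspace_add[OF subspace_J[OF t] v(3) w(3)] by (rule ssubst)
    have "V c \<subseteq> V b" unfolding V_def using F.left_part_antimono[OF t trans(4)] by blast
    then have "\<forall>u\<in>V c. cinner u (v + w) = 0" using v(2) w(2) by (auto simp: cinner_add_right)
    moreover have "v + w \<in> closed_span (V a)"
      using v(1) w(1) V_antimono[OF trans(3)] by (intro cvec.subspace_add subspace_closed_span) auto
    ultimately show "P a c" unfolding P_def using J norm by blast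
  next
    case (local x)
    obtain e' where e': "e' \<in> local_space t x" "norm (e - e') < d"
      using local_space_dense[OF t local] e d unfolding closure_approachable
      by (metis closure_approachable dist_commute dist_norm subsetD)
    then obtain a' b' where ab: "a' < x" "x < b'"
        "\<And>z. z \<in> F.left_part t a' \<inter> F.right_part t b' \<Longrightarrow> \<tau> e' z \<in> J t"
      unfolding local_space_def by blast
    show ?case
    proof (intro exI[of _ "min (x - a') (b' - x)"] conjI allI impI)
      show "0 < min (x - a') (b' - x)" using ab by simp
      fix a b assume h: "a \<le> x \<and> x \<le> b \<and> b - a < min (x - a') (b' - x)"
      then have le: "a' \<le> a" "a \<le> b" "b \<le> b'" by linarith+
      have "A a - A b \<in> F.left_part t a'" using A_in[OF le(2)] F.left_part_antimono[OF t le(1)] by blast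
      moreover have "A a - A b \<in> F.right_part t b'" using A_right[OF le(2)] F.right_part_mono[OF t le(3)] by blast
      ultimately have J: "\<tau> e' (A a - A b) \<in> J t" using ab(3) by blast
      show "P a b" unfolding P_def
      proof (intro exI[of _ "\<tau> (e - e') (A a - A b)"] conjI ballI)
        show "\<tau> (e - e') (A a - A b) \<in> closed_span (V a)"
          unfolding V_def using A_in[OF le(2)] by (blast intro: closed_span_superset)
        show "\<tau> e (A a - A b) - \<tau> (e - e') (A a - A b) \<in> J t" using J by (simp add: \<tau>_diff_left)
        show "norm (\<tau> (e - e') (A a - A b)) \<le> d * norm (A a - A b)"
          unfolding norm_\<tau> using e'(2) by (intro mult_right_mono) simp_all
        fix w assume "w \<in> V b"
        then show "cinner w (\<tau> (e - e') (A a - A b)) = 0"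
          using A_orth[OF le(2)] by (auto simp: V_def cinner_\<tau>)
      qed
    qed
  qed
  then obtain v where v: "\<tau> e (A 0 - A t) - v \<in> J t" "norm v \<le> d * norm (A 0 - A t)"
    unfolding P_def by blast
  have "A 0 = z" unfolding A_def using z by (intro orth_proj_unique L) (simp_all add: F.left_part_def)
  moreover have At: "A t = orth_proj (N t) z" using t by (simp add: A_def F.left_part_def)
  moreover have "\<tau> e (A t) \<in> J t"
    unfolding At using F.subspace_G[OF t] F.closed_G[OF t] by (intro J_right t e orth_proj_in)
  ultimately have "\<tau> e z - v \<in> J t"
    using cvec.subspace_add[OF subspace_J[OF t] v(1), of "\<tau> e (A t)"] by (simp add: \<tau>_diff_right)
  then show ?thesis using v(2) \<open>A 0 = z\<close> At by auto
qed

text \<open>As \<open>J t\<close> is closed, the error may tend to 0.\<close>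

lemma pair_in_J:
  assumes t: "0 < t" and e: "e \<in> H t" and z: "z \<in> K t"
    and prime: "\<And>r x y. 0 < r \<Longrightarrow> r < t \<Longrightarrow> x \<in> K r \<ominus> N r \<Longrightarrow> y \<in> K (t - r) \<ominus> N (t - r) \<Longrightarrow>
      cinner (n r (t - r) x y) z = 0"
  shows "\<tau> e z \<in> J t"
proof -
  define c where "c = norm (z - orth_proj (N t) z)"
  have "\<exists>y\<in>J t. dist y (\<tau> e z) < \<epsilon>" if \<epsilon>: "\<epsilon> > 0" for \<epsilon>
  proof -
    have c: "0 \<le> c" by (simp add: c_def)
    then have "0 < \<epsilon> / (c + 1)" using \<epsilon> by simp
    from pair_near_J[OF t e z prime this]
    obtain v where v: "\<tau> e z - v \<in> J t" "norm v \<le> \<epsilon> / (c + 1) * c"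
      unfolding c_def by blast
    have "\<epsilon> / (c + 1) * c < \<epsilon>" using \<epsilon> c by (simp add: field_simps)
    then have "dist (\<tau> e z - v) (\<tau> e z) < \<epsilon>" using v(2) by (simp add: dist_norm)
    then show ?thesis using v(1) by blast
  qed
  then have "\<tau> e z \<in> closure (J t)" by (simp add: closure_approachable)
  then show ?thesis using closed_J[OF t] by (simp add: closure_closed)
qed

text \<open>The vectors whose pairing with the whole fibre is in \<open>J\<close> form a multiplicative family of closed subspaces.\<close>

definition absorbed :: "real \<Rightarrow> 'b set"
  where "absorbed t = {z \<in> K t. \<forall>e\<in>H t. \<tau> e z \<in> J t}"

lemma
  assumes t: "0 < t"
  shows subspace_absorbed: "cvec.subspace (absorbed t)" and closed_absorbed: "closed (absorbed t)"
proof -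
  have sub: "closed_span (absorbed t) \<subseteq> absorbed t"
  proof
    fix z assume z: "z \<in> closed_span (absorbed t)"
    have "closed_span (absorbed t) \<subseteq> K t"
      by (intro closed_span_minimal F.closed_H F.subspace_H t) (auto simp: absorbed_def)
    moreover have "\<tau> e z \<in> J t" if "e \<in> H t" for e
      by (rule J_closed_span_right[OF t _ z]) (use that in \<open>auto simp: absorbed_def\<close>)
    ultimately show "z \<in> absorbed t" using z by (auto simp: absorbed_def)
  qed
  then have "closed_span (absorbed t) = absorbed t" by (auto intro: closed_span_superset)
  then show "cvec.subspace (absorbed t)" "closed (absorbed t)"
    using subspace_closed_span[of "absorbed t"] closed_closure[of "cvec.span (absorbed t)"] by simp_all
qed

lemma absorbed_mult:
  assumes st: "0 < s" "0 < t" and yz: "y \<in> absorbed s" "z \<in> absorbed t"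
  shows "n s t y z \<in> absorbed (s + t)"
proof -
  have yzK: "y \<in> K s" "z \<in> K t" using yz by (auto simp: absorbed_def)
  have "\<tau> e (n s t y z) \<in> J (s + t)" if "e \<in> H (s + t)" for e
  proof (rule J_closed_span_left)
    show "e \<in> closed_span {m s t p q | p q. p \<in> H s \<and> q \<in> H t}" using that E.total[OF st] by simp
    fix w assume "w \<in> {m s t p q | p q. p \<in> H s \<and> q \<in> H t}"
    then obtain p q where "w = m s t p q" "p \<in> H s" "q \<in> H t" by blast
    then show "\<tau> w (n s t y z) \<in> J (s + t)"
      using J_mult[OF st _ yzK(1) _ yzK(2)] yz by (simp add: absorbed_def)
  qed (use st in simp)
  moreover have "n s t y z \<in> K (s + t)" by (rule F.m_in_H) (use st yzK in simp_all)
  ultimately show ?thesis by (simp add: absorbed_def)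
qed

end

section \<open>Families generated under multiplication\<close>

lemma generated_superset:
  assumes "0 < t" "x \<in> A t"
  shows "x \<in> generated E A t"
proof -
  have "iter_prod E [(t, x)] \<in> generated E A t"
    unfolding generated_def
  proof (intro closed_span_superset CollectI exI conjI)
    show "iter_prod E [(t, x)] = iter_prod E [(t, x)]" ..
  qed (use assms in auto)
  then show ?thesis by simp
qed

lemma subspace_generated: "cvec.subspace (generated E A t)" and closed_generated: "closed (generated E A t)"
  unfolding generated_def by (simp_all add: subspace_closed_span)

lemma iter_prod_Cons:
  "ps \<noteq> [] \<Longrightarrow> iter_prod E ((t, x) # ps) = mul E t (sum_list (map fst ps)) (x \<otimes> iter_prod E ps)"
  by (cases ps) auto

lemma iter_prod_in:
  assumes A: "\<And>t x. 0 < t \<Longrightarrow> x \<in> A t \<Longrightarrow> x \<in> S t"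
    and mult: "\<And>s t x y. 0 < s \<Longrightarrow> 0 < t \<Longrightarrow> x \<in> S s \<Longrightarrow> y \<in> S t \<Longrightarrow> mul E s t (x \<otimes> y) \<in> S (s + t)"
    and ps: "ps \<noteq> []" "\<forall>(s, x)\<in>set ps. 0 < s \<and> x \<in> A s"
  shows "0 < sum_list (map fst ps)" "iter_prod E ps \<in> S (sum_list (map fst ps))"
proof -
  have "0 < sum_list (map fst ps) \<and> iter_prod E ps \<in> S (sum_list (map fst ps))"
    using ps
  proof (induction ps rule: list_nonempty_induct)
    case (single p)
    then show ?case using A by (cases p) auto
  next
    case (cons p ps)
    obtain t x where p: "p = (t, x)" by (cases p)
    have "0 < t" "x \<in> S t" using cons.prems A by (auto simp: p)
    moreover have "0 < sum_list (map fst ps)" "iter_prod E ps \<in> S (sum_list (map fst ps))"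
      using cons.IH cons.prems by auto
    ultimately show ?case using cons.hyps mult by (simp add: p iter_prod_Cons)
  qed
  then show "0 < sum_list (map fst ps)" "iter_prod E ps \<in> S (sum_list (map fst ps))" by auto
qed

lemma generated_subset:
  assumes S: "\<And>t. 0 < t \<Longrightarrow> cvec.subspace (S t)" "\<And>t. 0 < t \<Longrightarrow> closed (S t)"
    and A: "\<And>t x. 0 < t \<Longrightarrow> x \<in> A t \<Longrightarrow> x \<in> S t"
    and mult: "\<And>s t x y. 0 < s \<Longrightarrow> 0 < t \<Longrightarrow> x \<in> S s \<Longrightarrow> y \<in> S t \<Longrightarrow> mul E s t (x \<otimes> y) \<in> S (s + t)"
    and t: "0 < t"
  shows "generated E A t \<subseteq> S t"
  unfolding generated_def
  by (rule closed_span_minimal[OF _ S(2)[OF t] S(1)[OF t]]) (use iter_prod_in(2)[where A = A and S = S, OF A mult] in blast)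

context
  fixes E :: "'a::chilbert_space psys"
  assumes E: "product_system E"
begin

lemma graded_multiplication_product_system:
  "graded_multiplication (fibre E) (\<lambda>s t x y. mul E s t (x \<otimes> y))"
proof
  fix s t :: real assume st: "0 < s" "0 < t"
  note U = product_systemD(4)[OF E st]
  show "lin_cont (fibre E s) (\<lambda>x. mul E s t (x \<otimes> y))" if "y \<in> fibre E t" for y
    by (rule lin_cont_mul(1)[OF U that])
  show "lin_cont (fibre E t) (\<lambda>y. mul E s t (x \<otimes> y))" if "x \<in> fibre E s" for x
    by (rule lin_cont_mul(2)[OF U that])
  show "cinner (mul E s t (x \<otimes> y)) (mul E s t (x' \<otimes> y')) = cinner x x' * cinner y y'"
    if "x \<in> fibre E s" "x' \<in> fibre E s" "y \<in> fibre E t" "y' \<in> fibre E t" for x x' y y'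
    using unitary_betweenD(3)[OF U tensor_space_I[OF that(1,3)] tensor_space_I[OF that(2,4)]]
    by (simp add: cinner_tensor)
  have "mul E s t ` {x \<otimes> y | x y. x \<in> fibre E s \<and> y \<in> fibre E t}
      = {mul E s t (x \<otimes> y) | x y. x \<in> fibre E s \<and> y \<in> fibre E t}" by blast
  then show "closed_span {mul E s t (x \<otimes> y) | x y. x \<in> fibre E s \<and> y \<in> fibre E t} = fibre E (s + t)"
    using unitary_image_closed_span[OF U[unfolded tensor_space_def]] product_systemD(2)[OF E, of "s + t"] st
    by (simp add: closure_closed)
next
  fix t :: real assume t: "0 < t"
  show "\<exists>D. countable D \<and> closed_span D = fibre E t"
    using product_systemD(6)[OF E t] by (intro exI[of _ "range (\<lambda>n. sec E n t)"]) simp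
qed (use product_systemD[OF E] in auto)

lemma graded_subsystem_product_subsystem:
  assumes G: "product_subsystem E G"
  shows "graded_subsystem (fibre E) (\<lambda>s t x y. mul E s t (x \<otimes> y)) G"
proof -
  interpret graded_multiplication "fibre E" "\<lambda>s t x y. mul E s t (x \<otimes> y)"
    by (rule graded_multiplication_product_system)
  show ?thesis
  proof
    show "cvec.subspace (G t)" "closed (G t)" "G t \<noteq> {0}" "G t \<subseteq> fibre E t" if "0 < t" for t
      using G that unfolding product_subsystem_def by blast+
    fix s t :: real assume st: "0 < s" "0 < t"
    have U: "unitary_between (mul E s t) (G s \<otimes>\<^sub>H G t) (G (s + t))" and cl: "closed (G (s + t))"
      using G st unfolding product_subsystem_def by simp_all
    have "mul E s t ` {x \<otimes> y | x y. x \<in> G s \<and> y \<in> G t} = {mul E s t (x \<otimes> y) | x y. x \<in> G s \<and> y \<in> G t}" by blast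
    then show "closed_span {mul E s t (x \<otimes> y) | x y. x \<in> G s \<and> y \<in> G t} = G (s + t)"
      using unitary_image_closed_span[OF U[unfolded tensor_space_def]] cl by (simp add: closure_closed)
  qed
qed

lemma generated_subset_fibre:
  assumes "\<And>t. 0 < t \<Longrightarrow> A t \<subseteq> fibre E t" "0 < t"
  shows "generated E A t \<subseteq> fibre E t"
  by (rule generated_subset) (use assms product_systemD(1,2)[OF E] mul_in_fibre[OF E] in auto)

lemma iter_prod_append:
  assumes A: "\<And>t. 0 < t \<Longrightarrow> A t \<subseteq> fibre E t"
    and ps: "ps \<noteq> []" "\<forall>(s, x)\<in>set ps. 0 < s \<and> x \<in> A s"
    and qs: "qs \<noteq> []" "\<forall>(s, x)\<in>set qs. 0 < s \<and> x \<in> A s"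
  shows "mul E (sum_list (map fst ps)) (sum_list (map fst qs)) (iter_prod E ps \<otimes> iter_prod E qs) = iter_prod E (ps @ qs)"
  using ps
proof (induction ps rule: list_nonempty_induct)
  case (single p)
  then show ?case using qs(1) by (cases p) (simp add: iter_prod_Cons)
next
  case (cons p ps)
  obtain t x where p: "p = (t, x)" by (cases p)
  have in_fibre: "0 < sum_list (map fst rs)" "iter_prod E rs \<in> fibre E (sum_list (map fst rs))"
    if "rs \<noteq> []" "\<forall>(s, x)\<in>set rs. 0 < s \<and> x \<in> A s" for rs
    using iter_prod_in[of A "fibre E" E, OF _ _ that] A mul_in_fibre[OF E] by blast+
  have tx: "0 < t" "x \<in> fibre E t" and ps: "\<forall>(s, x)\<in>set ps. 0 < s \<and> x \<in> A s"
    using cons.prems A by (auto simp: p)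
  show ?case
    using product_systemD(5)[OF E tx(1) in_fibre(1)[OF cons.hyps ps] in_fibre(1)[OF qs] tx(2)
        in_fibre(2)[OF cons.hyps ps] in_fibre(2)[OF qs]] cons.IH[OF ps] cons.hyps
    by (simp add: p iter_prod_Cons)
qed

lemma generated_mult:
  assumes A: "\<And>t. 0 < t \<Longrightarrow> A t \<subseteq> fibre E t" and st: "0 < s" "0 < t"
    and xy: "x \<in> generated E A s" "y \<in> generated E A t"
  shows "mul E s t (x \<otimes> y) \<in> generated E A (s + t)"
proof -
  interpret graded_multiplication "fibre E" "\<lambda>s t x y. mul E s t (x \<otimes> y)"
    by (rule graded_multiplication_product_system)
  let ?X = "\<lambda>t. {iter_prod E ps | ps. ps \<noteq> [] \<and> (\<forall>(s, x)\<in>set ps. 0 < s \<and> x \<in> A s) \<and> sum_list (map fst ps) = t}"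
  have X: "?X t \<subseteq> fibre E t" if "0 < t" for t
    using generated_subset_fibre[OF A that] closed_span_superset[of _ "?X t"] unfolding generated_def by blast
  show ?thesis
  proof (rule m_closed_span[OF st X[OF st(1)] X[OF st(2)] subspace_generated closed_generated])
    show "x \<in> closed_span (?X s)" "y \<in> closed_span (?X t)" using xy by (simp_all add: generated_def)
    fix x y assume "x \<in> ?X s" "y \<in> ?X t"
    then obtain ps qs where ps: "x = iter_prod E ps" "ps \<noteq> []" "\<forall>(s, x)\<in>set ps. 0 < s \<and> x \<in> A s" "sum_list (map fst ps) = s"
      and qs: "y = iter_prod E qs" "qs \<noteq> []" "\<forall>(s, x)\<in>set qs. 0 < s \<and> x \<in> A s" "sum_list (map fst qs) = t"
      by blast
    have "mul E s t (x \<otimes> y) = iter_prod E (ps @ qs)"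
      using iter_prod_append[OF A ps(2,3) qs(2,3)] ps qs by simp
    moreover have "iter_prod E (ps @ qs) \<in> generated E A (s + t)"
      unfolding generated_def using ps qs
      by (intro closed_span_superset CollectI exI[of _ "ps @ qs"]) auto
    ultimately show "mul E s t (x \<otimes> y) \<in> generated E A (s + t)" by simp
  qed
qed

section \<open>Clusters\<close>

lemma cluster_prime_orthogonal:
  assumes "z \<in> cluster_prime E G t" "0 < r" "r < t"
    and "x \<in> fibre E r \<ominus> G r" "y \<in> fibre E (t - r) \<ominus> G (t - r)"
  shows "cinner (mul E r (t - r) (x \<otimes> y)) z = 0"
proof -
  have "mul E r (t - r) (x \<otimes> y) \<in> cluster_tilde E G t"
    unfolding cluster_tilde_def using assms(2-) by (intro closed_span_superset) blast
  then show ?thesis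
    using assms(1) by (subst cinner_eq_0_commute) (simp add: cluster_prime_def orth_in_def)
qed

lemma subsystem_subset_cluster_prime:
  assumes G: "product_subsystem E G" and t: "0 < t"
  shows "G t \<subseteq> cluster_prime E G t"
proof
  interpret graded_subsystem "fibre E" "\<lambda>s t x y. mul E s t (x \<otimes> y)" G
    by (rule graded_subsystem_product_subsystem[OF G])
  fix g assume g: "g \<in> G t"
  have "cinner g z = 0" if z: "z \<in> cluster_tilde E G t" for z
  proof (rule orthogonal_closed_span[OF _ z[unfolded cluster_tilde_def]])
    fix w assume "w \<in> {mul E r (t - r) (x \<otimes> y) | r x y.
      0 < r \<and> r < t \<and> x \<in> fibre E r \<ominus> G r \<and> y \<in> fibre E (t - r) \<ominus> G (t - r)}"
    then obtain r x y where w: "w = mul E r (t - r) (x \<otimes> y)" and r: "0 < r" "r < t"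
      and xy: "x \<in> fibre E r \<ominus> G r" "y \<in> fibre E (t - r) \<ominus> G (t - r)" by blast
    show "cinner g w = 0"
    proof (rule orthogonal_closed_span_left)
      show "g \<in> closed_span {mul E r (t - r) (p \<otimes> q) | p q. p \<in> G r \<and> q \<in> G (t - r)}"
        using g total_G[of r "t - r"] r by simp
      fix v assume "v \<in> {mul E r (t - r) (p \<otimes> q) | p q. p \<in> G r \<and> q \<in> G (t - r)}"
      then obtain p q where v: "v = mul E r (t - r) (p \<otimes> q)" "p \<in> G r" "q \<in> G (t - r)" by blast
      have "cinner v w = cinner p x * cinner q y"
        unfolding v(1) w by (rule cinner_m) (use r v xy in \<open>simp_all add: G_in_H orth_in_def\<close>)
      moreover have "cinner p x = 0" using xy(1) v(2) by (subst cinner_eq_0_commute) (simp add: orth_in_def)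
      ultimately show "cinner v w = 0" by simp
    qed
  qed
  then show "g \<in> cluster_prime E G t" using G_in_H[OF t g] by (simp add: cluster_prime_def orth_in_def)
qed

lemma subsystem_subset_cluster:
  assumes G: "product_subsystem E G" and t: "0 < t"
  shows "G t \<subseteq> cluster E G t"
  using subsystem_subset_cluster_prime[OF G t] generated_superset[OF t] unfolding cluster_def by blast

lemma cluster_subset_fibre:
  assumes "0 < t" shows "cluster E G t \<subseteq> fibre E t"
  unfolding cluster_def
  by (rule generated_subset_fibre[OF _ assms]) (auto simp: cluster_prime_def orth_in_def)

end

text \<open>Since \<open>absorbed\<close> is closed under multiplication, it suffices to treat the generators of the cluster.\<close>

lemma (in subsystem_pairing) cluster_subset_absorbed:
  assumes F: "K = fibre F" "n = (\<lambda>s t x y. mul F s t (x \<otimes> y))" "product_system F" and t: "0 < t"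
  shows "cluster F N t \<subseteq> absorbed t"
  unfolding cluster_def
proof (rule generated_subset[OF subspace_absorbed closed_absorbed _ _ t])
  fix t z assume t: "0 < t" and z: "z \<in> cluster_prime F N t"
  have zK: "z \<in> K t" using z by (simp add: F cluster_prime_def orth_in_def)
  have "\<tau> e z \<in> J t" if "e \<in> H t" for e
    by (rule pair_in_J[OF t that zK]) (use cluster_prime_orthogonal[OF F(3) z] F in auto)
  then show "z \<in> absorbed t" using zK by (simp add: absorbed_def)
next
  fix s t y z assume "0 < s" "0 < t" "y \<in> absorbed s" "z \<in> absorbed t"
  from absorbed_mult[OF this] show "mul F s t (y \<otimes> z) \<in> absorbed (s + t)" by (simp add: F(2))
qed

section \<open>The join in the tensor product\<close>

lemma tensor_space_mono: "G \<subseteq> G' \<Longrightarrow> H \<subseteq> H' \<Longrightarrow> G \<otimes>\<^sub>H H \<subseteq> G' \<otimes>\<^sub>H H'"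
  unfolding tensor_space_def by (intro closure_mono cvec.span_mono) blast

lemma tensor_space_subset:
  assumes "cvec.subspace S" "closed S" "\<And>x y. x \<in> G \<Longrightarrow> y \<in> H \<Longrightarrow> x \<otimes> y \<in> S"
  shows "G \<otimes>\<^sub>H H \<subseteq> S"
  unfolding tensor_space_def by (rule closed_span_minimal) (use assms in auto)

theorem theorem4p1:
  fixes E :: "'a::chilbert_space psys" and F :: "'b::chilbert_space psys"
    and M :: "real \<Rightarrow> 'a set" and N :: "real \<Rightarrow> 'b set"
  assumes "product_system E" and "product_system F"
    and "product_subsystem E M" and "product_subsystem F N"
  shows "\<forall>t>0.
    join (tensor_psys E F) (tensor_family (fibre E) N) (tensor_family M (fibre F)) t =
    join (tensor_psys E F)
      (tensor_family (fibre E) (cluster F N)) (tensor_family (cluster E M) (fibre F)) t"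
proof (intro allI impI antisym)
  let ?T = "tensor_psys E F"
  define A where "A = (\<lambda>t. tensor_family (fibre E) N t \<union> tensor_family M (fibre F) t)"
  define B where "B = (\<lambda>t. tensor_family (fibre E) (cluster F N) t \<union> tensor_family (cluster E M) (fibre F) t)"
  define J where "J = generated ?T A"
  note T = product_system_tensor[OF assms(1,2)]
  have fibT: "fibre ?T t = fibre E t \<otimes>\<^sub>H fibre F t" for t by (simp add: tensor_psys_def tensor_family_def)
  have mulT: "mul ?T = tensor_mul E F" by (simp add: tensor_psys_def)
  interpret E: graded_subsystem "fibre E" "\<lambda>s t x y. mul E s t (x \<otimes> y)" M
    by (rule graded_subsystem_product_subsystem[OF assms(1,3)])
  interpret F: graded_subsystem "fibre F" "\<lambda>s t x y. mul F s t (x \<otimes> y)" N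
    by (rule graded_subsystem_product_subsystem[OF assms(2,4)])
  have A_fibre: "A t \<subseteq> fibre ?T t" if "0 < t" for t
    unfolding fibT tensor_family_def A_def using E.G_subset_H[OF that] F.G_subset_H[OF that]
    by (intro Un_least tensor_space_mono) auto
  have A_J: "A t \<subseteq> J t" if "0 < t" for t
    unfolding J_def by (intro subsetI generated_superset that)
  have J_mult: "mul E s t (x \<otimes> x') \<otimes> mul F s t (y \<otimes> y') \<in> J (s + t)"
    if "0 < s" "0 < t" "x \<in> fibre E s" "y \<in> fibre F s" "x' \<in> fibre E t" "y' \<in> fibre F t"
      "x \<otimes> y \<in> J s" "x' \<otimes> y' \<in> J t" for s t x y x' y'
    using generated_mult[OF T A_fibre that(1,2) that(7,8)[unfolded J_def]]
      tensor_mul_eq[OF assms(1,2) that(1-6)] by (simp add: J_def mulT)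
  have J_right: "x \<otimes> y \<in> J t" if "0 < t" "x \<in> fibre E t" "y \<in> N t" for t x y
    using A_J[OF that(1)] tensor_space_I[OF that(2,3)] by (auto simp: tensor_family_def A_def)
  have J_left: "x \<otimes> y \<in> J t" if "0 < t" "x \<in> M t" "y \<in> fibre F t" for t x y
    using A_J[OF that(1)] tensor_space_I[OF that(2,3)] by (auto simp: tensor_family_def A_def)
  have J_sub: "cvec.subspace (J t)" "closed (J t)" for t
    by (simp_all add: J_def subspace_generated closed_generated)
  interpret EF: subsystem_pairing "fibre E" "\<lambda>s t x y. mul E s t (x \<otimes> y)" M
    "fibre F" "\<lambda>s t x y. mul F s t (x \<otimes> y)" N "(\<otimes>)" J
    by unfold_locales (auto simp: cinner_tensor lin_cont_tensor J_sub intro: J_mult J_right J_left)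
  interpret FE: subsystem_pairing "fibre F" "\<lambda>s t x y. mul F s t (x \<otimes> y)" N
    "fibre E" "\<lambda>s t x y. mul E s t (x \<otimes> y)" M "\<lambda>y x. x \<otimes> y" J
    by unfold_locales (auto simp: cinner_tensor lin_cont_tensor J_sub intro: J_mult J_right J_left)
  fix t :: real assume t: "0 < t"
  have B_J: "B t \<subseteq> J t" if t: "0 < t" for t
  proof -
    have "fibre E t \<otimes>\<^sub>H cluster F N t \<subseteq> J t"
      using EF.cluster_subset_absorbed[OF refl refl assms(2) t]
      by (intro tensor_space_subset J_sub) (auto simp: EF.absorbed_def)
    moreover have "cluster E M t \<otimes>\<^sub>H fibre F t \<subseteq> J t"
      using FE.cluster_subset_absorbed[OF refl refl assms(1) t]
      by (intro tensor_space_subset J_sub) (auto simp: FE.absorbed_def)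
    ultimately show ?thesis by (simp add: tensor_family_def B_def)
  qed
  have "generated ?T B t \<subseteq> J t"
    using B_J generated_mult[OF T A_fibre] by (intro generated_subset J_sub t) (auto simp: J_def)
  then show "join ?T (tensor_family (fibre E) (cluster F N)) (tensor_family (cluster E M) (fibre F)) t
      \<subseteq> join ?T (tensor_family (fibre E) N) (tensor_family M (fibre F)) t"
    by (simp add: J_def join_def A_def B_def)
  have B_fibre: "B t \<subseteq> fibre ?T t" if "0 < t" for t
    unfolding fibT tensor_family_def B_def
    using cluster_subset_fibre[OF assms(1) that] cluster_subset_fibre[OF assms(2) that]
    by (intro Un_least tensor_space_mono) auto
  have AB: "A t \<subseteq> B t" if "0 < t" for t
    unfolding tensor_family_def A_def B_def
    using subsystem_subset_cluster[OF assms(1,3) that] subsystem_subset_cluster[OF assms(2,4) that]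
    by (intro Un_mono tensor_space_mono) auto
  have "generated ?T A t \<subseteq> generated ?T B t"
  proof (rule generated_subset[OF subspace_generated closed_generated _ _ t])
    show "x \<in> generated ?T B t" if "0 < t" "x \<in> A t" for t x
      using AB[OF that(1)] that by (intro generated_superset) auto
  qed (rule generated_mult[OF T B_fibre])
  then show "join ?T (tensor_family (fibre E) N) (tensor_family M (fibre F)) t
      \<subseteq> join ?T (tensor_family (fibre E) (cluster F N)) (tensor_family (cluster E M) (fibre F)) t"
    by (simp add: join_def A_def B_def)
qed

end
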